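(* Let $\Omega\subset\mathbb{R}^2$ be a (bounded, Lipschitz) polygonal domain. For every $\theta\in[0,1]$ there exists a constant $C>0$ (depending only on $\theta$, on $\Omega$ and on the shape-regularity constant $\gamma$) such that for any mesh $\mathcal{T}$ of $\Omega$ satisfying the mesh assumption (M) with constant $\gamma$ and any degree distribution $\mathbf{p}$ on $\mathcal{T}$ satisfying the degree assumption (P) (both stated in the context), with $h,p\in L^\infty(\Omega)$ defined by $h|_K=h_K$, $p|_K=p_K$ for $K\in\mathcal{T}$, there holds $$\| h^{1-\theta} p^{-2(1-\theta)}\nabla u_h\|_{L^2(\Omega)}\le C\,\|u_h\|_{[L^2(\Omega),H^1(\Omega)]_\theta}\qquad\text{for all }u_h\in\mathcal{S}^{\mathbf{p},1}(\mathcal{T}).$$ Furthermore, the result is also valid with the discrete space $\widetilde{\mathcal{S}}^{\mathbf{p},1}(\mathcal{T})$ and the norm $\|\cdot\|_{[L^2(\Omega),\widetilde H^1(\Omega)]_\theta}$ in place of $\mathcal{S}^{\mathbf{p},1}(\mathcal{T})$ and $\|\cdot\|_{[L^2(\Omega),H^1(\Omega)]_\theta}$.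
   Context: $\widetilde H^1(\Omega)$ is the space of $u\in H^1(\Omega)$ with vanishing trace on $\partial\Omega$, with the $H^1(\Omega)$-norm. Interpolation (K-method): for Banach spaces $X_1\subset X_0$ with continuous embedding and norms $\|\cdot\|_1,\|\cdot\|_0$, set $K^2(t,u):=\inf_{v\in X_1}\|u-v\|_0^2+t^2\|v\|_1^2$ and, for $\theta\in(0,1)$, $\|u\|_{[X_0,X_1]_\theta}^2:=\int_0^\infty t^{-2\theta}K^2(t,u)\,\frac{dt}{t}$, $[X_0,X_1]_\theta:=\{u\in X_0: \|u\|_{[X_0,X_1]_\theta}<\infty\}$. For $\theta=0$ and $\theta=1$, $[X_0,X_1]_\theta$ means $X_0$ and $X_1$ respectively. Reference elements: $\widehat T\subset\mathbb{R}^2$ is the open triangle with vertices $(0,\frac{2}{\sqrt3})$, $(1,-\frac1{\sqrt3})$, $(-1,-\frac1{\sqrt3})$, and $\widehat S=(-1,1)\times(-\frac1{\sqrt3},\frac2{\sqrt3})$. A mesh $\mathcal{T}$ of $\Omega$ is a finite partition of $\Omega$ into open elements $K$ (triangles and/or quadrilaterals); $h_K$ is the diameter of $K$. Mesh assumption (M): (1) For each $K\in\mathcal{T}$ there are $\widehat K\in\{\widehat S,\widehat T\}$ and a bijective element map $F_K:\overline{\widehat K}\to\overline K$ which is $C^1(\overline{\widehat K})$. (2) The two eigenvalues $\lambda_1(x),\lambda_2(x)$ of the Gramian $F_K'(x)^\top F_K'(x)$ satisfy $\sup_{x\in\widehat K}\max\big(\frac{h_K^2}{\lambda_1(x)},\frac{\lambda_1(x)}{h_K^2},\frac{h_K^2}{\lambda_2(x)},\frac{\lambda_2(x)}{h_K^2}\big)\le\gamma$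 for a fixed constant $\gamma>0$ (the shape-regularity constant). (3) The intersection $\overline{K_1}\cap\overline{K_2}$ of two distinct elements is either empty, exactly one point, or exactly one edge; if it is an edge $e=F_{K_1}(\widehat e_j)=F_{K_2}(\widehat e_k)$ (with $\widehat e_j,\widehat e_k$ edges of the respective reference elements), then $F_{K_1}^{-1}\circ F_{K_2}|_{\widehat e_k}:\widehat e_k\to\widehat e_j$ is an affine bijection. (4) Each edge is either fully contained in $\Omega$ or in $\partial\Omega$. Discrete spaces: $\mathcal{P}^p=\mathrm{span}\{x^iy^j: 0\le i,j,\ i+j\le p\}$, $\mathcal{Q}^p=\mathrm{span}\{x^iy^j:0\le i,j\le p\}$; $\mathcal{P}^p(\widehat K)=\mathcal{P}^p$ if $\widehat K=\widehat T$ and $\mathcal{P}^p(\widehat K)=\mathcal{Q}^p$ if $\widehat K=\widehat S$. A degree distribution is a family $\mathbf{p}=(p_K)_{K\in\mathcal{T}}$ of integers $p_K\ge1$. Then $\mathcal{S}^{\mathbf{p},0}(\mathcal{T})=\{u\in L^2(\Omega): u\circ F_K\in\mathcal{P}^{p_K}(\widehat K)\ \forall K\in\mathcal{T}\}$, $\mathcal{S}^{\mathbf{p},1}(\mathcal{T})=\mathcal{S}^{\mathbf{p},0}(\mathcal{T})\cap H^1(\Omega)$, $\widetilde{\mathcal{S}}^{\mathbf{p},1}(\mathcal{T})=\mathcal{S}^{\mathbf{p},0}(\mathcal{T})\cap\widetilde H^1(\Omega)$. Degree assumption (P): whenever a triangle $T\in\mathcal{T}$ and a quadrilateral $S\in\mathcal{T}$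 share an edge, $p_T\le p_S$ or $2p_S\le p_T$. *)

theory Defs
  imports "HOL-Analysis.Analysis"
begin

section \<open>Domains\<close>

definition lipschitz_boundary :: "(real^2) set \<Rightarrow> bool" where
  "lipschitz_boundary \<Omega> \<longleftrightarrow>
     (\<forall>x\<in>frontier \<Omega>. \<exists>r>0. \<exists>L \<phi> e1 e2.
        norm e1 = 1 \<and> norm e2 = 1 \<and> e1 \<bullet> e2 = 0 \<and> L-lipschitz_on (UNIV :: real set) \<phi> \<and>
        \<Omega> \<inter> ball x r = {y \<in> ball x r. \<phi> (y \<bullet> e1) < y \<bullet> e2})"

definition lipschitz_polygonal_domain :: "(real^2) set \<Rightarrow> bool" where
  "lipschitz_polygonal_domain \<Omega> \<longleftrightarrow>
     open \<Omega> \<and> connected \<Omega> \<and> \<Omega> \<noteq> {} \<and> bounded \<Omega> \<and> lipschitz_boundary \<Omega> \<and>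
     (\<exists>E. finite E \<and> frontier \<Omega> = (\<Union>(a, b)\<in>E. closed_segment a b))"

section \<open>Lebesgue and Sobolev spaces\<close>

text \<open>Elements of function spaces are represented by functions on the whole plane, of which only
  the values almost everywhere in \<open>\<Omega>\<close> matter; the norms below are accordingly seminorms on
  representatives.\<close>

definition L2 :: "(real^2) set \<Rightarrow> (real^2 \<Rightarrow> 'b::euclidean_space) set" where
  "L2 \<Omega> = {f. f \<in> borel_measurable (lebesgue_on \<Omega>) \<and>
               integrable (lebesgue_on \<Omega>) (\<lambda>x. (norm (f x))\<^sup>2)}"

definition L2_norm :: "(real^2) set \<Rightarrow> (real^2 \<Rightarrow> 'b::euclidean_space) \<Rightarrow> real" where
  "L2_norm \<Omega> f = sqrt (\<integral>x. (norm (f x))\<^sup>2 \<partial>lebesgue_on \<Omega>)"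

primrec Ck :: "nat \<Rightarrow> (real^2 \<Rightarrow> real) \<Rightarrow> bool" where
  "Ck 0 f \<longleftrightarrow> continuous_on UNIV f"
| "Ck (Suc k) f \<longleftrightarrow>
     (\<forall>x. f differentiable (at x)) \<and> (\<forall>i. Ck k (\<lambda>x. frechet_derivative f (at x) (axis i 1)))"

definition smooth :: "(real^2 \<Rightarrow> real) \<Rightarrow> bool" where
  "smooth f \<longleftrightarrow> (\<forall>k. Ck k f)"

definition test_function :: "(real^2) set \<Rightarrow> (real^2 \<Rightarrow> real) \<Rightarrow> bool" where
  "test_function \<Omega> \<phi> \<longleftrightarrow>
     smooth \<phi> \<and> compact (closure {x. \<phi> x \<noteq> 0}) \<and> closure {x. \<phi> x \<noteq> 0} \<subseteq> \<Omega>"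

definition has_weak_gradient ::
    "(real^2) set \<Rightarrow> (real^2 \<Rightarrow> real) \<Rightarrow> (real^2 \<Rightarrow> real^2) \<Rightarrow> bool" where
  "has_weak_gradient \<Omega> u g \<longleftrightarrow>
     (\<forall>\<phi>. test_function \<Omega> \<phi> \<longrightarrow>
        (\<forall>i. (\<integral>x. u x * frechet_derivative \<phi> (at x) (axis i 1) \<partial>lebesgue_on \<Omega>)
            = - (\<integral>x. g x $ i * \<phi> x \<partial>lebesgue_on \<Omega>)))"

definition H1 :: "(real^2) set \<Rightarrow> (real^2 \<Rightarrow> real) set" where
  "H1 \<Omega> = {u \<in> L2 \<Omega>. \<exists>g\<in>L2 \<Omega>. has_weak_gradient \<Omega> u g}"

text \<open>The weak gradient is unique up to null sets, so the choice made here is immaterial.\<close>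

definition weak_gradient :: "(real^2) set \<Rightarrow> (real^2 \<Rightarrow> real) \<Rightarrow> real^2 \<Rightarrow> real^2" where
  "weak_gradient \<Omega> u = (SOME g. g \<in> L2 \<Omega> \<and> has_weak_gradient \<Omega> u g)"

definition H1_norm :: "(real^2) set \<Rightarrow> (real^2 \<Rightarrow> real) \<Rightarrow> real" where
  "H1_norm \<Omega> u = sqrt ((L2_norm \<Omega> u)\<^sup>2 + (L2_norm \<Omega> (weak_gradient \<Omega> u))\<^sup>2)"

text \<open>\<open>g\<close> is the trace of \<open>u\<close>: the value at \<open>u\<close> of the continuous extension to \<open>H1 \<Omega>\<close> of the
  restriction map \<open>v \<mapsto> v|\<^sub>\<partial>\<^sub>\<Omega>\<close> on functions smooth up to the boundary.
  The boundary of a polygonal domain is a finite union of segments, so convergence in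
  \<open>L\<^sup>2(\<partial>\<Omega>)\<close> is convergence in \<open>L\<^sup>2\<close>, with respect to arc length, on each segment contained in the
  boundary; the factor \<open>dist a b\<close> is the arc-length element (and makes degenerate segments
  harmless).\<close>

definition has_trace :: "(real^2) set \<Rightarrow> (real^2 \<Rightarrow> real) \<Rightarrow> (real^2 \<Rightarrow> real) \<Rightarrow> bool" where
  "has_trace \<Omega> u g \<longleftrightarrow>
     (\<exists>v :: nat \<Rightarrow> real^2 \<Rightarrow> real. (\<forall>n. smooth (v n)) \<and>
        (\<lambda>n. H1_norm \<Omega> (v n - u)) \<longlonglongrightarrow> 0 \<and>
        (\<forall>a b. closed_segment a b \<subseteq> frontier \<Omega> \<longrightarrow>
           (\<lambda>t. g (linepath a b t)) \<in> borel_measurable (lebesgue_on {0..1}) \<and>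
           (\<lambda>n. \<integral>\<^sup>+t. ennreal ((v n (linepath a b t) - g (linepath a b t))\<^sup>2 * dist a b)
                 \<partial>lebesgue_on {0..1}) \<longlonglongrightarrow> 0))"

definition H1_tilde :: "(real^2) set \<Rightarrow> (real^2 \<Rightarrow> real) set" where
  "H1_tilde \<Omega> = {u \<in> H1 \<Omega>. has_trace \<Omega> u (\<lambda>x. 0)}"

section \<open>Interpolation by the K-method\<close>

definition K2 :: "('f::minus \<Rightarrow> real) \<Rightarrow> 'f set \<Rightarrow> ('f \<Rightarrow> real) \<Rightarrow> real \<Rightarrow> 'f \<Rightarrow> real" where
  "K2 norm0 X1 norm1 t u = (INF v\<in>X1. (norm0 (u - v))\<^sup>2 + t\<^sup>2 * (norm1 v)\<^sup>2)"

text \<open>The integral is finite exactly for \<open>u\<close> in the interpolation space, which contains \<open>X1\<close>;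
  elsewhere the value of the norm (zero, by \<open>enn2real\<close>) has no meaning.\<close>

definition interp_norm ::
    "('f::minus \<Rightarrow> real) \<Rightarrow> 'f set \<Rightarrow> ('f \<Rightarrow> real) \<Rightarrow> real \<Rightarrow> 'f \<Rightarrow> real" where
  "interp_norm norm0 X1 norm1 \<theta> u =
     (if \<theta> = 0 then norm0 u
      else if \<theta> = 1 then norm1 u
      else sqrt (enn2real (\<integral>\<^sup>+t\<in>{0<..}.
             ennreal (t powr (-2 * \<theta>) * K2 norm0 X1 norm1 t u / t) \<partial>lborel)))"

section \<open>Meshes\<close>

definition ref_triangle :: "(real^2) set" where
  "ref_triangle = interior (convex hull
     {vector [0, 2 / sqrt 3], vector [1, - 1 / sqrt 3], vector [-1, - 1 / sqrt 3]})"

definition ref_square :: "(real^2) set" where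
  "ref_square = box (vector [-1, - 1 / sqrt 3]) (vector [1, 2 / sqrt 3])"

definition C1_on :: "(real^2) set \<Rightarrow> (real^2 \<Rightarrow> real^2) \<Rightarrow> bool" where
  "C1_on S f \<longleftrightarrow>
     (\<exists>f' :: real^2 \<Rightarrow> real^2^2.
        (\<forall>x\<in>S. (f has_derivative (\<lambda>h. f' x *v h)) (at x within S)) \<and> continuous_on S f')"

definition gramian :: "(real^2 \<Rightarrow> real^2) \<Rightarrow> real^2 \<Rightarrow> real^2^2" where
  "gramian f x = (let J = matrix (frechet_derivative f (at x)) in transpose J ** J)"

definition is_eigenvalue :: "real^2^2 \<Rightarrow> real \<Rightarrow> bool" where
  "is_eigenvalue A l \<longleftrightarrow> (\<exists>v. v \<noteq> 0 \<and> A *v v = l *\<^sub>R v)"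

text \<open>A mesh is given by its set \<open>\<T>\<close> of open elements together with, for each element \<open>K\<close>, the
  reference element \<open>R K\<close> and the element map \<open>F K\<close>. Elements may be curvilinear; an element is the
  image of its open reference element.\<close>

definition is_mesh ::
    "(real^2) set \<Rightarrow> (real^2) set set \<Rightarrow> ((real^2) set \<Rightarrow> (real^2) set) \<Rightarrow>
     ((real^2) set \<Rightarrow> real^2 \<Rightarrow> real^2) \<Rightarrow> bool" where
  "is_mesh \<Omega> \<T> R F \<longleftrightarrow>
     finite \<T> \<and> disjoint \<T> \<and> closure \<Omega> = (\<Union>K\<in>\<T>. closure K) \<and>
     (\<forall>K\<in>\<T>. open K \<and> K \<subseteq> \<Omega> \<and> R K \<in> {ref_square, ref_triangle} \<and> F K ` R K = K)"

text \<open>Pitfalls: the positivity of the eigenvalues has to be stated because of \<open>h / 0 = 0\<close>; in the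
  last condition, an edge is understood without its end points, as an interior edge may end on the
  boundary of \<open>\<Omega>\<close>.\<close>

definition mesh_assumption ::
    "(real^2) set \<Rightarrow> (real^2) set set \<Rightarrow> ((real^2) set \<Rightarrow> (real^2) set) \<Rightarrow>
     ((real^2) set \<Rightarrow> real^2 \<Rightarrow> real^2) \<Rightarrow> real \<Rightarrow> bool" where
  "mesh_assumption \<Omega> \<T> R F \<gamma> \<longleftrightarrow>
     (\<forall>K\<in>\<T>. bij_betw (F K) (closure (R K)) (closure K) \<and> C1_on (closure (R K)) (F K)) \<and>
     (\<forall>K\<in>\<T>. \<forall>x\<in>R K. \<forall>l. is_eigenvalue (gramian (F K) x) l \<longrightarrow>
        0 < l \<and> (diameter K)\<^sup>2 / l \<le> \<gamma> \<and> l / (diameter K)\<^sup>2 \<le> \<gamma>) \<and>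
     (\<forall>K1\<in>\<T>. \<forall>K2\<in>\<T>. K1 \<noteq> K2 \<longrightarrow>
        closure K1 \<inter> closure K2 = {} \<or>
        (\<exists>x. closure K1 \<inter> closure K2 = {x}) \<or>
        (\<exists>e1 e2. e1 edge_of closure (R K1) \<and> e2 edge_of closure (R K2) \<and>
           closure K1 \<inter> closure K2 = F K1 ` e1 \<and> F K1 ` e1 = F K2 ` e2 \<and>
           (let g = inv_into (closure (R K1)) (F K1) \<circ> F K2
            in bij_betw g e2 e1 \<and> (\<exists>A b. linear A \<and> (\<forall>x\<in>e2. g x = A x + b))))) \<and>
     (\<forall>K\<in>\<T>. \<forall>e. e edge_of closure (R K) \<longrightarrow>
        F K ` rel_interior e \<subseteq> \<Omega> \<or> F K ` rel_interior e \<subseteq> frontier \<Omega>)"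

definition degree_assumption ::
    "(real^2) set set \<Rightarrow> ((real^2) set \<Rightarrow> (real^2) set) \<Rightarrow>
     ((real^2) set \<Rightarrow> real^2 \<Rightarrow> real^2) \<Rightarrow> ((real^2) set \<Rightarrow> nat) \<Rightarrow> bool" where
  "degree_assumption \<T> R F p \<longleftrightarrow>
     (\<forall>T\<in>\<T>. \<forall>S\<in>\<T>. R T = ref_triangle \<and> R S = ref_square \<and>
        (\<exists>e1 e2. e1 edge_of closure (R T) \<and> e2 edge_of closure (R S) \<and> F T ` e1 = F S ` e2)
        \<longrightarrow> p T \<le> p S \<or> 2 * p S \<le> p T)"

text \<open>The piecewise constant function with value \<open>c K\<close> on \<open>K\<close>; it vanishes on the skeleton, which
  is a null set.\<close>

definition piecewise_const :: "(real^2) set set \<Rightarrow> ((real^2) set \<Rightarrow> real) \<Rightarrow> real^2 \<Rightarrow> real" where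
  "piecewise_const \<T> c x = (\<Sum>K\<in>\<T>. c K * indicator K x)"

section \<open>Discrete spaces\<close>

definition poly_P :: "nat \<Rightarrow> (real^2 \<Rightarrow> real) set" where
  "poly_P p = {q. \<exists>c. q = (\<lambda>x. \<Sum>i\<le>p. \<Sum>j\<le>p - i. c i j * (x $ 1) ^ i * (x $ 2) ^ j)}"

definition poly_Q :: "nat \<Rightarrow> (real^2 \<Rightarrow> real) set" where
  "poly_Q p = {q. \<exists>c. q = (\<lambda>x. \<Sum>i\<le>p. \<Sum>j\<le>p. c i j * (x $ 1) ^ i * (x $ 2) ^ j)}"

definition poly_ref :: "(real^2) set \<Rightarrow> nat \<Rightarrow> (real^2 \<Rightarrow> real) set" where
  "poly_ref Khat p = (if Khat = ref_triangle then poly_P p else poly_Q p)"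

definition S0 ::
    "(real^2) set \<Rightarrow> (real^2) set set \<Rightarrow> ((real^2) set \<Rightarrow> (real^2) set) \<Rightarrow>
     ((real^2) set \<Rightarrow> real^2 \<Rightarrow> real^2) \<Rightarrow> ((real^2) set \<Rightarrow> nat) \<Rightarrow> (real^2 \<Rightarrow> real) set" where
  "S0 \<Omega> \<T> R F p = {u \<in> L2 \<Omega>. \<forall>K\<in>\<T>. \<exists>q\<in>poly_ref (R K) (p K).
                     AE x in lebesgue_on (R K). (u \<circ> F K) x = q x}"

definition S1 ::
    "(real^2) set \<Rightarrow> (real^2) set set \<Rightarrow> ((real^2) set \<Rightarrow> (real^2) set) \<Rightarrow>
     ((real^2) set \<Rightarrow> real^2 \<Rightarrow> real^2) \<Rightarrow> ((real^2) set \<Rightarrow> nat) \<Rightarrow> (real^2 \<Rightarrow> real) set" where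
  "S1 \<Omega> \<T> R F p = S0 \<Omega> \<T> R F p \<inter> H1 \<Omega>"

definition S1_tilde ::
    "(real^2) set \<Rightarrow> (real^2) set set \<Rightarrow> ((real^2) set \<Rightarrow> (real^2) set) \<Rightarrow>
     ((real^2) set \<Rightarrow> real^2 \<Rightarrow> real^2) \<Rightarrow> ((real^2) set \<Rightarrow> nat) \<Rightarrow> (real^2 \<Rightarrow> real) set" where
  "S1_tilde \<Omega> \<T> R F p = S0 \<Omega> \<T> R F p \<inter> H1_tilde \<Omega>"

end

(* Local inverse estimate. On an element with (rescaled) reference coordinates let w be the polynomial
   representing u, and let v be an arbitrary H^1 function. The partial derivative r of w is tested with
   psi = chi r, where chi is a cutoff function vanishing near the boundary of the unit square, with
   layers of width proportional to p^-2 in which polynomials of degree p do not concentrate. Since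
   r = r(u - v) + r(v) and psi vanishes at the boundary, integration by parts puts the derivative of the
   first part on psi, at the cost of a factor p^2, and leaves the gradient of v in the second:
   norm(grad u, K)^2 <= C (p^4/h^2 norm(u - v, K)^2 + norm(grad v, K)^2).
   Triangles are covered by three parallelograms. As the element maps are only C^1, the chain rule for
   the weak gradient of v is proved by mollification in the physical variable.

   With a = h/p^2, multiplication by min(t, a)^2, summation over the elements and the infimum over v
   give sum_K min(t, a_K)^2 norm(grad u, K)^2 <= C K^2(t, u), and integration against t^(-2 theta - 1)
   gives the theorem. *)
theory Submission
  imports Defs "HOL-Computational_Algebra.Polynomial"
begin

section \<open>Polynomials in one variable\<close>

text \<open>The comparison function v is merely in H^1: an inverse inequality may act on r or on the
  test function but never on u - v, and no trace of u - v is under control, so psi has to vanish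
  near the boundary. That this costs only p^4 rests on two facts about a one-variable polynomial q
  of degree n. In layers of width eps ~ n^-2 the derivative of the cutoff is of size n^2 while q^2
  is at most (n + 1)^2 times its mean, so the squared norm of chi' q costs n^4 * n^-2 * n^2. For the
  other term, chi^2 is at most (2 / eps) x (1 - x), and the weighted Markov inequality int x (1 - x)
  q'^2 <= n (n + 1) int q^2 gives n^2 * n^2. Both facts come from Legendre expansions, with explicit
  constants.

  In two dimensions the determinant and the squared norm of the Jacobian of an element map both
  scale like h^2. The gradient terms are therefore scale-free, and h^-2 appears only in front of u -
  v. Multiplication by min(t, a)^2 then makes the coefficient of u - v at most 1 and that of grad v
  at most t^2, which is the form of the K-functional for every admissible v at once.\<close>

text \<open>Integration over the unit interval as a functional on the ring of polynomials:
  \<open>pint (f * g)\<close> is the L2(0,1) inner product, and expanding a square becomes an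
  identity of polynomials.\<close>

definition pint :: "real poly \<Rightarrow> real" where
  "pint q = integral {0..1} (poly q)"

lemma poly_integrable: "poly (q :: real poly) integrable_on {a..b}"
  by (intro integrable_continuous_interval continuous_intros)

lemma pint_add: "pint (p + q) = pint p + pint q"
  using integral_add[OF poly_integrable poly_integrable, of 0 1 p q]
  unfolding pint_def poly_add[abs_def] .

lemma pint_smult: "pint (smult c p) = c * pint p"
  unfolding pint_def poly_smult[abs_def] by simp

lemma pint_minus: "pint (- p) = - pint p"
  using pint_smult[of "-1" p] by simp

lemma pint_0 [simp]: "pint 0 = 0"
  unfolding pint_def poly_0[abs_def] by simp

lemma pint_diff: "pint (p - q) = pint p - pint q"
  using pint_add[of p "- q"] by (simp add: pint_minus)

lemma pint_sum: "pint (\<Sum>i\<in>A. f i) = (\<Sum>i\<in>A. pint (f i))"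
  by (induction A rule: infinite_finite_induct) (auto simp: pint_add)

lemma poly_integral_pderiv:
  fixes q :: "real poly"
  assumes "a \<le> b"
  shows "integral {a..b} (poly (pderiv q)) = poly q b - poly q a"
  using assms
  by (intro integral_unique fundamental_theorem_of_calculus)
    (auto simp flip: has_real_derivative_iff_has_vector_derivative intro: DERIV_subset poly_DERIV)

lemma pint_pderiv: "pint (pderiv q) = poly q 1 - poly q 0"
  by (simp add: pint_def poly_integral_pderiv)

lemma pint_nonneg: "(\<And>x. 0 \<le> x \<Longrightarrow> x \<le> 1 \<Longrightarrow> 0 \<le> poly q x) \<Longrightarrow> 0 \<le> pint q"
  unfolding pint_def by (intro integral_nonneg poly_integrable) auto

text \<open>A continuous nonnegative function with zero integral vanishes on the whole interval,
  while a nonzero polynomial has finitely many zeros.\<close>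

lemma pint_square_pos:
  assumes "q \<noteq> 0"
  shows "0 < pint (q * q)"
proof -
  have "0 \<le> pint (q * q)" by (intro pint_nonneg) auto
  moreover have "pint (q * q) \<noteq> 0"
  proof
    assume "pint (q * q) = 0"
    then have 0: "(poly (q * q) has_integral 0) (cbox 0 1)"
      using integrable_integral[OF poly_integrable[of "q * q" 0 1]] by (simp add: pint_def)
    have "poly (q * q) x = 0" if "x \<in> {0..1}" for x
      using that by (intro has_integral_0_cbox_imp_0[OF _ _ 0]) (auto intro!: continuous_intros)
    then have "{0..1} \<subseteq> {x. poly (q * q) x = 0}" by blast
    moreover have "q * q \<noteq> 0" using assms by simp
    ultimately show False
      using poly_roots_finite finite_subset infinite_Icc[of 0 "1::real"] by (metis zero_less_one)
  qed
  ultimately show ?thesis by simp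
qed

section \<open>Shifted Legendre polynomials\<close>

lemma degree_diff_lead:
  fixes q L :: "real poly"
  assumes "degree q \<le> Suc n" "degree L = Suc n" "lead_coeff L = 1"
  shows "degree (q - smult (coeff q (Suc n)) L) \<le> n"
proof (rule degree_le, intro allI impI)
  fix i assume "n < i"
  then consider "i = Suc n" | "Suc n < i" by linarith
  then show "coeff (q - smult (coeff q (Suc n)) L) i = 0"
    using assms by cases (auto simp: coeff_eq_0)
qed

text \<open>The Legendre polynomial transplanted to (0,1), normalised to be monic: subtracting the
  right multiple of it lowers the degree of a given polynomial, which drives the inductions on the
  degree below.\<close>

definition is_legendre :: "nat \<Rightarrow> real poly \<Rightarrow> bool" where
  "is_legendre n L \<longleftrightarrow> degree L = n \<and> lead_coeff L = 1 \<and> (\<forall>q. degree q < n \<longrightarrow> pint (L * q) = 0)"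

text \<open>Gram-Schmidt applied to x^n against the Legendre polynomials of lower degree.\<close>

lemma legendre_exists: "\<exists>L. is_legendre n L"
proof (induction n rule: less_induct)
  case (less n)
  then obtain L where L: "\<And>k. k < n \<Longrightarrow> is_legendre k (L k)" by metis
  have pos: "0 < pint (L k * L k)" if "k < n" for k
    using L[OF that] by (intro pint_square_pos) (auto simp: is_legendre_def)
  have less: "pint (L j * L k) = 0" if "j < n" "k < j" for k j
    using L[of j] L[of k] that by (auto simp: is_legendre_def)
  have orth: "pint (L k * L j) = 0" if "k < n" "j < n" "k \<noteq> j" for k j
    using less[of j k] less[of k j] that by (cases "k < j") (auto simp: mult.commute)
  define c where "c k = pint (monom 1 n * L k) / pint (L k * L k)" for k
  define S where "S = (\<Sum>k<n. smult (c k) (L k))"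
  define P where "P = monom 1 n - S"
  have dS: "degree S < n \<or> S = 0"
  proof (cases "n = 0")
    case False
    have "degree S \<le> n - 1" unfolding S_def
      using L by (intro degree_sum_le) (auto simp: is_legendre_def intro!: order.trans[OF degree_smult_le])
    then show ?thesis using False by linarith
  qed (auto simp: S_def)
  have degP: "degree P = n" and lead: "lead_coeff P = 1"
  proof -
    have "coeff S i = 0" if "i \<ge> n" for i using dS that by (auto simp: coeff_eq_0)
    then have n: "coeff P n = 1" and gt: "\<And>i. i > n \<Longrightarrow> coeff P i = 0"
      by (auto simp: P_def)
    then show "degree P = n" by (intro antisym degree_le le_degree) auto
    then show "lead_coeff P = 1" using n by simp
  qed
  have PL: "pint (P * L j) = 0" if "j < n" for j
  proof -
    have "pint (S * L j) = (\<Sum>k<n. c k * pint (L k * L j))"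
      by (simp add: S_def sum_distrib_right pint_sum pint_smult)
    also have "\<dots> = c j * pint (L j * L j)"
      using orth that by (subst sum.remove[of _ j]) (auto intro!: sum.neutral)
    finally show ?thesis
      using pos[OF that] by (simp add: P_def left_diff_distrib pint_diff c_def)
  qed
  \<comment> \<open>Orthogonality to the finitely many \<open>L j\<close> extends to all polynomials
    of lower degree by stripping off one leading term at a time.\<close>
  have "pint (P * q) = 0" if "degree q \<le> m" "m < n" for q m
    using that
  proof (induction m arbitrary: q)
    case 0
    then obtain a where q: "q = [:a:]" by (metis degree_eq_zeroE le_zero_eq)
    have "is_legendre 0 (L 0)" using L 0 by blast
    then obtain b where "L 0 = [:b:]" "b = 1"
      by (metis is_legendre_def degree_eq_zeroE lead_coeff_pCons(2))
    then have "q = smult a (L 0)" using q by simp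
    then show ?case using PL[of 0] 0 by (simp add: pint_smult)
  next
    case (Suc m)
    define r where "r = q - smult (coeff q (Suc m)) (L (Suc m))"
    have "degree r \<le> m" unfolding r_def
      using L[of "Suc m"] Suc.prems by (intro degree_diff_lead) (auto simp: is_legendre_def)
    then have "pint (P * r) = 0" using Suc by auto
    moreover have "P * q = P * r + smult (coeff q (Suc m)) (P * L (Suc m))"
      by (simp add: r_def algebra_simps)
    ultimately show ?case using PL[of "Suc m"] Suc.prems by (simp add: pint_add pint_smult)
  qed
  then have "is_legendre n P"
    using degP lead by (auto simp: is_legendre_def)
  then show ?case by blast
qed

section \<open>The Legendre operator and pointwise bounds for polynomials\<close>

lemma coeff_weight_mult: "coeff ([:0, 1, -1:] * f) (Suc (Suc n)) = coeff f (Suc n) - coeff (f :: real poly) n"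
  by simp

text \<open>\<open>[:0, 1, -1:]\<close> is x (1 - x): the two derivatives remove the two degrees
  that this weight adds.\<close>

lemma degree_weight_pderiv:
  fixes f :: "real poly"
  assumes "degree f \<le> n"
  shows "degree (pderiv ([:0, 1, -1:] * pderiv f)) \<le> n"
proof (cases "pderiv f = 0")
  case False
  then have "degree f > 0" by (metis gr0I pderiv_eq_0_iff)
  then show ?thesis
    using degree_mult_le[of "[:0, 1, -1:]" "pderiv f"] assms by (simp add: degree_pderiv)
qed simp

text \<open>The weight x (1 - x) vanishes at both end points, so integration by parts leaves no
  boundary term.\<close>

lemma pint_weight_parts:
  "pint ([:0, 1, -1:] * pderiv f * pderiv g) = - pint (pderiv ([:0, 1, -1:] * pderiv f) * g)"
proof -
  have "pint (pderiv ([:0, 1, -1:] * pderiv f * g)) = 0"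
    unfolding pint_pderiv by simp
  then show ?thesis
    by (simp only: pderiv_mult[of "[:0, 1, -1:] * pderiv f"] pint_add) (simp add: mult.commute)
qed

lemma weighted_square_expand:
  fixes w a b :: "real poly"
  shows "w * (smult c a + b) * (smult c a + b)
    = smult (c * c) (w * a * a) + smult (2 * c) (w * b * a) + w * b * b"
  by (intro iffD1[OF poly_eq_poly_eq_iff] ext) (simp add: algebra_simps)

text \<open>The Legendre polynomial of degree \<open>k\<close> is an eigenfunction of
  \<open>q \<mapsto> - (x (1 - x) q')'\<close> with eigenvalue \<open>k (k + 1)\<close>.\<close>

lemma weighted_markov:
  "degree q \<le> n \<Longrightarrow> pint ([:0, 1, -1:] * pderiv q * pderiv q) \<le> real n * real (n + 1) * pint (q * q)"
proof (induction n arbitrary: q)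
  case 0
  then have "pderiv q = 0" by (simp add: pderiv_eq_0_iff)
  then show ?case by simp
next
  case (Suc n)
  obtain L where L: "is_legendre (Suc n) L" using legendre_exists by blast
  define c where "c = coeff q (Suc n)"
  define r where "r = q - smult c L"
  let ?w = "[:0, 1, -1 :: real:]"
  let ?N = "real (Suc n) * real (Suc n + 1)"
  have dr: "degree r \<le> n" unfolding r_def c_def
    using L Suc.prems by (intro degree_diff_lead) (auto simp: is_legendre_def)
  have q: "q = smult c L + r" by (simp add: r_def)
  have orth: "pint (L * f) = 0" if "degree f \<le> n" for f
    using L that by (auto simp: is_legendre_def)
  \<comment> \<open>The operator applied to r has degree at most n, hence is orthogonal to L, and
    the quadratic form splits into the parts of L and r.\<close>
  have Lr: "pint (?w * pderiv r * pderiv L) = 0"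
    unfolding pint_weight_parts
    using orth[OF degree_weight_pderiv[OF dr]] by (simp add: mult.commute)
  \<comment> \<open>Only the leading coefficient -(n + 1) (n + 2) of the operator applied to L is
    compared; a remainder of lower degree is invisible when paired with L. This takes the place of
    the exact eigenvalue equation.\<close>
  have "degree (pderiv (?w * pderiv L) + smult ?N L) \<le> n"
  proof (rule degree_le, intro allI impI)
    fix i assume i: "n < i"
    have dl: "degree (pderiv (?w * pderiv L)) \<le> Suc n"
      using L by (intro degree_weight_pderiv) (auto simp: is_legendre_def)
    have 1: "coeff L (Suc n) = 1" and 2: "coeff L (Suc (Suc n)) = 0"
      using L by (auto simp: is_legendre_def intro: coeff_eq_0)
    have "coeff (pderiv (?w * pderiv L)) (Suc n) = - ?N"
      using 1 2 by (simp only: coeff_pderiv coeff_weight_mult) (simp add: algebra_simps)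
    then show "coeff (pderiv (?w * pderiv L) + smult ?N L) i = 0"
      using i dl L 1 by (cases "i = Suc n") (auto simp: coeff_eq_0 is_legendre_def simp del: mult_pCons_left)
  qed
  then have "pint (L * (pderiv (?w * pderiv L) + smult ?N L)) = 0" by (rule orth)
  then have LL: "pint (?w * pderiv L * pderiv L) = ?N * pint (L * L)"
    unfolding pint_weight_parts
    by (simp add: distrib_left pint_add pint_smult mult.commute del: mult_pCons_left mult_pCons_right)
  have "?w * pderiv q * pderiv q = smult (c * c) (?w * pderiv L * pderiv L) + smult (2 * c) (?w * pderiv r * pderiv L)
      + ?w * pderiv r * pderiv r"
    unfolding q pderiv_add pderiv_smult by (rule weighted_square_expand)
  then have "pint (?w * pderiv q * pderiv q)
      = c * c * pint (?w * pderiv L * pderiv L) + pint (?w * pderiv r * pderiv r)"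
    by (simp only: pint_add pint_smult Lr mult_zero_right add_0_right)
  also have "\<dots> \<le> c * c * (?N * pint (L * L)) + ?N * pint (r * r)"
  proof -
    have "pint (?w * pderiv r * pderiv r) \<le> real n * real (n + 1) * pint (r * r)"
      using Suc.IH dr by blast
    also have "\<dots> \<le> ?N * pint (r * r)"
      by (intro mult_right_mono mult_mono pint_nonneg) auto
    finally show ?thesis using LL by simp
  qed
  also have "\<dots> = ?N * (c * c * pint (L * L) + pint (r * r))"
    by (simp add: algebra_simps)
  also have "c * c * pint (L * L) + pint (r * r) = pint (q * q)"
  proof -
    have "q * q = smult (c * c) (L * L) + smult (2 * c) (L * r) + r * r"
      using weighted_square_expand[of 1 c L r] by (simp add: q mult.commute)
    then show ?thesis using orth[OF dr] by (simp add: pint_add pint_smult)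
  qed
  finally show ?case .
qed

text \<open>Integrating \<open>(x L\<^sup>2)'\<close> gives \<open>L(1)\<^sup>2 = (2n + 1) \<integral> L\<^sup>2\<close> for the Legendre polynomial of degree \<open>n\<close>.\<close>

lemma poly_at_1_bound:
  "degree q \<le> n \<Longrightarrow> (poly q 1)\<^sup>2 \<le> (real (n + 1))\<^sup>2 * pint (q * q)"
proof (induction n arbitrary: q)
  case 0
  then obtain a where "q = [:a:]" by (metis degree_eq_zeroE le_zero_eq)
  moreover have "pint [:b:] = b" for b
    unfolding pint_def poly_pCons[abs_def] by simp
  ultimately show ?case by (simp add: power2_eq_square)
next
  case (Suc n)
  obtain L where L: "is_legendre (Suc n) L" using legendre_exists by blast
  define c where "c = coeff q (Suc n)"
  define r where "r = q - smult c L"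
  let ?N = "real (Suc n)"
  have dr: "degree r \<le> n" unfolding r_def c_def
    using L Suc.prems by (intro degree_diff_lead) (auto simp: is_legendre_def)
  have q: "q = smult c L + r" by (simp add: r_def)
  have orth: "pint (L * f) = 0" if "degree f \<le> n" for f
    using L that by (auto simp: is_legendre_def)
  \<comment> \<open>The leading terms of x L' and (n + 1) L agree, so their difference is orthogonal
    to L and int x L L' = (n + 1) int L^2.\<close>
  have "degree (pCons 0 (pderiv L) - smult ?N L) \<le> n"
  proof (rule degree_le, intro allI impI)
    fix i assume i: "n < i"
    then obtain j where j: "i = Suc j" by (metis less_imp_Suc_add)
    show "coeff (pCons 0 (pderiv L) - smult ?N L) i = 0"
      using L i j by (cases "j = n") (auto simp: coeff_pderiv coeff_eq_0 is_legendre_def)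
  qed
  then have "pint (L * (pCons 0 (pderiv L) - smult ?N L)) = 0" by (rule orth)
  then have xLL: "pint (L * pCons 0 (pderiv L)) = ?N * pint (L * L)"
    by (simp add: right_diff_distrib pint_diff pint_smult del: mult_pCons_right)
  have "pint (pderiv ([:0, 1:] * (L * L))) = (poly L 1)\<^sup>2"
    unfolding pint_pderiv by (simp add: power2_eq_square)
  moreover have "pderiv ([:0, 1:] * (L * L)) = L * L + smult 2 (L * pCons 0 (pderiv L))"
    by (intro iffD1[OF poly_eq_poly_eq_iff] ext) (simp add: pderiv_mult pderiv_pCons algebra_simps)
  ultimately have L1: "(poly L 1)\<^sup>2 = (2 * ?N + 1) * pint (L * L)"
    by (simp only: pint_add pint_smult xLL distrib_right mult.assoc mult_1_left)
  define A where "A = c\<^sup>2 * pint (L * L)"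
  define B where "B = pint (r * r)"
  have A: "0 \<le> A" and B: "0 \<le> B" by (auto simp: A_def B_def intro!: mult_nonneg_nonneg pint_nonneg)
  have a: "(c * poly L 1)\<^sup>2 = (2 * ?N + 1) * A"
    by (simp add: power_mult_distrib L1 A_def)
  have b: "(poly r 1)\<^sup>2 \<le> ?N\<^sup>2 * B" using Suc.IH[OF dr] by (simp add: B_def add.commute)
  \<comment> \<open>AM-GM for the mixed term, weighted such that with N = n + 1 both parts end up
    with the coefficient N^2 + 2 N + 1 = (N + 1)^2; the induction closes without loss.\<close>
  have "2 * (c * poly L 1) * poly r 1 \<le> ?N\<^sup>2 * A + (2 * ?N + 1) * B"
  proof -
    have "(c * poly L 1)\<^sup>2 * (poly r 1)\<^sup>2 \<le> ((2 * ?N + 1) * A) * (?N\<^sup>2 * B)"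
      unfolding a using A b by (intro mult_left_mono) auto
    moreover have "4 * (((2 * ?N + 1) * A) * (?N\<^sup>2 * B)) \<le> (?N\<^sup>2 * A + (2 * ?N + 1) * B)\<^sup>2"
      using zero_le_power2[of "?N\<^sup>2 * A - (2 * ?N + 1) * B"]
      by (simp only: power2_diff power2_sum) (simp add: algebra_simps)
    ultimately have "(2 * (c * poly L 1) * poly r 1)\<^sup>2 \<le> (?N\<^sup>2 * A + (2 * ?N + 1) * B)\<^sup>2"
      by (simp add: power_mult_distrib)
    then show ?thesis
      using A B by (elim power2_le_imp_le) auto
  qed
  then have "(c * poly L 1 + poly r 1)\<^sup>2 \<le> (real (Suc n + 1))\<^sup>2 * (A + B)"
  proof -
    have "(real (Suc n + 1))\<^sup>2 * (A + B) = (2 * ?N + 1) * A + (?N\<^sup>2 * A + (2 * ?N + 1) * B) + ?N\<^sup>2 * B"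
      by (simp add: power2_eq_square algebra_simps)
    then show ?thesis using a b \<open>2 * (c * poly L 1) * poly r 1 \<le> _\<close> unfolding power2_sum by linarith
  qed
  moreover have "A + B = pint (q * q)"
  proof -
    have "q * q = smult (c * c) (L * L) + smult (2 * c) (L * r) + r * r"
      using weighted_square_expand[of 1 c L r] by (simp add: q mult.commute)
    then show ?thesis using orth[OF dr] by (simp add: pint_add pint_smult A_def B_def power2_eq_square)
  qed
  ultimately show ?case by (simp add: q)
qed

text \<open>The affine substitution t -> a + (b - a) t moves b to 1. Both orientations are covered
  because an interior point x is afterwards the right end of one interval and the left end of
  another.\<close>

lemma poly_endpoint_bound:
  fixes q :: "real poly"
  assumes "degree q \<le> n"
  shows "\<bar>b - a\<bar> * (poly q b)\<^sup>2
    \<le> (real (n + 1))\<^sup>2 * (if a \<le> b then integral {a..b} (\<lambda>x. (poly q x)\<^sup>2) else integral {b..a} (\<lambda>x. (poly q x)\<^sup>2))"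
proof -
  define r where "r = pcompose q [:a, b - a:]"
  \<comment> \<open>The substitution rule yields a difference of two integrals, one of which runs
    over an empty or degenerate interval; which one depends on the orientation.\<close>
  have "((\<lambda>x. (b - a) *\<^sub>R (poly q (a + (b - a) * x))\<^sup>2) has_integral
      (integral {a + (b - a) * 0..a + (b - a) * 1} (\<lambda>x. (poly q x)\<^sup>2)
       - integral {a + (b - a) * 1..a + (b - a) * 0} (\<lambda>x. (poly q x)\<^sup>2))) {0..1}"
  proof (rule has_integral_substitution_general[where s = "{}" and c = "min a b" and d = "max a b"])
    show "(\<lambda>x. a + (b - a) * x) ` {0..1} \<subseteq> {min a b..max a b}"
    proof clarsimp
      fix x :: real assume x: "0 \<le> x" "x \<le> 1"
      have "a + (b - a) * x = (1 - x) * a + x * b" by (simp add: algebra_simps)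
      moreover have "(1 - x) * min a b \<le> (1 - x) * a" "x * min a b \<le> x * b"
        "(1 - x) * a \<le> (1 - x) * max a b" "x * b \<le> x * max a b"
        using x by (intro mult_left_mono; simp)+
      ultimately show "min a b \<le> a + (b - a) * x \<and> a + (b - a) * x \<le> max a b"
        by (simp add: algebra_simps)
    qed
  qed (auto intro!: continuous_intros derivative_eq_intros)
  then have "(b - a) * integral {0..1} (\<lambda>x. (poly q (a + (b - a) * x))\<^sup>2)
      = integral {a..b} (\<lambda>x. (poly q x)\<^sup>2) - integral {b..a} (\<lambda>x. (poly q x)\<^sup>2)"
    by (subst (asm) has_integral_iff) simp
  moreover have "pint (r * r) = integral {0..1} (\<lambda>x. (poly q (a + (b - a) * x))\<^sup>2)"
    unfolding pint_def by (intro arg_cong[where f = "integral _"])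
      (auto simp: fun_eq_iff r_def poly_pcompose power2_eq_square algebra_simps)
  ultimately have I: "\<bar>b - a\<bar> * pint (r * r)
      = (if a \<le> b then integral {a..b} (\<lambda>x. (poly q x)\<^sup>2) else integral {b..a} (\<lambda>x. (poly q x)\<^sup>2))"
    by (cases a b rule: linorder_cases) (auto simp: algebra_simps)
  have "degree r \<le> n" unfolding r_def degree_pcompose using assms
    by (metis degree_pCons_eq_if le_trans mult.right_neutral mult_0_right mult_le_mono2 degree_0 One_nat_def le0)
  then have "(poly q b)\<^sup>2 \<le> (real (n + 1))\<^sup>2 * pint (r * r)"
    using poly_at_1_bound[of r n] by (simp add: r_def poly_pcompose)
  then have "\<bar>b - a\<bar> * (poly q b)\<^sup>2 \<le> \<bar>b - a\<bar> * ((real (n + 1))\<^sup>2 * pint (r * r))"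
    by (rule mult_left_mono) simp
  then show ?thesis unfolding I[symmetric] by (simp only: mult.left_commute)
qed

text \<open>The point x divides the unit interval into parts of length x and 1 - x; the end point
  bounds on both parts add up with total weight 1.\<close>

lemma poly_sup_bound:
  fixes q :: "real poly"
  assumes "degree q \<le> n" "0 \<le> x" "x \<le> 1"
  shows "(poly q x)\<^sup>2 \<le> (real (n + 1))\<^sup>2 * integral {0..1} (\<lambda>x. (poly q x)\<^sup>2)"
proof -
  have "x * (poly q x)\<^sup>2 \<le> (real (n + 1))\<^sup>2 * integral {0..x} (\<lambda>x. (poly q x)\<^sup>2)"
    using poly_endpoint_bound[OF assms(1), of x 0] assms by auto
  moreover have "(1 - x) * (poly q x)\<^sup>2 \<le> (real (n + 1))\<^sup>2 * integral {x..1} (\<lambda>x. (poly q x)\<^sup>2)"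
    using poly_endpoint_bound[OF assms(1), of x 1] assms by (auto split: if_splits)
  moreover have "integral {0..x} (\<lambda>x. (poly q x)\<^sup>2) + integral {x..1} (\<lambda>x. (poly q x)\<^sup>2)
      = integral {0..1} (\<lambda>x. (poly q x)\<^sup>2)"
    using assms by (intro Henstock_Kurzweil_Integration.integral_combine integrable_continuous_interval continuous_intros) auto
  ultimately show ?thesis
    by (simp add: algebra_simps) (simp add: algebra_simps flip: \<open>_ = integral {0..1} _\<close>)
qed

section \<open>Cutoff functions in one variable\<close>

definition ramp :: "real \<Rightarrow> real" where
  "ramp x = max 0 x"

lemma ramp_square_deriv: "((\<lambda>x. (ramp x)\<^sup>2) has_real_derivative 2 * ramp x) (at x)"
proof (cases x "0::real" rule: linorder_cases)
  case less
  have "((\<lambda>x. 0) has_real_derivative 2 * ramp x) (at x)"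
    using less by (simp add: ramp_def)
  then show ?thesis
    by (rule has_field_derivative_transform_within_open[where S = "{..<0}"])
      (use less in \<open>auto simp: ramp_def\<close>)
next
  case greater
  have "((\<lambda>x. x\<^sup>2) has_real_derivative 2 * ramp x) (at x)"
    using greater by (auto intro!: derivative_eq_intros simp: ramp_def)
  then show ?thesis
    by (rule has_field_derivative_transform_within_open[where S = "{0<..}"])
      (use greater in \<open>auto simp: ramp_def\<close>)
next
  case equal
  have "((\<lambda>h. ((ramp (0 + h))\<^sup>2 - (ramp 0)\<^sup>2) / h) \<longlongrightarrow> 0) (at 0)"
  proof (rule Lim_null_comparison[where g = "\<lambda>h. \<bar>h\<bar>"])
    show "((\<lambda>h::real. \<bar>h\<bar>) \<longlongrightarrow> 0) (at 0)"
      by (rule tendsto_rabs_zero) (rule tendsto_ident_at)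
  qed (auto simp: ramp_def power2_eq_square max_def)
  then show ?thesis using equal by (simp add: DERIV_def ramp_def)
qed

lemma continuous_on_ramp [continuous_intros]:
  "continuous_on S f \<Longrightarrow> continuous_on S (\<lambda>x. ramp (f x))"
  unfolding ramp_def by (intro continuous_intros)

text \<open>The C^1 quadratic spline rising from 0 to 1 on [0, 1]: its second derivative is 4 on the
  first half and -4 on the second, so \<open>dstep\<close> is a hat of height 2.\<close>

definition step :: "real \<Rightarrow> real" where
  "step x = 2 * (ramp x)\<^sup>2 - 4 * (ramp (x - 1/2))\<^sup>2 + 2 * (ramp (x - 1))\<^sup>2"

definition dstep :: "real \<Rightarrow> real" where
  "dstep x = 4 * ramp x - 8 * ramp (x - 1/2) + 4 * ramp (x - 1)"

lemma ramp_square_deriv_chain: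
  "(f has_real_derivative d) (at x) \<Longrightarrow> ((\<lambda>x. (ramp (f x))\<^sup>2) has_real_derivative 2 * ramp (f x) * d) (at x)"
  using DERIV_chain2[OF ramp_square_deriv, of f d x UNIV] by simp

lemma step_deriv: "(step has_real_derivative dstep x) (at x)"
  unfolding step_def[abs_def] dstep_def
  by (rule derivative_eq_intros ramp_square_deriv_chain refl)+ simp

lemma continuous_on_dstep [continuous_intros]:
  "continuous_on S f \<Longrightarrow> continuous_on S (\<lambda>x. dstep (f x))"
  unfolding dstep_def by (intro continuous_intros)

lemma step_cases:
  "x \<le> 0 \<Longrightarrow> step x = 0"
  "1 \<le> x \<Longrightarrow> step x = 1"
  "x \<le> 0 \<Longrightarrow> dstep x = 0"
  "1 \<le> x \<Longrightarrow> dstep x = 0"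
  by (auto simp: step_def dstep_def ramp_def power2_eq_square algebra_simps)

lemma step_bounds: "0 \<le> step x \<and> step x \<le> 1"
proof -
  consider "x \<le> 0" | "0 \<le> x" "x \<le> 1/2" | "1/2 \<le> x" "x \<le> 1" | "1 \<le> x" by linarith
  then show ?thesis
  proof cases
    case 2
    then have "x\<^sup>2 \<le> (1/2)\<^sup>2" by (intro power_mono) auto
    then show ?thesis using 2 by (simp add: step_def ramp_def power2_eq_square)
  next
    case 3
    have "step x = 1 - 2 * (1 - x)\<^sup>2"
      using 3 by (simp add: step_def ramp_def power2_eq_square algebra_simps)
    moreover have "(1 - x)\<^sup>2 \<le> (1/2)\<^sup>2" using 3 by (intro power_mono) auto
    ultimately show ?thesis by (simp add: power2_eq_square)
  qed (auto simp: step_cases)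
qed

lemma dstep_bounds: "0 \<le> dstep x \<and> dstep x \<le> 2"
  by (auto simp: dstep_def ramp_def max_def)

lemma integral_layers_le:
  fixes f :: "real \<Rightarrow> real"
  assumes "continuous_on {0..1} f" "0 \<le> \<delta>" "\<delta> \<le> 1/2" "0 \<le> M"
    and "\<And>x. 0 \<le> x \<Longrightarrow> x \<le> 1 \<Longrightarrow> f x \<le> M" "\<And>x. \<delta> \<le> x \<Longrightarrow> x \<le> 1 - \<delta> \<Longrightarrow> f x = 0"
  shows "integral {0..1} f \<le> 2 * \<delta> * M"
proof -
  have int: "f integrable_on {a..b}" if "0 \<le> a" "b \<le> 1" for a b
    using assms(1) that by (intro integrable_continuous_interval) (auto intro: continuous_on_subset)
  have "integral {0..\<delta>} f \<le> integral {0..\<delta>} (\<lambda>x. M)"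
    using assms by (intro integral_le int) auto
  moreover have "integral {1 - \<delta>..1} f \<le> integral {1 - \<delta>..1} (\<lambda>x. M)"
    using assms by (intro integral_le int) auto
  moreover have "integral {\<delta>..1 - \<delta>} f = integral {\<delta>..1 - \<delta>} (\<lambda>x. 0)"
    using assms by (intro integral_cong) auto
  moreover have "integral {0..\<delta>} f + integral {\<delta>..1 - \<delta>} f = integral {0..1 - \<delta>} f"
    using assms by (intro Henstock_Kurzweil_Integration.integral_combine int) auto
  moreover have "integral {0..1 - \<delta>} f + integral {1 - \<delta>..1} f = integral {0..1} f"
    using assms by (intro Henstock_Kurzweil_Integration.integral_combine int) auto
  ultimately show ?thesis using assms by simp
qed

lemma integral_add_pint:
  assumes "continuous_on {0..1} f"
  shows "integral {0..1} (\<lambda>x. 2 * f x + c * poly W x) = 2 * integral {0..1} f + c * pint W"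
  unfolding pint_def using assms
  by (subst integral_add) (auto intro!: integrable_continuous_interval continuous_intros)

text \<open>A cutoff function with boundary layers of width proportional to \<open>(n + 1)\<^sup>-\<^sup>2\<close>; by
  \<open>poly_sup_bound\<close> polynomials of degree \<open>n\<close> do not concentrate in these layers.\<close>

lemma polynomial_cutoff:
  fixes n :: nat
  obtains \<epsilon> and \<kappa> \<kappa>' :: "real \<Rightarrow> real" where
    "0 < \<epsilon>" "\<epsilon> < 1/2"
    "\<And>x. (\<kappa> has_real_derivative \<kappa>' x) (at x)" "continuous_on UNIV \<kappa>'"
    "\<And>x. 0 \<le> \<kappa> x" "\<And>x. \<kappa> x \<le> 1"
    "\<And>x. x \<le> \<epsilon> \<or> 1 - \<epsilon> \<le> x \<Longrightarrow> \<kappa> x = 0"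
    "\<And>x. x \<le> \<epsilon> \<or> 1 - \<epsilon> \<le> x \<Longrightarrow> \<kappa>' x = 0"
    "\<And>q :: real poly. degree q \<le> n \<Longrightarrow>
      integral {0..1} (\<lambda>x. (poly q x)\<^sup>2) \<le> 2 * integral {0..1} (\<lambda>x. \<kappa> x * (poly q x)\<^sup>2)"
    "\<And>q :: real poly. degree q \<le> n \<Longrightarrow>
      integral {0..1} (\<lambda>x. (\<kappa>' x * poly q x + \<kappa> x * poly (pderiv q) x)\<^sup>2)
        \<le> 3000 * real (n + 1) ^ 4 * integral {0..1} (\<lambda>x. (poly q x)\<^sup>2)"
proof -
  define N where "N = (real (n + 1))\<^sup>2"
  \<comment> \<open>The layers in which \<kappa> may differ from 1 have total measure 4 \<epsilon>,
    and q^2 is at most N I there, where I is the integral of q^2. They hold at most 4 \<epsilon> N I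
    = I / 4 of the mass.\<close>
  define \<epsilon> where "\<epsilon> = 1 / (16 * N)"
  have N: "1 \<le> N" by (simp add: N_def)
  then have \<epsilon>: "0 < \<epsilon>" "\<epsilon> \<le> 1/16" by (auto simp: \<epsilon>_def field_simps)
  \<comment> \<open>Each factor climbs from 0 to 1 at distances between \<epsilon> and 2 \<epsilon>
    from its end point; the shift by -1 is what makes \<kappa> vanish in whole layers next to the
    ends.\<close>
  define \<kappa> where "\<kappa> x = step (x / \<epsilon> - 1) * step ((1 - x) / \<epsilon> - 1)" for x
  define \<kappa>' where "\<kappa>' x = dstep (x / \<epsilon> - 1) / \<epsilon> * step ((1 - x) / \<epsilon> - 1)
    - step (x / \<epsilon> - 1) * (dstep ((1 - x) / \<epsilon> - 1) / \<epsilon>)" for x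
  have der: "(\<kappa> has_real_derivative \<kappa>' x) (at x)" for x
    unfolding \<kappa>_def \<kappa>'_def using \<epsilon>
    by (auto intro!: derivative_eq_intros DERIV_chain2[OF step_deriv])
  have cont_step: "continuous_on S (\<lambda>x. step (f x))" if "continuous_on S f" for S and f :: "real \<Rightarrow> real"
    using that unfolding step_def by (intro continuous_intros)
  have cont': "continuous_on S \<kappa>'" for S
    unfolding \<kappa>'_def using \<epsilon> by (intro continuous_intros cont_step) auto
  have cont: "continuous_on S \<kappa>" for S
    unfolding \<kappa>_def using \<epsilon> by (intro continuous_intros cont_step) auto
  have bnd: "0 \<le> \<kappa> x" "\<kappa> x \<le> 1" for x
    using step_bounds by (auto simp: \<kappa>_def intro!: mult_le_one)
  have zero: "\<kappa> x = 0 \<and> \<kappa>' x = 0" if "x \<le> \<epsilon> \<or> 1 - \<epsilon> \<le> x" for x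
  proof -
    have "x / \<epsilon> - 1 \<le> 0 \<or> (1 - x) / \<epsilon> - 1 \<le> 0" using that \<epsilon> by (auto simp: field_simps)
    then show ?thesis by (auto simp: \<kappa>_def \<kappa>'_def step_cases)
  qed
  have one: "\<kappa> x = 1 \<and> \<kappa>' x = 0" if "2 * \<epsilon> \<le> x" "x \<le> 1 - 2 * \<epsilon>" for x
  proof -
    have "1 \<le> x / \<epsilon> - 1" "1 \<le> (1 - x) / \<epsilon> - 1" using that \<epsilon> by (auto simp: field_simps)
    then show ?thesis by (auto simp: \<kappa>_def \<kappa>'_def step_cases)
  qed
  have bnd': "(\<kappa>' x)\<^sup>2 \<le> 4 / \<epsilon>\<^sup>2" for x
  proof -
    have "0 \<le> dstep (x / \<epsilon> - 1) / \<epsilon> * step ((1 - x) / \<epsilon> - 1)"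
      "dstep (x / \<epsilon> - 1) / \<epsilon> * step ((1 - x) / \<epsilon> - 1) \<le> 2 / \<epsilon> * 1"
      "0 \<le> step (x / \<epsilon> - 1) * (dstep ((1 - x) / \<epsilon> - 1) / \<epsilon>)"
      "step (x / \<epsilon> - 1) * (dstep ((1 - x) / \<epsilon> - 1) / \<epsilon>) \<le> 1 * (2 / \<epsilon>)"
      using step_bounds dstep_bounds \<epsilon>
      by (intro mult_nonneg_nonneg mult_mono divide_nonneg_pos divide_right_mono; simp)+
    then have "\<bar>\<kappa>' x\<bar> \<le> 2 / \<epsilon>" unfolding \<kappa>'_def by linarith
    then have "\<bar>\<kappa>' x\<bar>\<^sup>2 \<le> (2 / \<epsilon>)\<^sup>2" by (intro power_mono) auto
    then show ?thesis by (simp add: power_divide)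
  qed
  note ci = continuous_intros cont cont'
  show thesis
  proof (rule that[of \<epsilon> \<kappa> \<kappa>'])
    fix q :: "real poly" assume q: "degree q \<le> n"
    define I where "I = integral {0..1} (\<lambda>x. (poly q x)\<^sup>2)"
    have I0: "0 \<le> I" unfolding I_def by (intro integral_nonneg integrable_continuous_interval continuous_intros) auto
    have sup: "(poly q x)\<^sup>2 \<le> N * I" if "0 \<le> x" "x \<le> 1" for x
      using poly_sup_bound[OF q that] by (simp add: N_def I_def)
    have "I - integral {0..1} (\<lambda>x. \<kappa> x * (poly q x)\<^sup>2) = integral {0..1} (\<lambda>x. (1 - \<kappa> x) * (poly q x)\<^sup>2)"
      unfolding I_def
      by (subst integral_diff[symmetric]) (auto intro!: integrable_continuous_interval ci simp: algebra_simps)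
    also have "\<dots> \<le> 2 * (2 * \<epsilon>) * (1 * (N * I))"
    proof (rule integral_layers_le)
      fix x :: real assume "0 \<le> x" "x \<le> 1"
      then show "(1 - \<kappa> x) * (poly q x)\<^sup>2 \<le> 1 * (N * I)"
        using bnd[of x] sup by (intro mult_mono) auto
    qed (use \<epsilon> N I0 one in \<open>auto intro!: ci\<close>)
    also have "\<dots> = I / 4" using N by (simp add: \<epsilon>_def)
    finally show "integral {0..1} (\<lambda>x. (poly q x)\<^sup>2) \<le> 2 * integral {0..1} (\<lambda>x. \<kappa> x * (poly q x)\<^sup>2)"
      using I0 unfolding I_def by linarith
    let ?W = "[:0, 1, -1:] * pderiv q * pderiv q"
    have "integral {0..1} (\<lambda>x. (\<kappa>' x * poly q x + \<kappa> x * poly (pderiv q) x)\<^sup>2)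
      \<le> integral {0..1} (\<lambda>x. 2 * ((\<kappa>' x)\<^sup>2 * (poly q x)\<^sup>2) + (4 / \<epsilon>) * poly ?W x)"
    proof (intro integral_le integrable_continuous_interval ci)
      fix x :: real assume x: "x \<in> {0..1}"
      have "(\<kappa>' x * poly q x + \<kappa> x * poly (pderiv q) x)\<^sup>2
        \<le> 2 * (\<kappa>' x * poly q x)\<^sup>2 + 2 * (\<kappa> x * poly (pderiv q) x)\<^sup>2"
        using zero_le_power2[of "\<kappa>' x * poly q x - \<kappa> x * poly (pderiv q) x"]
        by (simp add: power2_sum power2_diff)
      \<comment> \<open>The cutoff is traded for the weight of the Markov inequality: \<kappa>
        vanishes within \<epsilon> of the ends, and elsewhere one of x and 1 - x is at least
        \<epsilon> and the other at least 1/2.\<close>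
      moreover have "(\<kappa> x)\<^sup>2 \<le> (2 / \<epsilon>) * (x * (1 - x))"
      proof (cases "x \<le> \<epsilon> \<or> 1 - \<epsilon> \<le> x")
        case True
        then show ?thesis using zero[OF True] x \<epsilon> by (auto intro!: mult_nonneg_nonneg)
      next
        case False
        have "(\<kappa> x)\<^sup>2 \<le> 1" using bnd[of x] by (simp add: abs_square_le_1)
        moreover have "\<epsilon> \<le> 2 * (x * (1 - x))"
        proof (cases "x \<le> 1/2")
          case True
          then have "\<epsilon> * (1/2) \<le> x * (1 - x)" using False x \<epsilon> by (intro mult_mono) auto
          then show ?thesis by simp
        next
          case f: False
          then have "(1/2) * \<epsilon> \<le> x * (1 - x)" using False x \<epsilon> by (intro mult_mono) auto
          then show ?thesis by simp
        qed
        moreover have "1 \<le> (2 / \<epsilon>) * (x * (1 - x))"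
          using \<open>\<epsilon> \<le> 2 * (x * (1 - x))\<close> \<epsilon>(1) by (simp add: pos_le_divide_eq)
        ultimately show ?thesis by linarith
      qed
      then have "(\<kappa> x)\<^sup>2 * (poly (pderiv q) x)\<^sup>2 \<le> (2 / \<epsilon>) * (x * (1 - x)) * (poly (pderiv q) x)\<^sup>2"
        by (rule mult_right_mono) simp
      moreover have "poly ?W x = x * (1 - x) * (poly (pderiv q) x)\<^sup>2"
        by (simp add: power2_eq_square algebra_simps)
      ultimately show "(\<kappa>' x * poly q x + \<kappa> x * poly (pderiv q) x)\<^sup>2
          \<le> 2 * ((\<kappa>' x)\<^sup>2 * (poly q x)\<^sup>2) + (4 / \<epsilon>) * poly ?W x"
        by (simp only: power_mult_distrib)
    qed
    also have "\<dots> = 2 * integral {0..1} (\<lambda>x. (\<kappa>' x)\<^sup>2 * (poly q x)\<^sup>2) + (4 / \<epsilon>) * pint ?W"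
      by (rule integral_add_pint) (intro ci)
    also have "integral {0..1} (\<lambda>x. (\<kappa>' x)\<^sup>2 * (poly q x)\<^sup>2) \<le> 2 * (2 * \<epsilon>) * ((4 / \<epsilon>\<^sup>2) * (N * I))"
    proof (rule integral_layers_le)
      fix x :: real assume "0 \<le> x" "x \<le> 1"
      then show "(\<kappa>' x)\<^sup>2 * (poly q x)\<^sup>2 \<le> (4 / \<epsilon>\<^sup>2) * (N * I)"
        using bnd'[of x] sup by (intro mult_mono) auto
    qed (use \<epsilon> N I0 one in \<open>auto intro!: ci\<close>)
    also have "2 * (2 * \<epsilon>) * ((4 / \<epsilon>\<^sup>2) * (N * I)) = 256 * N\<^sup>2 * I"
      using N by (simp add: \<epsilon>_def power2_eq_square field_simps)
    also have "pint ?W \<le> N * I"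
    proof -
      have "pint ?W \<le> real n * real (n + 1) * pint (q * q)" by (rule weighted_markov[OF q])
      also have "pint (q * q) = I" unfolding I_def pint_def
        by (intro arg_cong[where f = "integral _"]) (auto simp: fun_eq_iff power2_eq_square)
      also have "real n * real (n + 1) * I \<le> N * I"
        unfolding N_def power2_eq_square using I0 by (intro mult_right_mono) auto
      finally show ?thesis .
    qed
    \<comment> \<open>Both contributions are of order N^2: with 1 / \<epsilon> = 16 N the layers
      give 2 * 256 and the weighted derivative gives 64.\<close>
    also have "2 * (256 * N\<^sup>2 * I) + (4 / \<epsilon>) * (N * I) = 576 * N\<^sup>2 * I"
      using N by (simp add: \<epsilon>_def power2_eq_square field_simps)
    finally have "integral {0..1} (\<lambda>x. (\<kappa>' x * poly q x + \<kappa> x * poly (pderiv q) x)\<^sup>2) \<le> 576 * N\<^sup>2 * I"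
      using \<epsilon> by (simp add: divide_right_mono mult_left_mono)
    also have "N\<^sup>2 = real (n + 1) ^ 4" by (simp add: N_def flip: power_mult)
    \<comment> \<open>Rounded up to 3000, from which the later weight 48000 = 16 * 3000 is
      formed.\<close>
    also have "576 * real (n + 1) ^ 4 * I \<le> 3000 * real (n + 1) ^ 4 * I"
      using I0 by (intro mult_right_mono) auto
    finally show "integral {0..1} (\<lambda>x. (\<kappa>' x * poly q x + \<kappa> x * poly (pderiv q) x)\<^sup>2)
        \<le> 3000 * real (n + 1) ^ 4 * integral {0..1} (\<lambda>x. (poly q x)\<^sup>2)"
      by (simp add: I_def)
  qed (use \<epsilon> der cont' bnd zero in auto)
qed

section \<open>Polynomials in two variables and integrals over the unit square\<close>

text \<open>Degree at most m in x and at most n in y. Generation by rules turns sections,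
  derivatives and continuity into plain inductions; the inequalities in \<open>mult\<close> allow a
  degree bound to be relaxed.\<close>

inductive bipoly :: "nat \<Rightarrow> nat \<Rightarrow> (real \<Rightarrow> real \<Rightarrow> real) \<Rightarrow> bool" where
  const: "bipoly m n (\<lambda>x y. c)"
| fst: "bipoly (Suc m) n (\<lambda>x y. x)"
| snd: "bipoly m (Suc n) (\<lambda>x y. y)"
| add: "bipoly m n f \<Longrightarrow> bipoly m n g \<Longrightarrow> bipoly m n (\<lambda>x y. f x y + g x y)"
| mult: "bipoly m n f \<Longrightarrow> bipoly m' n' g \<Longrightarrow> m + m' \<le> k \<Longrightarrow> n + n' \<le> l
    \<Longrightarrow> bipoly k l (\<lambda>x y. f x y * g x y)"

lemma bipoly_swap: "bipoly m n f \<Longrightarrow> bipoly n m (\<lambda>x y. f y x)"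
  by (induction rule: bipoly.induct) (auto intro: bipoly.intros)

text \<open>The link to the one-variable inequalities, which are applied on each horizontal line;
  vertical lines follow through \<open>bipoly_swap\<close>.\<close>

lemma bipoly_section: "bipoly m n f \<Longrightarrow> \<exists>P. degree P \<le> m \<and> (\<forall>x. f x y = poly P x)"
proof (induction rule: bipoly.induct)
  case (const m n c)
  show ?case by (rule exI[of _ "[:c:]"]) simp
next
  case (fst m n)
  show ?case by (rule exI[of _ "[:0, 1:]"]) simp
next
  case (snd m n)
  show ?case by (rule exI[of _ "[:y:]"]) simp
next
  case (add m n f g)
  then obtain P Q where "degree P \<le> m" "\<forall>x. f x y = poly P x" "degree Q \<le> m" "\<forall>x. g x y = poly Q x" by blast
  then show ?case by (intro exI[of _ "P + Q"]) (auto intro: degree_add_le)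
next
  case (mult m n f m' n' g k l)
  then obtain P Q where "degree P \<le> m" "\<forall>x. f x y = poly P x" "degree Q \<le> m'" "\<forall>x. g x y = poly Q x" by blast
  then show ?case using mult.hyps(3) degree_mult_le[of P Q] by (intro exI[of _ "P * Q"]) auto
qed

text \<open>The degree bound is kept and not lowered: a common bound for f and its derivative makes
  the product case go through.\<close>

lemma bipoly_deriv:
  "bipoly m n f \<Longrightarrow> \<exists>f'. bipoly m n f' \<and> (\<forall>x y. ((\<lambda>x. f x y) has_real_derivative f' x y) (at x))"
proof (induction rule: bipoly.induct)
  case (const m n c)
  show ?case by (rule exI[of _ "\<lambda>x y. 0"]) (auto intro: bipoly.const)
next
  case (fst m n)
  show ?case by (rule exI[of _ "\<lambda>x y. 1"]) (auto intro: bipoly.const)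
next
  case (snd m n)
  show ?case by (rule exI[of _ "\<lambda>x y. 0"]) (auto intro: bipoly.const)
next
  case (add m n f g)
  then obtain f' g' where "bipoly m n f'" "\<And>x y. ((\<lambda>x. f x y) has_real_derivative f' x y) (at x)"
    "bipoly m n g'" "\<And>x y. ((\<lambda>x. g x y) has_real_derivative g' x y) (at x)" by blast
  then show ?case
    by (intro exI[of _ "\<lambda>x y. f' x y + g' x y"]) (auto intro!: bipoly.add derivative_eq_intros)
next
  case (mult m n f m' n' g k l)
  then obtain f' g' where *: "bipoly m n f'" "\<And>x y. ((\<lambda>x. f x y) has_real_derivative f' x y) (at x)"
    "bipoly m' n' g'" "\<And>x y. ((\<lambda>x. g x y) has_real_derivative g' x y) (at x)" by blast
  have "bipoly k l (\<lambda>x y. f' x y * g x y + f x y * g' x y)"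
    using * mult by (intro bipoly.add bipoly.mult[where m = m and n = n and m' = m' and n' = n']) auto
  moreover have "((\<lambda>x. f x y * g x y) has_real_derivative f' x y * g x y + f x y * g' x y) (at x)" for x y
    using DERIV_mult[OF *(2,4)] by (simp add: algebra_simps)
  ultimately show ?case by blast
qed

lemma bipoly_continuous:
  "bipoly m n f \<Longrightarrow> continuous_on S a \<Longrightarrow> continuous_on S b \<Longrightarrow> continuous_on S (\<lambda>t. f (a t) (b t))"
  by (induction rule: bipoly.induct) (auto intro!: continuous_intros)

lemma bipoly_power: "bipoly m n f \<Longrightarrow> bipoly (k * m) (k * n) (\<lambda>x y. f x y ^ k)"
  by (induction k) (auto intro: bipoly.const bipoly.mult)

lemma bipoly_sum: "(\<And>i. i \<in> A \<Longrightarrow> bipoly m n (f i)) \<Longrightarrow> bipoly m n (\<lambda>x y. \<Sum>i\<in>A. f i x y)"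
  by (induction A rule: infinite_finite_induct) (auto intro: bipoly.intros)

section \<open>Coordinates of the plane and iterated integrals\<close>

definition pt :: "real \<Rightarrow> real \<Rightarrow> real^2" where
  "pt x y = vector [x, y]"

lemma pt_nth [simp]: "pt x y $ 1 = x" "pt x y $ 2 = y"
  by (simp_all add: pt_def)

lemma pt_eta [simp]: "pt (s $ 1) (s $ 2) = s"
  by (simp add: vec_eq_iff forall_2)

lemma pt_eq_axis: "pt x y = x *\<^sub>R axis 1 1 + y *\<^sub>R axis 2 1"
  by (simp add: vec_eq_iff forall_2 axis_def)

lemma continuous_on_pt [continuous_intros]:
  "continuous_on S f \<Longrightarrow> continuous_on S g \<Longrightarrow> continuous_on S (\<lambda>t. pt (f t) (g t))"
  unfolding pt_eq_axis by (intro continuous_intros)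

lemma mem_cbox_2: "(s :: real^2) \<in> cbox a b \<longleftrightarrow> a $ 1 \<le> s $ 1 \<and> s $ 1 \<le> b $ 1 \<and> a $ 2 \<le> s $ 2 \<and> s $ 2 \<le> b $ 2"
  by (auto simp: mem_box_cart forall_2)

lemma mem_box_2: "(s :: real^2) \<in> box a b \<longleftrightarrow> a $ 1 < s $ 1 \<and> s $ 1 < b $ 1 \<and> a $ 2 < s $ 2 \<and> s $ 2 < b $ 2"
  by (auto simp: mem_box_cart forall_2)

lemma pt_image_cbox: "(\<lambda>(x, y). pt x y) ` cbox (a, c) (b, d) = cbox (pt a c) (pt b d)"
proof (intro set_eqI iffI)
  fix s assume "s \<in> cbox (pt a c) (pt b d)"
  then show "s \<in> (\<lambda>(x, y). pt x y) ` cbox (a, c) (b, d)"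
    by (intro image_eqI[of _ _ "(s $ 1, s $ 2)"]) (auto simp: mem_cbox_2)
qed (auto simp: mem_cbox_2)

lemma proj_image_cbox: "(\<lambda>s :: real^2. (s $ 1, s $ 2)) ` cbox u v = cbox (u $ 1, u $ 2) (v $ 1, v $ 2)"
proof (intro set_eqI iffI)
  fix p assume "p \<in> cbox (u $ 1, u $ 2) (v $ 1, v $ 2)"
  then show "p \<in> (\<lambda>s :: real^2. (s $ 1, s $ 2)) ` cbox u v"
    by (cases p) (intro image_eqI[of _ _ "pt (fst p) (snd p)"]; auto simp: mem_cbox_2)
qed (auto simp: mem_cbox_2)

lemma content_cbox_2:
  assumes "a \<le> b" "c \<le> d"
  shows "measure lborel (cbox (pt a c) (pt b d)) = (b - a) * (d - c)"
proof -
  have "pt a c \<in> cbox (pt a c) (pt b d)" using assms by (simp add: mem_cbox_2)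
  then have "cbox (pt a c) (pt b d) \<noteq> {}" by blast
  then show ?thesis by (subst content_cbox_cart) (auto simp: UNIV_2)
qed

text \<open>The identification of \<open>real \<times> real\<close> with \<open>real^2\<close> maps
  boxes to boxes of the same content; it carries integrals over a product to the vector
  type.\<close>

lemma has_integral_pt:
  fixes f :: "real^2 \<Rightarrow> real"
  assumes "((\<lambda>(x, y). f (pt x y)) has_integral i) (cbox (a, c) (b, d))"
  shows "(f has_integral i) (cbox (pt a c) (pt b d))"
proof -
  have inv_image: "\<exists>w z. (\<lambda>s :: real^2. (s $ 1, s $ 2)) ` cbox u v = cbox w z" for u v
  proof -
    show ?thesis using proj_image_cbox by blast
  qed
  have content: "measure lborel ((\<lambda>s :: real^2. (s $ 1, s $ 2)) ` cbox u v) = 1 * measure lborel (cbox u v)" for u v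
  proof (cases "cbox u v = {}")
    case False
    then have le: "u $ 1 \<le> v $ 1" "u $ 2 \<le> v $ 2" by (auto simp: mem_cbox_2)
    show ?thesis
      using le content_cbox_2[OF le] by (simp add: content_Pair proj_image_cbox)
  qed simp
  have "((\<lambda>s. (\<lambda>(x, y). f (pt x y)) (s $ 1, s $ 2)) has_integral (1 / 1) *\<^sub>R i)
      ((\<lambda>(x, y). pt x y) ` cbox (a, c) (b, d))"
  proof (rule has_integral_twiddle[OF _ _ _ _ _ _ content assms])
    show "\<exists>w z. (\<lambda>(x, y). pt x y) ` cbox u v = cbox w z" for u v
      using pt_image_cbox by (metis surj_pair)
    show "continuous (at x) (\<lambda>s :: real^2. (s $ 1, s $ 2))" for x
      by (intro continuous_intros continuous_component)
  qed (use inv_image in auto)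
  then show ?thesis by (simp add: pt_image_cbox)
qed

lemma cbox_01: "cbox (0 :: real^2) 1 = cbox (pt 0 0) (pt 1 1)"
  by (auto simp: mem_cbox_2)

lemma integral_square_iterated:
  fixes f :: "real^2 \<Rightarrow> real"
  assumes "continuous_on (cbox 0 1) f"
  shows "integral (cbox 0 1) f = integral {0..1} (\<lambda>x. integral {0..1} (\<lambda>y. f (pt x y)))"
    and "integral (cbox 0 1) f = integral {0..1} (\<lambda>y. integral {0..1} (\<lambda>x. f (pt x y)))"
proof -
  have cont: "continuous_on (cbox (0, 0) (1, 1)) (\<lambda>(x, y). f (pt x y))"
    unfolding case_prod_unfold
    by (rule continuous_on_compose2[OF assms]) (auto intro!: continuous_intros simp: mem_cbox_2)
  have "((\<lambda>(x, y). f (pt x y)) has_integral integral (cbox (0, 0) (1, 1)) (\<lambda>(x, y). f (pt x y)))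
      (cbox (0, 0) (1, 1))"
    using cont by (intro integrable_integral integrable_continuous)
  from has_integral_pt[OF this]
  have "integral (cbox 0 1) f = integral (cbox (0, 0) (1, 1)) (\<lambda>(x, y). f (pt x y))"
    by (auto simp: cbox_01 intro: integral_unique)
  then show 1: "integral (cbox 0 1) f = integral {0..1} (\<lambda>x. integral {0..1} (\<lambda>y. f (pt x y)))"
    using integral_prod_continuous[OF cont] by simp
  show "integral (cbox 0 1) f = integral {0..1} (\<lambda>y. integral {0..1} (\<lambda>x. f (pt x y)))"
    using integral_swap_continuous[OF cont] 1 by simp
qed

lemma continuous_section_integral:
  fixes f :: "real^2 \<Rightarrow> real"
  assumes "continuous_on (cbox 0 1) f"
  shows "continuous_on {0..1} (\<lambda>x. integral {0..1} (\<lambda>y. f (pt x y)))"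
    and "continuous_on {0..1} (\<lambda>y. integral {0..1} (\<lambda>x. f (pt x y)))"
proof -
  have c: "continuous_on ({0..1} \<times> {0..1}) (\<lambda>(x, y). f (pt x y))"
    "continuous_on ({0..1} \<times> {0..1}) (\<lambda>(y, x). f (pt x y))"
    unfolding case_prod_unfold
    by (rule continuous_on_compose2[OF assms]; auto intro!: continuous_intros simp: mem_cbox_2)+
  show "continuous_on {0..1} (\<lambda>x. integral {0..1} (\<lambda>y. f (pt x y)))"
    using integral_continuous_on_param[of "{0..1}" 0 1 "\<lambda>x y. f (pt x y)"] c by simp
  show "continuous_on {0..1} (\<lambda>y. integral {0..1} (\<lambda>x. f (pt x y)))"
    using integral_continuous_on_param[of "{0..1}" 0 1 "\<lambda>y x. f (pt x y)"] c by simp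
qed

lemma integral_square_le:
  fixes f g :: "real^2 \<Rightarrow> real"
  assumes "continuous_on (cbox 0 1) f" "continuous_on (cbox 0 1) g"
    and "\<And>y. 0 \<le> y \<Longrightarrow> y \<le> 1 \<Longrightarrow> integral {0..1} (\<lambda>x. f (pt x y)) \<le> integral {0..1} (\<lambda>x. g (pt x y))"
  shows "integral (cbox 0 1) f \<le> integral (cbox 0 1) g"
  unfolding integral_square_iterated(2)[OF assms(1)] integral_square_iterated(2)[OF assms(2)]
  by (rule integral_le) (auto intro!: integrable_continuous_interval continuous_section_integral assms)

lemma integral_square_le':
  fixes f g :: "real^2 \<Rightarrow> real"
  assumes "continuous_on (cbox 0 1) f" "continuous_on (cbox 0 1) g"
    and "\<And>x. 0 \<le> x \<Longrightarrow> x \<le> 1 \<Longrightarrow> integral {0..1} (\<lambda>y. f (pt x y)) \<le> integral {0..1} (\<lambda>y. g (pt x y))"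
  shows "integral (cbox 0 1) f \<le> integral (cbox 0 1) g"
  unfolding integral_square_iterated(1)[OF assms(1)] integral_square_iterated(1)[OF assms(2)]
  by (rule integral_le) (auto intro!: integrable_continuous_interval continuous_section_integral assms)

lemma integral_square_swap:
  fixes f :: "real^2 \<Rightarrow> real"
  assumes "continuous_on (cbox 0 1) f"
  shows "integral (cbox 0 1) (\<lambda>s :: real^2. f (pt (s $ 2) (s $ 1))) = integral (cbox 0 1) f"
proof -
  have "continuous_on (cbox 0 1) (\<lambda>s :: real^2. f (pt (s $ 2) (s $ 1)))"
    by (rule continuous_on_compose2[OF assms]) (auto intro!: continuous_intros simp: mem_cbox_2)
  from integral_square_iterated(1)[OF this] integral_square_iterated(2)[OF assms]
  show ?thesis by simp
qed

section \<open>The cutoff test function on the square\<close>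

lemma axis_2_nth [simp]: "axis 1 a $ (1::2) = a" "axis 1 a $ (2::2) = 0"
  "axis 2 a $ (1::2) = 0" "axis 2 a $ (2::2) = a"
  by (simp_all add: axis_def)

text \<open>\<psi> is \<kappa>(x) \<kappa>(y) r. A derivative in x meets only the factor \<kappa>(x)
  r, which is handled on each horizontal line, while \<kappa>(y)^2 is at most 1. The mass bound is
  used once in each variable, hence 4 = 2 * 2.\<close>

lemma square_cutoff_1:
  assumes r: "bipoly n n r"
  obtains \<epsilon> and \<psi> \<psi>' :: "real^2 \<Rightarrow> real" where
    "0 < \<epsilon>" "\<epsilon> < 1/2" "continuous_on UNIV \<psi>" "continuous_on UNIV \<psi>'"
    "\<And>s. ((\<lambda>t. \<psi> (s + t *\<^sub>R axis 1 1)) has_real_derivative \<psi>' s) (at 0)"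
    "\<And>s. s \<notin> cbox (pt \<epsilon> \<epsilon>) (pt (1 - \<epsilon>) (1 - \<epsilon>)) \<Longrightarrow> \<psi> s = 0 \<and> \<psi>' s = 0"
    "\<And>s. (\<psi> s)\<^sup>2 \<le> (r (s $ 1) (s $ 2))\<^sup>2"
    "integral (cbox 0 1) (\<lambda>s :: real^2. (r (s $ 1) (s $ 2))\<^sup>2)
      \<le> 4 * integral (cbox 0 1) (\<lambda>s :: real^2. \<psi> s * r (s $ 1) (s $ 2))"
    "integral (cbox 0 1) (\<lambda>s :: real^2. (\<psi>' s)\<^sup>2)
      \<le> 3000 * real (n + 1) ^ 4 * integral (cbox 0 1) (\<lambda>s :: real^2. (r (s $ 1) (s $ 2))\<^sup>2)"
proof -
  obtain r' where r': "bipoly n n r'" "\<And>x y. ((\<lambda>x. r x y) has_real_derivative r' x y) (at x)"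
    using bipoly_deriv[OF r] by blast
  obtain \<epsilon> and \<kappa> \<kappa>' :: "real \<Rightarrow> real" where \<epsilon>: "0 < \<epsilon>" "\<epsilon> < 1/2"
    and \<kappa>: "\<And>x. (\<kappa> has_real_derivative \<kappa>' x) (at x)" "continuous_on UNIV \<kappa>'"
      "\<And>x. 0 \<le> \<kappa> x" "\<And>x. \<kappa> x \<le> 1"
      "\<And>x. x \<le> \<epsilon> \<or> 1 - \<epsilon> \<le> x \<Longrightarrow> \<kappa> x = 0"
      "\<And>x. x \<le> \<epsilon> \<or> 1 - \<epsilon> \<le> x \<Longrightarrow> \<kappa>' x = 0"
    and \<kappa>_int: "\<And>q :: real poly. degree q \<le> n \<Longrightarrow>
      integral {0..1} (\<lambda>x. (poly q x)\<^sup>2) \<le> 2 * integral {0..1} (\<lambda>x. \<kappa> x * (poly q x)\<^sup>2)"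
    and \<kappa>_deriv: "\<And>q :: real poly. degree q \<le> n \<Longrightarrow>
      integral {0..1} (\<lambda>x. (\<kappa>' x * poly q x + \<kappa> x * poly (pderiv q) x)\<^sup>2)
        \<le> 3000 * real (n + 1) ^ 4 * integral {0..1} (\<lambda>x. (poly q x)\<^sup>2)"
    by (rule polynomial_cutoff[of n]) (rule that; assumption)
  have "continuous_on UNIV \<kappa>" by (rule DERIV_continuous_on) (use \<kappa>(1) in blast)
  then have cont_\<kappa>: "continuous_on S (\<lambda>x. \<kappa> (f x))" and cont_\<kappa>': "continuous_on S (\<lambda>x. \<kappa>' (f x))"
    if "continuous_on S f" for S and f :: "real^2 \<Rightarrow> real"
    using that \<kappa>(2) by (auto intro: continuous_on_compose2)
  define \<psi> where "\<psi> s = \<kappa> (s $ 1) * \<kappa> (s $ 2) * r (s $ 1) (s $ 2)" for s :: "real^2"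
  define \<psi>' where "\<psi>' s = \<kappa> (s $ 2) * (\<kappa>' (s $ 1) * r (s $ 1) (s $ 2) + \<kappa> (s $ 1) * r' (s $ 1) (s $ 2))" for s :: "real^2"
  note ci = continuous_intros cont_\<kappa> cont_\<kappa>' bipoly_continuous[OF r] bipoly_continuous[OF r'(1)]
  have \<kappa>2: "(\<kappa> x)\<^sup>2 \<le> 1" for x using \<kappa>(3,4)[of x] by (simp add: abs_square_le_1)
  show thesis
  proof (rule that[of \<epsilon> \<psi> \<psi>'])
    show "continuous_on UNIV \<psi>" "continuous_on UNIV \<psi>'"
      unfolding \<psi>_def \<psi>'_def by (intro ci)+
    show "((\<lambda>t. \<psi> (s + t *\<^sub>R axis 1 1)) has_real_derivative \<psi>' s) (at 0)" for s
    proof -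
      have 1: "((\<lambda>t. \<kappa> (s $ 1 + t)) has_real_derivative \<kappa>' (s $ 1)) (at 0)"
        using \<kappa>(1)[of "s $ 1"] DERIV_shift[of \<kappa> _ 0 "s $ 1"] by (simp add: add.commute)
      have 2: "((\<lambda>t. r (s $ 1 + t) (s $ 2)) has_real_derivative r' (s $ 1) (s $ 2)) (at 0)"
        using r'(2)[of "s $ 2" "s $ 1"] DERIV_shift[of "\<lambda>x. r x (s $ 2)" _ 0 "s $ 1"] by (simp add: add.commute)
      have "((\<lambda>t. \<kappa> (s $ 1 + t) * \<kappa> (s $ 2) * r (s $ 1 + t) (s $ 2)) has_real_derivative \<psi>' s) (at 0)"
        by (rule derivative_eq_intros 1 2 refl)+ (simp add: \<psi>'_def algebra_simps)
      then show ?thesis by (simp add: \<psi>_def)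
    qed
    show "\<psi> s = 0 \<and> \<psi>' s = 0" if "s \<notin> cbox (pt \<epsilon> \<epsilon>) (pt (1 - \<epsilon>) (1 - \<epsilon>))" for s
    proof -
      have "(s $ 1 \<le> \<epsilon> \<or> 1 - \<epsilon> \<le> s $ 1) \<or> (s $ 2 \<le> \<epsilon> \<or> 1 - \<epsilon> \<le> s $ 2)"
        using that by (auto simp: mem_cbox_2)
      then show ?thesis using \<kappa>(5,6) by (auto simp: \<psi>_def \<psi>'_def)
    qed
    show "(\<psi> s)\<^sup>2 \<le> (r (s $ 1) (s $ 2))\<^sup>2" for s
    proof -
      have "(\<kappa> (s $ 1))\<^sup>2 * (\<kappa> (s $ 2))\<^sup>2 \<le> 1" using \<kappa>2 by (intro mult_le_one) auto
      from mult_right_mono[OF this, of "(r (s $ 1) (s $ 2))\<^sup>2"]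
      show ?thesis by (simp add: \<psi>_def power_mult_distrib)
    qed
    have "integral (cbox 0 1) (\<lambda>s :: real^2. (r (s $ 1) (s $ 2))\<^sup>2)
        \<le> integral (cbox 0 1) (\<lambda>s :: real^2. 2 * (\<kappa> (s $ 1) * (r (s $ 1) (s $ 2))\<^sup>2))"
    proof (rule integral_square_le)
      fix y :: real
      obtain P where "degree P \<le> n" "\<And>x. r x y = poly P x" using bipoly_section[OF r] by blast
      then show "integral {0..1} (\<lambda>x. (r (pt x y $ 1) (pt x y $ 2))\<^sup>2)
          \<le> integral {0..1} (\<lambda>x. 2 * (\<kappa> (pt x y $ 1) * (r (pt x y $ 1) (pt x y $ 2))\<^sup>2))"
        using \<kappa>_int[of P] by simp
    qed (intro ci)+
    also have "\<dots> \<le> integral (cbox 0 1) (\<lambda>s :: real^2. 4 * (\<psi> s * r (s $ 1) (s $ 2)))"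
    proof (rule integral_square_le')
      fix x :: real
      obtain P where P: "degree P \<le> n" "\<And>y. r x y = poly P y"
        using bipoly_section[OF bipoly_swap[OF r], of x] by blast
      have "integral {0..1} (\<lambda>y. \<psi> (pt x y) * r x y) = \<kappa> x * integral {0..1} (\<lambda>y. \<kappa> y * (poly P y)\<^sup>2)"
        by (subst integral_mult_right[symmetric], intro arg_cong[where f = "integral _"])
          (auto simp: \<psi>_def P(2) power2_eq_square fun_eq_iff)
      then show "integral {0..1} (\<lambda>y. 2 * (\<kappa> (pt x y $ 1) * (r (pt x y $ 1) (pt x y $ 2))\<^sup>2))
          \<le> integral {0..1} (\<lambda>y. 4 * (\<psi> (pt x y) * r (pt x y $ 1) (pt x y $ 2)))"
        using mult_left_mono[OF \<kappa>_int[OF P(1)] \<kappa>(3)[of x]] by (simp add: P(2))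
    qed (unfold \<psi>_def, (intro ci)+)
    finally show "integral (cbox 0 1) (\<lambda>s :: real^2. (r (s $ 1) (s $ 2))\<^sup>2)
      \<le> 4 * integral (cbox 0 1) (\<lambda>s :: real^2. \<psi> s * r (s $ 1) (s $ 2))" by simp
    have "integral (cbox 0 1) (\<lambda>s :: real^2. (\<psi>' s)\<^sup>2)
      \<le> integral (cbox 0 1) (\<lambda>s :: real^2. 3000 * real (n + 1) ^ 4 * (r (s $ 1) (s $ 2))\<^sup>2)"
    proof (rule integral_square_le)
      fix y :: real
      obtain P where P: "degree P \<le> n" "\<And>x. r x y = poly P x" using bipoly_section[OF r] by blast
      \<comment> \<open>On the line with ordinate y, \<open>r'\<close> is the derivative of the
        section polynomial, so the one-variable bound for the derivative of \<kappa> times a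
        polynomial applies.\<close>
      have r'P: "r' x y = poly (pderiv P) x" for x
        using r'(2)[where x = x and y = y] poly_DERIV[of P x] by (simp add: P(2) DERIV_unique)
      have "integral {0..1} (\<lambda>x. (\<psi>' (pt x y))\<^sup>2)
          = (\<kappa> y)\<^sup>2 * integral {0..1} (\<lambda>x. (\<kappa>' x * poly P x + \<kappa> x * poly (pderiv P) x)\<^sup>2)"
        by (simp add: \<psi>'_def P(2) r'P power_mult_distrib)
      also have "\<dots> \<le> 1 * (3000 * real (n + 1) ^ 4 * integral {0..1} (\<lambda>x. (poly P x)\<^sup>2))"
        using \<kappa>2 \<kappa>_deriv[OF P(1)]
        by (intro mult_mono mult_nonneg_nonneg integral_nonneg integrable_continuous_interval continuous_intros)
          (auto intro!: continuous_on_subset[OF \<open>continuous_on UNIV \<kappa>\<close>] continuous_on_subset[OF \<kappa>(2)] integral_nonneg integrable_continuous_interval continuous_intros)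
      finally show "integral {0..1} (\<lambda>x. (\<psi>' (pt x y))\<^sup>2)
          \<le> integral {0..1} (\<lambda>x. 3000 * real (n + 1) ^ 4 * (r (pt x y $ 1) (pt x y $ 2))\<^sup>2)"
        by (simp add: P(2))
    qed (unfold \<psi>'_def, (intro ci)+)
    then show "integral (cbox 0 1) (\<lambda>s :: real^2. (\<psi>' s)\<^sup>2)
      \<le> 3000 * real (n + 1) ^ 4 * integral (cbox 0 1) (\<lambda>s :: real^2. (r (s $ 1) (s $ 2))\<^sup>2)" by simp
  qed (use \<epsilon> in auto)
qed

text \<open>Direction 2 is direction 1 with the coordinates exchanged, a symmetry of the square that
  preserves the integral.\<close>

lemma square_cutoff:
  fixes i :: 2
  assumes r: "bipoly n n r"
  obtains \<epsilon> and \<psi> \<psi>' :: "real^2 \<Rightarrow> real" where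
    "0 < \<epsilon>" "\<epsilon> < 1/2" "continuous_on UNIV \<psi>" "continuous_on UNIV \<psi>'"
    "\<And>s. ((\<lambda>t. \<psi> (s + t *\<^sub>R axis i 1)) has_real_derivative \<psi>' s) (at 0)"
    "\<And>s. s \<notin> cbox (pt \<epsilon> \<epsilon>) (pt (1 - \<epsilon>) (1 - \<epsilon>)) \<Longrightarrow> \<psi> s = 0 \<and> \<psi>' s = 0"
    "\<And>s. (\<psi> s)\<^sup>2 \<le> (r (s $ 1) (s $ 2))\<^sup>2"
    "integral (cbox 0 1) (\<lambda>s :: real^2. (r (s $ 1) (s $ 2))\<^sup>2)
      \<le> 4 * integral (cbox 0 1) (\<lambda>s :: real^2. \<psi> s * r (s $ 1) (s $ 2))"
    "integral (cbox 0 1) (\<lambda>s :: real^2. (\<psi>' s)\<^sup>2)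
      \<le> 3000 * real (n + 1) ^ 4 * integral (cbox 0 1) (\<lambda>s :: real^2. (r (s $ 1) (s $ 2))\<^sup>2)"
proof (cases "i = 1")
  case True
  show thesis
    by (rule square_cutoff_1[OF r]) (rule that[unfolded True]; assumption)
next
  case False
  then have i: "i = 2" using exhaust_2 by blast
  let ?T = "\<lambda>s :: real^2. pt (s $ 2) (s $ 1)"
  obtain \<epsilon> and \<psi> \<psi>' :: "real^2 \<Rightarrow> real" where *:
    "0 < \<epsilon>" "\<epsilon> < 1/2" "continuous_on UNIV \<psi>" "continuous_on UNIV \<psi>'"
    "\<And>s. ((\<lambda>t. \<psi> (s + t *\<^sub>R axis 1 1)) has_real_derivative \<psi>' s) (at 0)"
    "\<And>s. s \<notin> cbox (pt \<epsilon> \<epsilon>) (pt (1 - \<epsilon>) (1 - \<epsilon>)) \<Longrightarrow> \<psi> s = 0 \<and> \<psi>' s = 0"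
    "\<And>s. (\<psi> s)\<^sup>2 \<le> (r (s $ 2) (s $ 1))\<^sup>2"
    "integral (cbox 0 1) (\<lambda>s :: real^2. (r (s $ 2) (s $ 1))\<^sup>2)
      \<le> 4 * integral (cbox 0 1) (\<lambda>s :: real^2. \<psi> s * r (s $ 2) (s $ 1))"
    "integral (cbox 0 1) (\<lambda>s :: real^2. (\<psi>' s)\<^sup>2)
      \<le> 3000 * real (n + 1) ^ 4 * integral (cbox 0 1) (\<lambda>s :: real^2. (r (s $ 2) (s $ 1))\<^sup>2)"
    by (rule square_cutoff_1[OF bipoly_swap[OF r]]) (rule that; assumption)
  note ci = continuous_on_compose2[OF *(3)] continuous_on_compose2[OF *(4)]
    bipoly_continuous[OF r] continuous_intros
  have sw: "integral (cbox 0 1) (\<lambda>s :: real^2. (r (s $ 2) (s $ 1))\<^sup>2) = integral (cbox 0 1) (\<lambda>s :: real^2. (r (s $ 1) (s $ 2))\<^sup>2)"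
    "integral (cbox 0 1) (\<lambda>s :: real^2. \<psi> s * r (s $ 2) (s $ 1)) = integral (cbox 0 1) (\<lambda>s :: real^2. \<psi> (?T s) * r (s $ 1) (s $ 2))"
    "integral (cbox 0 1) (\<lambda>s :: real^2. (\<psi>' s)\<^sup>2) = integral (cbox 0 1) (\<lambda>s :: real^2. (\<psi>' (?T s))\<^sup>2)"
    using integral_square_swap[of "\<lambda>s. (r (s $ 1) (s $ 2))\<^sup>2"]
      integral_square_swap[of "\<lambda>s. \<psi> (?T s) * r (s $ 1) (s $ 2)"]
      integral_square_swap[of "\<lambda>s. (\<psi>' (?T s))\<^sup>2"]
    by (simp_all add: ci)
  show thesis
  proof (rule that[of \<epsilon> "\<lambda>s. \<psi> (?T s)" "\<lambda>s. \<psi>' (?T s)"])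
    show "continuous_on UNIV (\<lambda>s. \<psi> (?T s))" "continuous_on UNIV (\<lambda>s. \<psi>' (?T s))"
      by (auto intro!: ci)
    show "((\<lambda>t. \<psi> (?T (s + t *\<^sub>R axis i 1))) has_real_derivative \<psi>' (?T s)) (at 0)" for s
    proof -
      have "?T (s + t *\<^sub>R axis i 1) = ?T s + t *\<^sub>R axis 1 1" for t
        by (simp add: i vec_eq_iff forall_2)
      then show ?thesis using *(5)[of "?T s"] by simp
    qed
    show "\<psi> (?T s) = 0 \<and> \<psi>' (?T s) = 0" if "s \<notin> cbox (pt \<epsilon> \<epsilon>) (pt (1 - \<epsilon>) (1 - \<epsilon>))" for s
      using that *(6)[of "?T s"] by (auto simp: mem_cbox_2)
    show "(\<psi> (?T s))\<^sup>2 \<le> (r (s $ 1) (s $ 2))\<^sup>2" for s using *(7)[of "?T s"] by simp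
  qed (use * sw in auto)
qed

section \<open>Smooth bump functions\<close>

text \<open>The usual smooth but not analytic functions, multiplied by powers of \<open>1 / x\<close> so that the
  family is closed under differentiation.\<close>

definition flat :: "nat \<Rightarrow> real \<Rightarrow> real" where
  "flat j x = (if x \<le> 0 then 0 else (1 / x) ^ j * exp (- (1 / x)))"

text \<open>Exponential decay beats every power after the substitution h = 1 / x. The quotient is
  the difference quotient of \<open>flat j\<close> at 0, the only critical point for its
  differentiability.\<close>

lemma flat_lim: "((\<lambda>h. flat j h / h) \<longlongrightarrow> 0) (at 0)"
proof -
  have "((\<lambda>x. x ^ Suc j / exp x) \<longlongrightarrow> (0::real)) at_top" by (rule tendsto_power_div_exp_0)
  from filterlim_compose[OF this filterlim_inverse_at_top_right]
  have "((\<lambda>h. flat j h / h) \<longlongrightarrow> 0) (at_right 0)"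
    by (rule Lim_transform_eventually)
      (auto simp: eventually_at_right_field flat_def exp_minus field_simps intro!: exI[of _ 1])
  moreover have "((\<lambda>h. flat j h / h) \<longlongrightarrow> 0) (at_left 0)"
    by (rule tendsto_eventually) (auto simp: eventually_at_left_field flat_def intro!: exI[of _ "-1"])
  ultimately show ?thesis by (simp add: filterlim_split_at)
qed

lemma flat_deriv: "(flat j has_real_derivative flat (j + 2) x - real j * flat (j + 1) x) (at x)"
proof (cases x "0::real" rule: linorder_cases)
  case less
  have "((\<lambda>x. 0) has_real_derivative flat (j + 2) x - real j * flat (j + 1) x) (at x)"
    using less by (simp add: flat_def)
  then show ?thesis
    by (rule has_field_derivative_transform_within_open[where S = "{..<0}"])
      (use less in \<open>auto simp: flat_def\<close>)
next
  case greater
  have "((\<lambda>x. (1 / x) ^ j * exp (- (1 / x))) has_real_derivative flat (j + 2) x - real j * flat (j + 1) x) (at x)"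
  proof -
    define y where "y = 1 / x"
    have d: "((\<lambda>x. 1 / x) has_real_derivative - (y * y)) (at x)"
      using greater by (auto intro!: derivative_eq_intros simp: y_def power2_eq_square)
    have "((\<lambda>x. (1 / x) ^ j * exp (- (1 / x))) has_real_derivative
        (real j * (- (y * y) * y ^ (j - Suc 0))) * exp (- y) + exp (- y) * (- (- (y * y))) * y ^ j) (at x)"
      unfolding y_def by (rule derivative_eq_intros d[unfolded y_def] refl)+
    moreover have "(real j * (- (y * y) * y ^ (j - Suc 0))) * exp (- y) + exp (- y) * (- (- (y * y))) * y ^ j
        = y ^ (j + 2) * exp (- y) - real j * (y ^ (j + 1) * exp (- y))"
      by (cases j) (simp_all add: algebra_simps)
    ultimately show ?thesis using greater by (simp add: flat_def y_def)
  qed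
  then show ?thesis
    by (rule has_field_derivative_transform_within_open[where S = "{0<..}"])
      (use greater in \<open>auto simp: flat_def\<close>)
next
  case equal
  then show ?thesis using flat_lim[of j] by (simp add: DERIV_def flat_def)
qed

lemma flat_0_bounds: "0 \<le> flat 0 x" "flat 0 x \<le> 1" "flat 0 x \<noteq> 0 \<longleftrightarrow> 0 < x"
  by (auto simp: flat_def)

text \<open>A class closed under partial derivatives and large enough for all bumps and mollifiers;
  membership gives \<open>Ck k\<close> for every k by a single induction.\<close>

inductive elem_smooth :: "(real^2 \<Rightarrow> real) \<Rightarrow> bool" where
  const: "elem_smooth (\<lambda>x. c)"
| flat: "elem_smooth (\<lambda>x. flat j (a + b * x $ i))"
| add: "elem_smooth f \<Longrightarrow> elem_smooth g \<Longrightarrow> elem_smooth (\<lambda>x. f x + g x)"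
| mult: "elem_smooth f \<Longrightarrow> elem_smooth g \<Longrightarrow> elem_smooth (\<lambda>x. f x * g x)"

lemma elem_smooth_deriv:
  "elem_smooth f \<Longrightarrow> \<exists>D :: 2 \<Rightarrow> real^2 \<Rightarrow> real. (\<forall>i. elem_smooth (D i)) \<and>
     (\<forall>x. (f has_derivative (\<lambda>h. D 1 x * h $ 1 + D 2 x * h $ 2)) (at x))"
proof (induction rule: elem_smooth.induct)
  case (const c)
  show ?case by (rule exI[of _ "\<lambda>i x. 0"]) (auto intro: elem_smooth.const)
next
  case (flat j a b i)
  let ?d = "\<lambda>x. b * (flat (j + 2) (a + b * x $ i) + (- real j) * flat (j + 1) (a + b * x $ i))"
  have "((\<lambda>x. flat j (a + b * x $ i)) has_derivative (\<lambda>h. ?d x * h $ i)) (at x)" for x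
  proof -
    have 1: "((\<lambda>x :: real^2. a + b * x $ i) has_derivative (\<lambda>h. b * h $ i)) (at x)"
      by (auto intro!: derivative_eq_intros bounded_linear.has_derivative[OF bounded_linear_vec_nth])
    from has_derivative_compose[OF 1 flat_deriv[of j "a + b * x $ i", unfolded has_field_derivative_def]]
    show ?thesis by (simp add: algebra_simps)
  qed
  moreover have "elem_smooth ?d" by (intro elem_smooth.intros)
  ultimately obtain d where "elem_smooth d" "\<And>x. ((\<lambda>x. flat j (a + b * x $ i)) has_derivative (\<lambda>h. d x * h $ i)) (at x)"
    by blast
  moreover have "i = 1 \<or> i = 2" using exhaust_2 by blast
  ultimately show ?case
    by (intro exI[of _ "\<lambda>k. if k = i then d else (\<lambda>x. 0)"]) (auto intro: elem_smooth.const)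
next
  case (add f g)
  then obtain D E :: "2 \<Rightarrow> real^2 \<Rightarrow> real" where "\<forall>i. elem_smooth (D i)" "\<forall>i. elem_smooth (E i)"
    "\<And>x. (f has_derivative (\<lambda>h. D 1 x * h $ 1 + D 2 x * h $ 2)) (at x)"
    "\<And>x. (g has_derivative (\<lambda>h. E 1 x * h $ 1 + E 2 x * h $ 2)) (at x)" by blast
  then show ?case
    by (intro exI[of _ "\<lambda>i x. D i x + E i x"])
      (auto intro!: elem_smooth.add derivative_eq_intros simp: algebra_simps)
next
  case (mult f g)
  then obtain D E :: "2 \<Rightarrow> real^2 \<Rightarrow> real" where "\<forall>i. elem_smooth (D i)" "\<forall>i. elem_smooth (E i)"
    "\<And>x. (f has_derivative (\<lambda>h. D 1 x * h $ 1 + D 2 x * h $ 2)) (at x)"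
    "\<And>x. (g has_derivative (\<lambda>h. E 1 x * h $ 1 + E 2 x * h $ 2)) (at x)" by blast
  with mult.hyps show ?case
    by (intro exI[of _ "\<lambda>i x. D i x * g x + f x * E i x"])
      (auto intro!: elem_smooth.add elem_smooth.mult derivative_eq_intros simp: algebra_simps)
qed

lemma elem_smooth_partial:
  assumes "elem_smooth f"
  shows "f differentiable (at x)" "elem_smooth (\<lambda>x. frechet_derivative f (at x) (axis i 1))"
proof -
  obtain D :: "2 \<Rightarrow> real^2 \<Rightarrow> real" where D: "\<And>i. elem_smooth (D i)"
    "\<And>x. (f has_derivative (\<lambda>h. D 1 x * h $ 1 + D 2 x * h $ 2)) (at x)"
    using elem_smooth_deriv[OF assms] by blast
  show "f differentiable (at x)" using D(2) unfolding differentiable_def by blast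
  have "frechet_derivative f (at x) = (\<lambda>h. D 1 x * h $ 1 + D 2 x * h $ 2)" for x
    by (rule frechet_derivative_at[symmetric]) (rule D(2))
  moreover have "i = 1 \<or> i = 2" using exhaust_2 by blast
  ultimately have "(\<lambda>x. frechet_derivative f (at x) (axis i 1)) = D i" by auto
  then show "elem_smooth (\<lambda>x. frechet_derivative f (at x) (axis i 1))" using D(1) by simp
qed

lemma elem_smooth_continuous: "elem_smooth f \<Longrightarrow> continuous_on S f"
  by (intro continuous_at_imp_continuous_on ballI differentiable_imp_continuous_within elem_smooth_partial(1))

lemma elem_smooth_smooth: "elem_smooth f \<Longrightarrow> smooth f"
proof -
  have "elem_smooth f \<Longrightarrow> Ck k f" for k
    by (induction k arbitrary: f) (auto intro: elem_smooth_partial elem_smooth_continuous)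
  then show "elem_smooth f \<Longrightarrow> smooth f" by (simp add: smooth_def)
qed

text \<open>A product of four one-sided profiles. Increasing n sharpens it towards the indicator of
  the open box; n = 1 serves for the mollifiers.\<close>

definition bump :: "real \<Rightarrow> real^2 \<Rightarrow> real^2 \<Rightarrow> real^2 \<Rightarrow> real" where
  "bump n a b x = flat 0 (n * (x $ 1 - a $ 1)) * flat 0 (n * (b $ 1 - x $ 1))
    * (flat 0 (n * (x $ 2 - a $ 2)) * flat 0 (n * (b $ 2 - x $ 2)))"

lemma elem_smooth_bump: "elem_smooth (bump n a b)"
proof -
  have "bump n a b = (\<lambda>x. flat 0 (- (n * a $ 1) + n * x $ 1) * flat 0 (n * b $ 1 + (- n) * x $ 1)
    * (flat 0 (- (n * a $ 2) + n * x $ 2) * flat 0 (n * b $ 2 + (- n) * x $ 2)))"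
    by (simp add: bump_def fun_eq_iff algebra_simps)
  then show ?thesis by (simp only:) (intro elem_smooth.intros)
qed

lemma bump_bounds: "0 \<le> bump n a b x" "bump n a b x \<le> 1"
  using flat_0_bounds by (auto simp: bump_def intro!: mult_le_one)

lemma bump_nonzero: "0 < n \<Longrightarrow> bump n a b x \<noteq> 0 \<longleftrightarrow> x \<in> box a b"
  using flat_0_bounds(3) by (auto simp: bump_def mem_box_2 zero_less_mult_iff)

lemma test_function_elem_smooth:
  assumes "elem_smooth \<phi>" "\<And>x. x \<notin> cbox a b \<Longrightarrow> \<phi> x = 0" "cbox a b \<subseteq> \<Omega>"
  shows "test_function \<Omega> \<phi>"
proof -
  have "{x. \<phi> x \<noteq> 0} \<subseteq> cbox a b" using assms(2) by blast
  then have sub: "closure {x. \<phi> x \<noteq> 0} \<subseteq> cbox a b" by (intro closure_minimal) auto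
  then have "compact (closure {x. \<phi> x \<noteq> 0})"
    using compact_closure bounded_subset bounded_cbox \<open>{x. \<phi> x \<noteq> 0} \<subseteq> cbox a b\<close> by blast
  then show ?thesis using sub assms elem_smooth_smooth by (auto simp: test_function_def)
qed

lemma test_function_bump: "0 < n \<Longrightarrow> cbox a b \<subseteq> \<Omega> \<Longrightarrow> test_function \<Omega> (bump n a b)"
  using bump_nonzero[of n a b] box_subset_cbox[of a b]
  by (intro test_function_elem_smooth elem_smooth_bump) blast+

lemma flat_0_limit: "0 < x \<Longrightarrow> (\<lambda>m. flat 0 (real (Suc m) * x)) \<longlonglongrightarrow> 1"
proof -
  assume x: "0 < x"
  have "(\<lambda>m. exp (- (inverse x * inverse (real (Suc m))))) \<longlonglongrightarrow> exp (- (inverse x * 0))"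
    by (intro tendsto_intros LIMSEQ_inverse_real_of_nat)
  moreover have "flat 0 (real (Suc m) * x) = exp (- (inverse x * inverse (real (Suc m))))" for m
  proof -
    have "0 < real (Suc m) * x" using x by simp
    then show ?thesis by (simp add: flat_def divide_inverse mult.commute)
  qed
  ultimately show ?thesis by simp
qed

lemma bump_limit: "(\<lambda>m. bump (real (Suc m)) a b x) \<longlonglongrightarrow> indicator (box a b) x"
proof (cases "x \<in> box a b")
  case True
  then have "(\<lambda>m. bump (real (Suc m)) a b x) \<longlonglongrightarrow> 1 * 1 * (1 * 1)"
    unfolding bump_def by (intro tendsto_mult flat_0_limit) (auto simp: mem_box_2)
  then show ?thesis using True by simp
next
  case False
  then show ?thesis using bump_nonzero[of "real (Suc _)" a b x] by simp
qed

section \<open>The fundamental lemma of the calculus of variations\<close>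

lemma absolutely_integrable_mult_bounded:
  fixes f b :: "real^2 \<Rightarrow> real"
  assumes "f absolutely_integrable_on S" "S \<in> sets lebesgue" "continuous_on S b" "\<And>x. x \<in> S \<Longrightarrow> \<bar>b x\<bar> \<le> B"
  shows "(\<lambda>x. f x * b x) absolutely_integrable_on S"
proof -
  have "(\<lambda>x. b x * f x) absolutely_integrable_on S"
  proof (rule absolutely_integrable_bounded_measurable_product[OF bilinear_times])
    show "bounded (b ` S)" using assms(4) by (auto simp: bounded_iff)
    show "b \<in> borel_measurable (lebesgue_on S)"
      by (rule continuous_imp_measurable_on_sets_lebesgue[OF assms(3,2)])
  qed (use assms in auto)
  then show ?thesis by (simp add: mult.commute)
qed

text \<open>Bumps converge boundedly to indicators of boxes, so g has zero integral over every
  closed box inside \<Omega>; Lebesgue differentiation along shrinking cubes then gives g = 0 almost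
  everywhere.\<close>

lemma fundamental_lemma:
  fixes g :: "real^2 \<Rightarrow> real"
  assumes \<Omega>: "open \<Omega>" and g: "g absolutely_integrable_on \<Omega>"
    and orth: "\<And>n a b. 0 < n \<Longrightarrow> cbox a b \<subseteq> \<Omega> \<Longrightarrow> integral \<Omega> (\<lambda>x. g x * bump n a b x) = 0"
  shows "negligible {x \<in> \<Omega>. g x \<noteq> 0}"
proof -
  have meas: "\<Omega> \<in> sets lebesgue" using \<Omega> by simp
  have box0: "integral (cbox a b) g = 0" if ab: "cbox a b \<subseteq> \<Omega>" for a b
  proof -
    have int: "(\<lambda>x. g x * bump n a b x) absolutely_integrable_on \<Omega>" for n
      using bump_bounds by (intro absolutely_integrable_mult_bounded[where B = 1] g meas
          elem_smooth_continuous elem_smooth_bump) auto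
    have "(\<lambda>m. integral \<Omega> (\<lambda>x. g x * bump (real (Suc m)) a b x)) \<longlonglongrightarrow>
        integral \<Omega> (\<lambda>x. g x * indicator (box a b) x)"
    proof (rule dominated_convergence(2)[where h = "\<lambda>x. norm (g x)"])
      show "(\<lambda>x. norm (g x)) integrable_on \<Omega>" using g by (simp add: absolutely_integrable_on_def)
      show "norm (g x * bump (real (Suc m)) a b x) \<le> norm (g x)" for m x
        using mult_left_mono[OF bump_bounds(2), of "\<bar>g x\<bar>" "real (Suc m)" a b x] bump_bounds(1)
        by (simp add: abs_mult)
      show "(\<lambda>m. g x * bump (real (Suc m)) a b x) \<longlonglongrightarrow> g x * indicator (box a b) x" for x
        by (intro tendsto_mult tendsto_const bump_limit)
    qed (use int in \<open>auto simp: absolutely_integrable_on_def\<close>)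
    then have "integral \<Omega> (\<lambda>x. g x * indicator (box a b) x) = 0"
      using orth[OF _ ab, of "real (Suc _)"] LIMSEQ_unique[OF _ tendsto_const] by simp
    moreover have "integral \<Omega> (\<lambda>x. g x * indicator (box a b) x) = integral (box a b) g"
      using ab box_subset_cbox[of a b]
      by (subst (1 2) integral_restrict_UNIV[symmetric], intro arg_cong[where f = "integral _"])
        (auto simp: indicator_def fun_eq_iff)
    ultimately show ?thesis by (simp add: integral_open_interval)
  qed
  \<comment> \<open>Extended by zero, g is integrable on every box, as the differentiation theorem
    asks; x is a corner of the cubes, not their centre.\<close>
  let ?f = "\<lambda>x. if x \<in> \<Omega> then g x else 0"
  have "?f absolutely_integrable_on UNIV" using g by (simp add: absolutely_integrable_restrict_UNIV)
  then have "?f absolutely_integrable_on cbox a b" for a b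
    by (rule absolutely_integrable_on_subcbox) auto
  then have "?f integrable_on cbox a b" for a b by (simp add: absolutely_integrable_on_def)
  then obtain N where N: "negligible N"
    "\<And>x e. \<lbrakk>x \<notin> N; 0 < e\<rbrakk> \<Longrightarrow> \<exists>d>0. \<forall>h. 0 < h \<and> h < d \<longrightarrow>
       norm (integral (cbox x (x + h *\<^sub>R One)) ?f /\<^sub>R h ^ DIM(real^2) - ?f x) < e"
    by (rule integrable_ccontinuous_explicit) blast
  have "g x = 0" if x: "x \<in> \<Omega>" "x \<notin> N" for x
  proof (rule ccontr)
    assume "g x \<noteq> 0"
    then obtain d where d: "0 < d" "\<And>h. 0 < h \<Longrightarrow> h < d \<Longrightarrow>
        norm (integral (cbox x (x + h *\<^sub>R One)) ?f /\<^sub>R h ^ DIM(real^2) - ?f x) < norm (g x)"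
      using N(2)[OF x(2), of "norm (g x)"] by auto
    obtain e where e: "0 < e" "cball x e \<subseteq> \<Omega>" using \<Omega> x open_contains_cball by blast
    \<comment> \<open>Points of the cube are within h times \<open>norm One\<close> of x, so the
      second bound keeps the cube inside the ball.\<close>
    define h where "h = min (d / 2) (e / (norm (One :: real^2) + 1))"
    have h: "0 < h" "h < d" using d e by (auto simp: h_def intro!: divide_pos_pos add_nonneg_pos)
    have "cbox x (x + h *\<^sub>R One) \<subseteq> cball x e"
    proof
      fix y assume y: "y \<in> cbox x (x + h *\<^sub>R One)"
      have "norm (y - x) \<le> norm (h *\<^sub>R (One :: real^2))"
        using y by (intro norm_le_componentwise) (auto simp: mem_box inner_diff_left inner_add_left abs_if)
      also have "\<dots> \<le> e / (norm (One :: real^2) + 1) * norm (One :: real^2)"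
        unfolding norm_scaleR using h by (intro mult_right_mono) (auto simp: h_def)
      also have "\<dots> \<le> e" using e by (simp add: field_simps add_nonneg_pos)
      finally show "y \<in> cball x e" by (simp add: dist_norm norm_minus_commute)
    qed
    then have sub: "cbox x (x + h *\<^sub>R One) \<subseteq> \<Omega>" using e by blast
    have "integral (cbox x (x + h *\<^sub>R One)) ?f = integral (cbox x (x + h *\<^sub>R One)) g"
      using sub by (intro integral_cong) auto
    then show False using d(2)[OF h] box0[OF sub] x by simp
  qed
  then have "{x \<in> \<Omega>. g x \<noteq> 0} \<subseteq> N" by blast
  then show ?thesis using N(1) negligible_subset by blast
qed

section \<open>Mollification\<close>

text \<open>With y = 1 / x, exp y >= (1 + y / j)^j >= (y / j)^j, hence y^j exp (- y) <= j^j.\<close>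

lemma flat_bounded: "\<bar>flat j x\<bar> \<le> max 1 (real j ^ j)"
proof (cases "x \<le> 0 \<or> j = 0")
  case True
  then show ?thesis by (auto simp: flat_def)
next
  case False
  define y where "y = 1 / x"
  have y: "0 < y" "0 < j" using False by (auto simp: y_def)
  have "(y / real j) ^ j \<le> (1 + y / real j) ^ j" using y by (intro power_mono) auto
  also have "\<dots> \<le> exp y" using y by (intro exp_ge_one_plus_x_over_n_power_n) auto
  finally have "y ^ j \<le> real j ^ j * exp y" using y by (simp add: power_divide field_simps)
  then have "y ^ j * exp (- y) \<le> real j ^ j" by (simp add: exp_minus field_simps)
  then show ?thesis using False y by (simp add: flat_def flip: y_def)
qed

lemma elem_smooth_compose: "elem_smooth f \<Longrightarrow> continuous_on S g \<Longrightarrow> continuous_on S (\<lambda>x. f (g x))"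
  using continuous_on_compose2[OF elem_smooth_continuous[of f UNIV]] by blast

text \<open>Boundedness makes products with integrable functions integrable and supplies the
  dominating function for Fubini's theorem.\<close>

lemma elem_smooth_bounded: "elem_smooth f \<Longrightarrow> \<exists>B. \<forall>x. \<bar>f x\<bar> \<le> B"
proof (induction rule: elem_smooth.induct)
  case (flat j a b i)
  then show ?case using flat_bounded by blast
next
  case (add f g)
  then obtain A B where *: "\<And>x. \<bar>f x\<bar> \<le> A" "\<And>x. \<bar>g x\<bar> \<le> B" by blast
  have "\<bar>f x + g x\<bar> \<le> A + B" for x using *[of x] by linarith
  then show ?case by blast
next
  case (mult f g)
  then obtain A B where *: "\<And>x. \<bar>f x\<bar> \<le> A" "\<And>x. \<bar>g x\<bar> \<le> B" by blast
  have "\<bar>f x * g x\<bar> \<le> A * B" for x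
    unfolding abs_mult using *[of x] by (intro mult_mono) auto
  then show ?case by blast
qed auto

definition corner :: "real \<Rightarrow> real^2" where
  "corner e = pt e e"

definition mollifier :: "real \<Rightarrow> real^2 \<Rightarrow> real" where
  "mollifier e z = bump 1 (- corner e) (corner e) z / integral (cbox (- corner e) (corner e)) (bump 1 (- corner e) (corner e))"

lemma mollifier_mass_pos:
  assumes "0 < e"
  shows "0 < integral (cbox (- corner e) (corner e)) (bump 1 (- corner e) (corner e))" (is "0 < ?N")
proof -
  let ?C = "cbox (- corner e) (corner e)" and ?b = "bump 1 (- corner e) (corner e)"
  have int: "?b integrable_on ?C"
    by (intro integrable_continuous elem_smooth_continuous elem_smooth_bump)
  have "0 \<le> ?N" using bump_bounds by (intro integral_nonneg int) auto
  moreover have "?N \<noteq> 0"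
  proof
    assume "?N = 0"
    then have "(?b has_integral 0) ?C" using int by (simp add: has_integral_iff)
    moreover have 0: "0 \<in> box (- corner e) (corner e)" using assms by (simp add: mem_box_2 corner_def)
    ultimately have "?b 0 = 0"
      using bump_bounds subsetD[OF box_subset_cbox 0]
      by (intro has_integral_0_cbox_imp_0[of "- corner e" "corner e" ?b])
        (auto intro!: elem_smooth_continuous elem_smooth_bump)
    then show False using bump_nonzero[of 1 "- corner e" "corner e" 0] 0 by simp
  qed
  ultimately show ?thesis by simp
qed

lemma elem_smooth_mollifier: "elem_smooth (mollifier e)"
  using elem_smooth.mult[OF elem_smooth_bump elem_smooth.const, of 1 "- corner e" "corner e"
      "1 / integral (cbox (- corner e) (corner e)) (bump 1 (- corner e) (corner e))"]
  by (simp add: mollifier_def[abs_def])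

text \<open>Reflection exchanges the two one-sided profiles in each variable, so the reflected and
  translated mollifier is again a bump, now around x; this makes it usable as a test function in
  y.\<close>

lemma mollifier_reflect: "mollifier e (x - y) = bump 1 (x - corner e) (x + corner e) y
    / integral (cbox (- corner e) (corner e)) (bump 1 (- corner e) (corner e))"
  by (simp add: mollifier_def bump_def corner_def algebra_simps)

lemma elem_smooth_mollifier_reflect: "elem_smooth (\<lambda>y. mollifier e (x - y))"
  using elem_smooth.mult[OF elem_smooth_bump elem_smooth.const, of 1 "x - corner e" "x + corner e"
      "1 / integral (cbox (- corner e) (corner e)) (bump 1 (- corner e) (corner e))"]
  by (simp add: mollifier_reflect)

lemma mollifier_nonneg: "0 < e \<Longrightarrow> 0 \<le> mollifier e z"
  using mollifier_mass_pos[of e] bump_bounds by (auto simp: mollifier_def intro!: divide_nonneg_pos)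

lemma mollifier_eq_0: "z \<notin> cbox (- corner e) (corner e) \<Longrightarrow> mollifier e z = 0"
  using bump_nonzero[of 1 "- corner e" "corner e" z] box_subset_cbox by (auto simp: mollifier_def)

lemma integral_mollifier:
  assumes "0 < e"
  shows "((\<lambda>x. mollifier e (x - y)) has_integral 1) (cbox (y - corner e) (y + corner e))"
proof -
  have "(mollifier e has_integral integral (cbox (- corner e) (corner e)) (mollifier e)) (cbox (- corner e) (corner e))"
    by (intro integrable_integral integrable_continuous elem_smooth_continuous elem_smooth_mollifier)
  moreover have "integral (cbox (- corner e) (corner e)) (mollifier e) = 1"
    using mollifier_mass_pos[OF assms] by (simp add: mollifier_def[abs_def])
  ultimately have "(mollifier e has_integral 1) (cbox (- corner e) (corner e))" by simp
  from has_integral_affinity'[OF this, of 1 "- y"]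
  show ?thesis by (simp add: algebra_simps)
qed

text \<open>The l1 norm is a sufficient majorant; this is the origin of the radius 2 e in the
  conditions on supports.\<close>

lemma norm_le_corner:
  assumes "x \<in> cbox (y - corner e) (y + corner e)"
  shows "norm (x - y) \<le> 2 * e"
proof -
  have "norm (x - y) \<le> (\<Sum>i\<in>UNIV. \<bar>(x - y) $ i\<bar>)" by (rule norm_le_l1_cart)
  also have "\<dots> \<le> 2 * e" using assms by (auto simp: UNIV_2 mem_cbox_2 corner_def)
  finally show ?thesis .
qed

lemma test_function_mollifier:
  assumes "0 < e" "cball x (2 * e) \<subseteq> \<Omega>"
  shows "test_function \<Omega> (\<lambda>y. mollifier e (x - y))"
proof (rule test_function_elem_smooth[OF elem_smooth_mollifier_reflect])
  show "mollifier e (x - y) = 0" if "y \<notin> cbox (x - corner e) (x + corner e)" for y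
    using that by (intro mollifier_eq_0) (auto simp: mem_cbox_2 corner_def)
  show "cbox (x - corner e) (x + corner e) \<subseteq> \<Omega>"
    using norm_le_corner assms(2) by (fastforce simp: dist_norm norm_minus_commute)
qed

definition dmollifier :: "real \<Rightarrow> 2 \<Rightarrow> real^2 \<Rightarrow> real" where
  "dmollifier e i z = frechet_derivative (mollifier e) (at z) (axis i 1)"

lemma elem_smooth_dmollifier: "elem_smooth (dmollifier e i)"
  unfolding dmollifier_def[abs_def] by (rule elem_smooth_partial[OF elem_smooth_mollifier])

lemma mollifier_deriv:
  "(mollifier e has_derivative (\<lambda>h. h $ 1 * dmollifier e 1 z + h $ 2 * dmollifier e 2 z)) (at z)"
proof -
  have "mollifier e differentiable at z"
    by (rule elem_smooth_partial[OF elem_smooth_mollifier])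
  then have D: "(mollifier e has_derivative frechet_derivative (mollifier e) (at z)) (at z)"
    by (simp add: frechet_derivative_works)
  then interpret bounded_linear "frechet_derivative (mollifier e) (at z)"
    by (rule has_derivative_bounded_linear)
  have "frechet_derivative (mollifier e) (at z) h = h $ 1 * dmollifier e 1 z + h $ 2 * dmollifier e 2 z" for h
  proof -
    have "h = h $ 1 *\<^sub>R axis 1 1 + h $ 2 *\<^sub>R axis 2 1" by (simp add: vec_eq_iff forall_2)
    then have "frechet_derivative (mollifier e) (at z) h
      = frechet_derivative (mollifier e) (at z) (h $ 1 *\<^sub>R axis 1 1 + h $ 2 *\<^sub>R axis 2 1)" by simp
    then show ?thesis by (simp add: add scaleR dmollifier_def)
  qed
  then have "frechet_derivative (mollifier e) (at z) = (\<lambda>h. h $ 1 * dmollifier e 1 z + h $ 2 * dmollifier e 2 z)"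
    by blast
  then show ?thesis using D by simp
qed

text \<open>The inner derivative -1 produces a minus sign that cancels the one in the definition of
  the weak gradient.\<close>

lemma mollifier_reflect_deriv:
  "frechet_derivative (\<lambda>y. mollifier e (x - y)) (at y) (axis i 1) = - dmollifier e i (x - y)"
proof -
  have "((\<lambda>y. x - y) has_derivative (\<lambda>h. - h)) (at y)" by (auto intro!: derivative_eq_intros)
  from has_derivative_compose[OF this mollifier_deriv]
  have "((\<lambda>y. mollifier e (x - y)) has_derivative
      (\<lambda>h. (- h) $ 1 * dmollifier e 1 (x - y) + (- h) $ 2 * dmollifier e 2 (x - y))) (at y)" .
  from frechet_derivative_at[OF this]
  have "frechet_derivative (\<lambda>y. mollifier e (x - y)) (at y)
      = (\<lambda>h. (- h) $ 1 * dmollifier e 1 (x - y) + (- h) $ 2 * dmollifier e 2 (x - y))" ..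
  moreover have "i = 1 \<or> i = 2" using exhaust_2 by blast
  ultimately show ?thesis by auto
qed

text \<open>The mollifier is nonnegative, has unit mass and support of size e, so the error is an
  average of differences of a at nearby points; uniform continuity makes the bound independent of
  y.\<close>

lemma mollifier_uniform:
  fixes a :: "real^2 \<Rightarrow> real"
  assumes a: "continuous_on UNIV a" and S: "bounded S" "\<And>x. x \<notin> S \<Longrightarrow> a x = 0" and r: "0 < r"
  shows "\<exists>d>0. \<forall>e y. 0 < e \<and> e < d \<longrightarrow> \<bar>integral UNIV (\<lambda>x. a x * mollifier e (x - y)) - a y\<bar> \<le> r"
proof -
  obtain R where R: "S \<subseteq> cball 0 R" using S(1) unfolding bounded_iff by force
  \<comment> \<open>The ball is enlarged by 1 so that it contains both points as soon as one of them
    lies in S and their distance is below 1.\<close>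
  have "uniformly_continuous_on (cball 0 (R + 1)) a"
    using a by (intro compact_uniformly_continuous) (auto intro: continuous_on_subset)
  then obtain d where d: "0 < d" "\<And>x y. x \<in> cball 0 (R + 1) \<Longrightarrow> y \<in> cball 0 (R + 1) \<Longrightarrow> dist y x < d \<Longrightarrow> dist (a y) (a x) < r"
    using r unfolding uniformly_continuous_on_def by metis
  have uc: "\<bar>a x - a y\<bar> \<le> r" if "norm (x - y) < min d 1" for x y
  proof (cases "x \<in> S \<or> y \<in> S")
    case True
    then have "x \<in> cball 0 R \<or> y \<in> cball 0 R" using R by blast
    moreover have "norm x \<le> norm y + norm (x - y)" "norm y \<le> norm x + norm (x - y)"
      using norm_triangle_sub[of x y] norm_triangle_sub[of y x] by (auto simp: norm_minus_commute)
    ultimately have "x \<in> cball 0 (R + 1)" "y \<in> cball 0 (R + 1)" using that by auto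
    then have "dist (a x) (a y) < r" using that by (intro d(2)) (auto simp: dist_norm)
    then show ?thesis by (simp add: dist_real_def)
  next
    case False
    then show ?thesis using S(2) r by simp
  qed
  have "\<bar>integral UNIV (\<lambda>x. a x * mollifier e (x - y)) - a y\<bar> \<le> r" if e: "0 < e" "e < min d 1 / 2" for e y
  proof -
    let ?C = "cbox (y - corner e) (y + corner e)"
    have c: "continuous_on ?C (\<lambda>x. mollifier e (x - y))"
      by (intro elem_smooth_compose elem_smooth_mollifier continuous_intros)
    note ci = c continuous_on_subset[OF a] continuous_intros
    have "integral UNIV (\<lambda>x. a x * mollifier e (x - y)) = integral ?C (\<lambda>x. a x * mollifier e (x - y))"
    proof (subst integral_restrict_UNIV[symmetric], intro arg_cong[where f = "integral _"] ext)
      fix x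
      have "x \<notin> ?C \<Longrightarrow> mollifier e (x - y) = 0"
        by (intro mollifier_eq_0) (auto simp: mem_cbox_2 corner_def)
      then show "a x * mollifier e (x - y) = (if x \<in> ?C then a x * mollifier e (x - y) else 0)" by auto
    qed
    moreover have "a y = integral ?C (\<lambda>x. a y * mollifier e (x - y))"
      using integral_mollifier[OF e(1), of y] by (simp add: integral_unique)
    ultimately have "integral UNIV (\<lambda>x. a x * mollifier e (x - y)) - a y
        = integral ?C (\<lambda>x. a x * mollifier e (x - y)) - integral ?C (\<lambda>x. a y * mollifier e (x - y))"
      by simp
    also have "\<dots> = integral ?C (\<lambda>x. (a x - a y) * mollifier e (x - y))"
      by (subst integral_diff[symmetric]) (auto intro!: integrable_continuous ci simp: algebra_simps)
    also have "norm \<dots> \<le> integral ?C (\<lambda>x. r * mollifier e (x - y))"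
    proof (intro integral_norm_bound_integral integrable_continuous ci)
      fix x assume "x \<in> ?C"
      then have "\<bar>a x - a y\<bar> \<le> r" using norm_le_corner[of x y e] e by (intro uc) auto
      then show "norm ((a x - a y) * mollifier e (x - y)) \<le> r * mollifier e (x - y)"
        using mollifier_nonneg[OF e(1)] by (auto simp: abs_mult intro!: mult_right_mono)
    qed auto
    also have "\<dots> = r" using integral_mollifier[OF e(1), of y] by (simp add: integral_unique)
    finally show ?thesis by simp
  qed
  then show ?thesis using d(1) by (intro exI[of _ "min d 1 / 2"]) auto
qed

text \<open>Fubini's theorem is used for \<open>lborel\<close>, whereas f is only Lebesgue
  measurable on \<Omega>. Its zero extension is replaced by a Borel function equal to it almost
  everywhere, which is compatible with every Borel factor h.\<close>

lemma lborel_representative: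
  fixes f :: "real^2 \<Rightarrow> real"
  assumes "f absolutely_integrable_on \<Omega>"
  obtains f' where "f' \<in> borel_measurable borel" "integrable lborel f'"
    "\<And>h. h \<in> borel_measurable borel \<Longrightarrow>
      (\<lambda>x. f x * h x) absolutely_integrable_on \<Omega> \<longleftrightarrow> integrable lborel (\<lambda>x. f' x * h x)"
    "\<And>h. h \<in> borel_measurable borel \<Longrightarrow> integrable lborel (\<lambda>x. f' x * h x) \<Longrightarrow>
      (\<integral>x. f' x * h x \<partial>lborel) = integral \<Omega> (\<lambda>x. f x * h x)"
proof -
  let ?g = "\<lambda>x. indicator \<Omega> x * f x"
  have g: "integrable lebesgue ?g" using assms by (simp add: set_integrable_def)
  then have "?g \<in> borel_measurable lebesgue" by simp
  then obtain f' where f': "f' \<in> borel_measurable lborel" "AE x in lborel. ?g x = f' x"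
    using completion_ex_borel_measurable_real by blast
  then have ae: "AE x in lebesgue. ?g x = f' x" by (intro AE_completion)
  have m: "(\<lambda>x. f' x * h x) \<in> borel_measurable lborel" if "h \<in> borel_measurable borel" for h :: "real^2 \<Rightarrow> real"
    using f'(1) that by simp
  have iff: "(\<lambda>x. f x * h x) absolutely_integrable_on \<Omega> \<longleftrightarrow> integrable lborel (\<lambda>x. f' x * h x)"
    and eq: "integral\<^sup>L lebesgue (\<lambda>x. ?g x * h x) = (\<integral>x. f' x * h x \<partial>lborel)"
    if h: "h \<in> borel_measurable borel" for h :: "real^2 \<Rightarrow> real"
  proof -
    have hl: "h \<in> borel_measurable lebesgue" using h by (intro measurable_completion) simp
    have gl: "?g \<in> borel_measurable lebesgue" by fact
    have fl: "f' \<in> borel_measurable lebesgue" using f'(1) by (intro measurable_completion)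
    have "integrable lebesgue (\<lambda>x. ?g x * h x) \<longleftrightarrow> integrable lebesgue (\<lambda>x. f' x * h x)"
      using ae hl gl fl by (intro integrable_cong_AE) auto
    also have "\<dots> \<longleftrightarrow> integrable lborel (\<lambda>x. f' x * h x)"
      by (intro integrable_completion m h)
    finally show "(\<lambda>x. f x * h x) absolutely_integrable_on \<Omega> \<longleftrightarrow> integrable lborel (\<lambda>x. f' x * h x)"
      by (simp add: set_integrable_def mult.assoc)
    have "integral\<^sup>L lebesgue (\<lambda>x. ?g x * h x) = integral\<^sup>L lebesgue (\<lambda>x. f' x * h x)"
      using ae hl gl fl by (intro integral_cong_AE) auto
    also have "\<dots> = (\<integral>x. f' x * h x \<partial>lborel)" by (intro integral_completion m h)
    finally show "integral\<^sup>L lebesgue (\<lambda>x. ?g x * h x) = (\<integral>x. f' x * h x \<partial>lborel)" .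
  qed
  show thesis
  proof (rule that[of f'])
    show "f' \<in> borel_measurable borel" using f'(1) by simp
    show "integrable lborel f'" using iff[of "\<lambda>x. 1"] assms by simp
    show "(\<integral>x. f' x * h x \<partial>lborel) = integral \<Omega> (\<lambda>x. f x * h x)"
      if "h \<in> borel_measurable borel" "integrable lborel (\<lambda>x. f' x * h x)" for h :: "real^2 \<Rightarrow> real"
      using eq[OF that(1)] set_lebesgue_integral_eq_integral(2)[of \<Omega> "\<lambda>x. f x * h x"] iff[OF that(1)] that(2)
      by (simp add: set_lebesgue_integral_def mult.assoc)
  qed (use iff in auto)
qed

text \<open>k and b are bounded, so the double integral of f(y) b(s) k(\<Phi>(s) - y) is dominated
  by a constant times |f(y)| over the square, which is integrable in (s, y).\<close>

lemma kernel_fubini: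
  fixes f b :: "real^2 \<Rightarrow> real" and k :: "real^2 \<Rightarrow> real" and \<Phi> :: "real^2 \<Rightarrow> real^2"
  assumes f: "f absolutely_integrable_on \<Omega>" and b: "continuous_on (cbox 0 1) b"
    and \<Phi>: "continuous_on (cbox 0 1) \<Phi>" and k: "elem_smooth k"
  shows "integral \<Omega> (\<lambda>y. f y * integral (cbox 0 1) (\<lambda>s. b s * k (\<Phi> s - y)))
      = integral (cbox 0 1) (\<lambda>s. b s * integral \<Omega> (\<lambda>y. f y * k (\<Phi> s - y)))"
    and "(\<lambda>y. f y * integral (cbox 0 1) (\<lambda>s. b s * k (\<Phi> s - y))) absolutely_integrable_on \<Omega>"
    and "(\<lambda>s. b s * integral \<Omega> (\<lambda>y. f y * k (\<Phi> s - y))) integrable_on cbox 0 1"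
proof -
  let ?Q = "cbox 0 1 :: (real^2) set"
  obtain f' where f': "f' \<in> borel_measurable borel" "integrable lborel f'"
    and iff: "\<And>h. h \<in> borel_measurable borel \<Longrightarrow>
      (\<lambda>x. f x * h x) absolutely_integrable_on \<Omega> \<longleftrightarrow> integrable lborel (\<lambda>x. f' x * h x)"
    and eq: "\<And>h. h \<in> borel_measurable borel \<Longrightarrow> integrable lborel (\<lambda>x. f' x * h x) \<Longrightarrow>
      (\<integral>x. f' x * h x \<partial>lborel) = integral \<Omega> (\<lambda>x. f x * h x)"
    by (rule lborel_representative[OF f]) (rule that; assumption)
  note [measurable] = f'(1)
  obtain M where M: "\<And>z. \<bar>k z\<bar> \<le> M" using elem_smooth_bounded[OF k] by blast
  have "compact (b ` ?Q)" using b by (intro compact_continuous_image) auto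
  then obtain B where B: "\<And>s. s \<in> ?Q \<Longrightarrow> \<bar>b s\<bar> \<le> B"
    using compact_imp_bounded bounded_iff by (metis image_eqI real_norm_def)
  have [measurable]: "k \<in> borel_measurable borel"
    using elem_smooth_continuous[OF k] by (rule borel_measurable_continuous_onI)
  \<comment> \<open>Truncation makes b and \<Phi> Borel on the whole plane; outside the square
    \<open>b'\<close> is 0 and the value of \<open>\<Phi>'\<close> immaterial.\<close>
  define b' where "b' s = indicator ?Q s *\<^sub>R b s" for s
  define \<Phi>' where "\<Phi>' s = indicator ?Q s *\<^sub>R \<Phi> s" for s
  have [measurable]: "b' \<in> borel_measurable borel" "\<Phi>' \<in> borel_measurable borel"
    unfolding b'_def \<Phi>'_def using b \<Phi> by (intro borel_measurable_continuous_on_indicator; simp)+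
  define F where "F s y = b' s * (f' y * k (\<Phi>' s - y))" for s y
  have Fm[measurable]: "case_prod F \<in> borel_measurable (lborel \<Otimes>\<^sub>M lborel)"
    unfolding F_def[abs_def] by measurable
  have F_le: "norm (F s y) \<le> norm (indicator ?Q s * B * (M * \<bar>f' y\<bar>))" for s y
  proof (cases "s \<in> ?Q")
    case True
    have "\<bar>b s\<bar> * (\<bar>f' y\<bar> * \<bar>k (\<Phi> s - y)\<bar>) \<le> B * (\<bar>f' y\<bar> * M)"
      using B[OF True] M by (intro mult_mono) auto
    also have "\<dots> \<le> \<bar>B * (\<bar>f' y\<bar> * M)\<bar>" by simp
    finally show ?thesis using True by (simp add: F_def b'_def \<Phi>'_def abs_mult ac_simps)
  qed (simp add: F_def b'_def)
  have G: "integrable (lborel \<Otimes>\<^sub>M lborel) (\<lambda>(s, y). indicator ?Q s * B * (M * \<bar>f' y\<bar>))"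
  proof (rule lborel_pair.Fubini_integrable)
    have "integrable lborel (\<lambda>s :: real^2. indicator ?Q s * (\<bar>B\<bar> * (\<bar>M\<bar> * (\<integral>y. \<bar>f' y\<bar> \<partial>lborel))))"
      by (intro integrable_mult_left) (use emeasure_lborel_cbox_finite in \<open>auto simp: integrable_indicator_iff\<close>)
    then show "integrable lborel (\<lambda>s. \<integral>y. norm (case (s, y) of (s, y) \<Rightarrow> indicator ?Q s * B * (M * \<bar>f' y\<bar>)) \<partial>lborel)"
      by (simp add: abs_mult mult.assoc)
    show "AE s in lborel. integrable lborel (\<lambda>y. case (s, y) of (s, y) \<Rightarrow> indicator ?Q s * B * (M * \<bar>f' y\<bar>))"
      using f'(2) by auto
  qed measurable
  have F: "integrable (lborel \<Otimes>\<^sub>M lborel) (case_prod F)"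
    by (rule Bochner_Integration.integrable_bound[OF G]) (use F_le in auto)
  define T where "T y = (\<integral>s. b' s * k (\<Phi>' s - y) \<partial>lborel)" for y
  have Tm: "T \<in> borel_measurable borel" unfolding T_def[abs_def] by measurable
  have Teq: "T y = integral ?Q (\<lambda>s. b s * k (\<Phi> s - y))" for y
  proof -
    have "continuous_on ?Q (\<lambda>s. b s * k (\<Phi> s - y))"
      by (intro elem_smooth_compose[OF k] b \<Phi> continuous_intros)
    then have "set_integrable lborel ?Q (\<lambda>s. b s * k (\<Phi> s - y))"
      unfolding set_integrable_def by (intro borel_integrable_compact) auto
    from set_borel_integral_eq_integral(2)[OF this]
    have "(\<integral>s. indicator ?Q s *\<^sub>R (b s * k (\<Phi> s - y)) \<partial>lborel) = integral ?Q (\<lambda>s. b s * k (\<Phi> s - y))"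
      by (simp add: set_lebesgue_integral_def)
    moreover have "(\<lambda>s. indicator ?Q s *\<^sub>R (b s * k (\<Phi> s - y))) = (\<lambda>s. b' s * k (\<Phi>' s - y))"
      by (auto simp: fun_eq_iff b'_def \<Phi>'_def indicator_def)
    ultimately show ?thesis by (simp add: T_def)
  qed
  have FT: "(\<integral>s. F s y \<partial>lborel) = f' y * T y" for y
    unfolding F_def T_def by (subst integral_mult_right_zero[symmetric]) (simp add: ac_simps)
  have intT: "integrable lborel (\<lambda>y. f' y * T y)"
    using lborel_pair.integrable_snd[OF F] unfolding FT .
  have inner: "(\<integral>y. F s y \<partial>lborel) = indicator ?Q s *\<^sub>R (b s * integral \<Omega> (\<lambda>y. f y * k (\<Phi> s - y)))" for s
  proof (cases "s \<in> ?Q")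
    case True
    have km: "(\<lambda>y. k (\<Phi> s - y)) \<in> borel_measurable borel" by measurable
    have "integrable lborel (\<lambda>y. f' y * k (\<Phi> s - y))"
    proof (rule Bochner_Integration.integrable_bound)
      show "integrable lborel (\<lambda>y. M * f' y)" using f'(2) by simp
      have "\<bar>f' y\<bar> * \<bar>k (\<Phi> s - y)\<bar> \<le> \<bar>f' y\<bar> * \<bar>M\<bar>" for y
        using M[of "\<Phi> s - y"] by (intro mult_left_mono) auto
      then show "AE y in lborel. norm (f' y * k (\<Phi> s - y)) \<le> norm (M * f' y)"
        by (auto simp: abs_mult mult.commute)
    qed measurable
    from eq[OF km this] True show ?thesis
      by (simp add: F_def b'_def \<Phi>'_def)
  qed (simp add: F_def b'_def)
  have int_s: "set_integrable lborel ?Q (\<lambda>s. b s * integral \<Omega> (\<lambda>y. f y * k (\<Phi> s - y)))"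
    using lborel_pair.integrable_fst[OF F] unfolding set_integrable_def inner .
  show "(\<lambda>y. f y * integral ?Q (\<lambda>s. b s * k (\<Phi> s - y))) absolutely_integrable_on \<Omega>"
    using iff[OF Tm] intT by (simp add: Teq)
  show "(\<lambda>s. b s * integral \<Omega> (\<lambda>y. f y * k (\<Phi> s - y))) integrable_on ?Q"
    by (rule set_borel_integral_eq_integral(1)[OF int_s])
  have "integral \<Omega> (\<lambda>y. f y * T y) = (\<integral>y. (\<integral>s. F s y \<partial>lborel) \<partial>lborel)"
    unfolding FT by (rule eq[OF Tm intT, symmetric])
  also have "\<dots> = (\<integral>s. (\<integral>y. F s y \<partial>lborel) \<partial>lborel)"
    by (rule lborel_pair.Fubini_integral[OF F])
  also have "\<dots> = integral ?Q (\<lambda>s. b s * integral \<Omega> (\<lambda>y. f y * k (\<Phi> s - y)))"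
    unfolding inner using set_borel_integral_eq_integral(2)[OF int_s] by (simp add: set_lebesgue_integral_def)
  finally show "integral \<Omega> (\<lambda>y. f y * integral ?Q (\<lambda>s. b s * k (\<Phi> s - y)))
      = integral ?Q (\<lambda>s. b s * integral \<Omega> (\<lambda>y. f y * k (\<Phi> s - y)))"
    by (simp add: Teq)
qed

section \<open>Weak gradients and changes of variables\<close>

text \<open>Scalar integrands enter the vector-valued change of variables as elements of
  \<open>real ^ 1\<close>.\<close>

lemma change_of_variables_real:
  fixes f :: "real^2 \<Rightarrow> real" and g :: "real^2 \<Rightarrow> real^2"
  assumes "S \<in> sets lebesgue"
    and "\<And>x. x \<in> S \<Longrightarrow> (g has_derivative (\<lambda>h. J x *v h)) (at x within S)" and "inj_on g S"
  shows "(\<lambda>x. \<bar>det (J x)\<bar> * f (g x)) absolutely_integrable_on S \<longleftrightarrow> f absolutely_integrable_on (g ` S)"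
    and "f absolutely_integrable_on (g ` S) \<Longrightarrow> integral S (\<lambda>x. \<bar>det (J x)\<bar> * f (g x)) = integral (g ` S) f"
proof -
  have *: "(\<lambda>x. \<bar>det (J x)\<bar> * f (g x)) absolutely_integrable_on S \<and>
      integral S (\<lambda>x. \<bar>det (J x)\<bar> * f (g x)) = b
    \<longleftrightarrow> f absolutely_integrable_on (g ` S) \<and> integral (g ` S) f = b" for b
  proof -
    have "(\<lambda>x. \<bar>det (matrix (\<lambda>h. J x *v h))\<bar> *\<^sub>R vec (f (g x)) :: real ^ 1) absolutely_integrable_on S \<and>
        integral S (\<lambda>x. \<bar>det (matrix (\<lambda>h. J x *v h))\<bar> *\<^sub>R vec (f (g x))) = (vec b :: real ^ 1)
      \<longleftrightarrow> (\<lambda>x. vec (f x) :: real ^ 1) absolutely_integrable_on (g ` S) \<and>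
        integral (g ` S) (\<lambda>x. vec (f x)) = (vec b :: real ^ 1)"
      by (intro has_absolute_integral_change_of_variables assms) auto
    then show ?thesis by (simp add: absolutely_integrable_on_1_iff integral_on_1_eq)
  qed
  show "(\<lambda>x. \<bar>det (J x)\<bar> * f (g x)) absolutely_integrable_on S \<longleftrightarrow> f absolutely_integrable_on (g ` S)"
    using * by blast
  show "f absolutely_integrable_on (g ` S) \<Longrightarrow> integral S (\<lambda>x. \<bar>det (J x)\<bar> * f (g x)) = integral (g ` S) f"
    using * by blast
qed

section \<open>Integration along coordinate lines\<close>

definition line :: "2 \<Rightarrow> real \<Rightarrow> real \<Rightarrow> real^2" where
  "line i t c = (if i = 1 then pt t c else pt c t)"

lemma line_shift: "line i (t + u) c = line i t c + u *\<^sub>R axis i 1"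
proof -
  have "i = 1 \<or> i = 2" using exhaust_2 by blast
  then show ?thesis by (auto simp: line_def vec_eq_iff forall_2)
qed

lemma line_mem_square: "t \<in> {0..1} \<Longrightarrow> c \<in> {0..1} \<Longrightarrow> line i t c \<in> cbox 0 1"
  by (auto simp: line_def mem_cbox_2)

lemma line_deriv: "((\<lambda>t. line i t c) has_derivative (\<lambda>h. h *\<^sub>R axis i 1)) (at t within S)"
proof -
  have "(\<lambda>t. line i t c) = (\<lambda>t. line i 0 c + t *\<^sub>R axis i 1)"
    by (rule ext) (metis add_0 line_shift)
  moreover have "((\<lambda>t. line i 0 c + t *\<^sub>R axis i 1) has_derivative (\<lambda>h. h *\<^sub>R axis i 1)) (at t within S)"
    by (auto intro!: derivative_eq_intros)
  ultimately show ?thesis by metis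
qed

lemma deriv_along_line:
  assumes "\<And>s. ((\<lambda>t. f (s + t *\<^sub>R axis i 1)) has_real_derivative f' s) (at 0)"
  shows "((\<lambda>t. f (line i t c)) has_real_derivative f' (line i t c)) (at t within S)"
proof -
  have "((\<lambda>u. f (line i (u + t) c)) has_real_derivative f' (line i t c)) (at 0)"
    using assms[of "line i t c"] by (simp add: line_shift add.commute[of _ t])
  then have "((\<lambda>t. f (line i t c)) has_real_derivative f' (line i t c)) (at t)"
    using DERIV_shift[of "\<lambda>t. f (line i t c)" "f' (line i t c)" 0 t] by simp
  then show ?thesis by (rule has_field_derivative_at_within)
qed

text \<open>The fundamental theorem of calculus on each line in direction i, where F takes equal
  values at both ends, followed by integration over the other coordinate.\<close>

lemma integral_square_deriv:
  fixes F F' :: "real^2 \<Rightarrow> real"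
  assumes "continuous_on (cbox 0 1) F'"
    and "\<And>t c. t \<in> {0..1} \<Longrightarrow> c \<in> {0..1} \<Longrightarrow>
      ((\<lambda>t. F (line i t c)) has_real_derivative F' (line i t c)) (at t within {0..1})"
    and "\<And>c. c \<in> {0..1} \<Longrightarrow> F (line i 0 c) = F (line i 1 c)"
  shows "integral (cbox 0 1) F' = 0"
proof -
  have "integral (cbox 0 1) F' = integral {0..1} (\<lambda>c. integral {0..1} (\<lambda>t. F' (line i t c)))"
    using integral_square_iterated[OF assms(1)] unfolding line_def by (cases "i = 1") (simp_all only: refl if_True if_False)
  also have "\<dots> = integral {0..1} (\<lambda>c :: real. 0)"
  proof (rule integral_cong)
    fix c :: real assume c: "c \<in> {0..1}"
    have "((\<lambda>t. F' (line i t c)) has_integral F (line i 1 c) - F (line i 0 c)) {0..1}"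
      using assms(2) c
      by (intro fundamental_theorem_of_calculus) (auto simp flip: has_real_derivative_iff_has_vector_derivative)
    then show "integral {0..1} (\<lambda>t. F' (line i t c)) = 0"
      using assms(3)[OF c] by (simp add: integral_unique)
  qed
  finally show ?thesis by simp
qed

text \<open>A C^1 chart of the closed unit square. Nondegeneracy is demanded in the open square,
  because the eigenvalue bounds of an element are given on the open reference element.\<close>

locale patch =
  fixes \<Phi> :: "real^2 \<Rightarrow> real^2" and J :: "real^2 \<Rightarrow> real^2^2"
  assumes der: "\<And>s. s \<in> cbox 0 1 \<Longrightarrow> (\<Phi> has_derivative (\<lambda>h. J s *v h)) (at s within cbox 0 1)"
    and cont_J: "continuous_on (cbox 0 1) J"
    and inj: "inj_on \<Phi> (cbox 0 1)"
    and det_nz: "\<And>s. s \<in> box 0 1 \<Longrightarrow> det (J s) \<noteq> 0"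
begin

lemma cont: "continuous_on (cbox 0 1) \<Phi>"
  by (rule has_derivative_continuous_on[OF der])

lemma cont_entry: "continuous_on (cbox 0 1) (\<lambda>s. J s $ k $ i)"
  using cont_J by (intro continuous_intros)

lemma cont_det: "continuous_on (cbox 0 1) (\<lambda>s. det (J s))"
  unfolding det_2 by (intro continuous_intros cont_entry)

lemma box_sub: "box 0 1 \<subseteq> (cbox 0 1 :: (real^2) set)"
  by (rule box_subset_cbox)

lemma open_image: "open (\<Phi> ` box 0 1)"
  using cont inj box_sub by (intro invariance_of_domain) (auto intro: continuous_on_subset inj_on_subset)

lemma der_box: "s \<in> box 0 1 \<Longrightarrow> (\<Phi> has_derivative (\<lambda>h. J s *v h)) (at s within box 0 1)"
  using der box_sub has_derivative_subset by blast

lemma transform: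
  fixes f :: "real^2 \<Rightarrow> real"
  shows "(\<lambda>s. \<bar>det (J s)\<bar> * f (\<Phi> s)) absolutely_integrable_on box 0 1 \<longleftrightarrow> f absolutely_integrable_on \<Phi> ` box 0 1"
    and "f absolutely_integrable_on \<Phi> ` box 0 1 \<Longrightarrow>
      integral (box 0 1) (\<lambda>s. \<bar>det (J s)\<bar> * f (\<Phi> s)) = integral (\<Phi> ` box 0 1) f"
  by (rule change_of_variables_real[OF _ der_box inj_on_subset[OF inj box_sub]]; simp)+

text \<open>\<Phi> transports the measure b ds to the density a = b / |det J|, read at the preimage
  under \<Phi>, which is continuous with compact support. The inner integral is thus a mollification
  of a; it converges uniformly, and f is integrable.\<close>

lemma pushforward_limit:
  fixes f b :: "real^2 \<Rightarrow> real"
  assumes f: "f absolutely_integrable_on \<Omega>" and \<Omega>: "open \<Omega>" "\<Phi> ` box 0 1 \<subseteq> \<Omega>"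
    and b: "continuous_on (cbox 0 1) b" and \<delta>: "0 < \<delta>"
    and supp: "\<And>s. s \<in> cbox 0 1 \<Longrightarrow> s \<notin> cbox (pt \<delta> \<delta>) (pt (1 - \<delta>) (1 - \<delta>)) \<Longrightarrow> b s = 0" and r: "0 < r"
  shows "\<exists>d>0. \<forall>e. 0 < e \<and> e < d \<longrightarrow>
    \<bar>integral \<Omega> (\<lambda>y. f y * integral (cbox 0 1) (\<lambda>s. b s * mollifier e (\<Phi> s - y)))
      - integral (box 0 1) (\<lambda>s. b s * f (\<Phi> s))\<bar> \<le> r"
proof -
  let ?Q = "cbox 0 1 :: (real^2) set" and ?U = "box 0 1 :: (real^2) set"
  let ?D = "cbox (pt \<delta> \<delta>) (pt (1 - \<delta>) (1 - \<delta>))"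
  have DU: "?D \<subseteq> ?U" using \<delta> by (auto simp: mem_cbox_2 mem_box_2)
  define \<Psi> where "\<Psi> = the_inv_into ?Q \<Phi>"
  have \<Psi>: "\<Psi> (\<Phi> s) = s" if "s \<in> ?Q" for s
    unfolding \<Psi>_def using inj that by (rule the_inv_into_f_f)
  have cont_\<Psi>: "continuous_on (\<Phi> ` ?Q) \<Psi>"
    unfolding \<Psi>_def using cont inj by (intro continuous_on_inv_into) auto
  define a where "a y = (if y \<in> \<Phi> ` ?U then b (\<Psi> y) / \<bar>det (J (\<Psi> y))\<bar> else 0)" for y
  have a_\<Phi>: "a (\<Phi> s) = b s / \<bar>det (J s)\<bar>" if "s \<in> ?U" for s
    using that \<Psi>[of s] box_sub by (auto simp: a_def)
  have a_0: "a y = 0" if "y \<notin> \<Phi> ` ?D" for y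
  proof (cases "y \<in> \<Phi> ` ?U")
    case True
    then obtain s where "s \<in> ?U" "y = \<Phi> s" by blast
    then show ?thesis using that supp[of s] a_\<Phi>[of s] box_sub by auto
  qed (simp add: a_def)
  have comp: "compact (\<Phi> ` ?D)"
    using cont DU box_sub by (intro compact_continuous_image) (auto intro: continuous_on_subset)
  \<comment> \<open>Continuity is glued from two open sets: the image of the open square, and the
    complement of the image of the box that carries b, where a is 0.\<close>
  have cont_a: "continuous_on UNIV a"
  proof -
    have "continuous_on (\<Phi> ` ?U) (\<lambda>y. b (\<Psi> y) / \<bar>det (J (\<Psi> y))\<bar>)"
    proof (intro continuous_intros)
      have c: "continuous_on (\<Phi> ` ?U) \<Psi>"
        using cont_\<Psi> box_sub by (rule continuous_on_subset[OF _ image_mono])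
      have sub: "\<Psi> ` \<Phi> ` ?U \<subseteq> ?Q" using \<Psi> box_sub by auto
      show "continuous_on (\<Phi> ` ?U) (\<lambda>y. b (\<Psi> y))" by (rule continuous_on_compose2[OF b c sub])
      show "continuous_on (\<Phi> ` ?U) (\<lambda>y. det (J (\<Psi> y)))" by (rule continuous_on_compose2[OF cont_det c sub])
      show "\<forall>y\<in>\<Phi> ` ?U. \<bar>det (J (\<Psi> y))\<bar> \<noteq> 0" using det_nz \<Psi> box_sub by auto
    qed
    then have 1: "continuous_on (\<Phi> ` ?U) a"
      by (rule continuous_on_eq) (simp add: a_def)
    have 2: "continuous_on (- \<Phi> ` ?D) a"
      by (rule continuous_on_eq[OF continuous_on_const]) (use a_0 in auto)
    have "continuous_on (\<Phi> ` ?U \<union> - \<Phi> ` ?D) a"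
      using open_image comp 1 2 by (intro continuous_on_open_Un) (auto simp: compact_imp_closed)
    moreover have "\<Phi> ` ?U \<union> - \<Phi> ` ?D = UNIV" using DU by blast
    ultimately show ?thesis by simp
  qed
  have T: "integral ?Q (\<lambda>s. b s * mollifier e (\<Phi> s - y)) = integral UNIV (\<lambda>x. a x * mollifier e (x - y))" for e y
  proof -
    let ?h = "\<lambda>x. a x * mollifier e (x - y)"
    have "(\<lambda>s. b s * mollifier e (\<Phi> s - y)) absolutely_integrable_on ?Q"
      by (intro absolutely_integrable_continuous continuous_intros b elem_smooth_compose elem_smooth_mollifier cont)
    then have "(\<lambda>s. b s * mollifier e (\<Phi> s - y)) absolutely_integrable_on ?U"
      by (rule set_integrable_subset) (use box_sub in auto)
    moreover have eq: "b s * mollifier e (\<Phi> s - y) = \<bar>det (J s)\<bar> * ?h (\<Phi> s)" if "s \<in> ?U" for s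
      using det_nz[OF that] a_\<Phi>[OF that] by simp
    ultimately have "(\<lambda>s. \<bar>det (J s)\<bar> * ?h (\<Phi> s)) absolutely_integrable_on ?U"
      by (simp cong: set_integrable_cong)
    then have "?h absolutely_integrable_on \<Phi> ` ?U" using transform(1)[of ?h] by blast
    then have "integral ?U (\<lambda>s. \<bar>det (J s)\<bar> * ?h (\<Phi> s)) = integral (\<Phi> ` ?U) ?h"
      by (rule transform(2))
    moreover have "integral ?U (\<lambda>s. b s * mollifier e (\<Phi> s - y)) = integral ?U (\<lambda>s. \<bar>det (J s)\<bar> * ?h (\<Phi> s))"
      by (rule integral_cong) (rule eq)
    ultimately have "integral ?U (\<lambda>s. b s * mollifier e (\<Phi> s - y)) = integral (\<Phi> ` ?U) ?h" by simp
    moreover have "integral (\<Phi> ` ?U) ?h = integral UNIV ?h"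
      by (subst integral_restrict_UNIV[symmetric], intro arg_cong[where f = "integral _"]) (auto simp: a_def)
    ultimately show ?thesis by (simp add: integral_open_interval)
  qed
  have meas: "\<Omega> \<in> sets lebesgue" using \<Omega> by simp
  \<comment> \<open>The tolerance r / (I + 1) makes sense also when the L1 norm I of f is 0.\<close>
  define I where "I = integral \<Omega> (\<lambda>y. \<bar>f y\<bar>)"
  have fabs: "(\<lambda>y. \<bar>f y\<bar>) integrable_on \<Omega>" using f by (simp add: absolutely_integrable_on_def)
  then have I0: "0 \<le> I" unfolding I_def by (intro integral_nonneg) auto
  obtain d where d: "0 < d" "\<And>e y. 0 < e \<Longrightarrow> e < d \<Longrightarrow> \<bar>integral UNIV (\<lambda>x. a x * mollifier e (x - y)) - a y\<bar> \<le> r / (I + 1)"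
    using mollifier_uniform[OF cont_a compact_imp_bounded[OF comp] a_0, of "r / (I + 1)"] r I0 by auto
  have "bounded (range a)"
  proof -
    have "range a \<subseteq> insert 0 (a ` \<Phi> ` ?D)" using a_0 by auto
    moreover have "compact (a ` \<Phi> ` ?D)"
      using comp by (rule compact_continuous_image[OF continuous_on_subset[OF cont_a subset_UNIV]])
    ultimately show ?thesis by (meson bounded_insert bounded_subset compact_imp_bounded)
  qed
  then obtain A where A: "\<And>y. \<bar>a y\<bar> \<le> A" by (auto simp: bounded_iff)
  have fa: "(\<lambda>y. f y * a y) absolutely_integrable_on \<Omega>"
    using A by (intro absolutely_integrable_mult_bounded[OF f meas continuous_on_subset[OF cont_a]]) auto
  have fa_eq: "integral \<Omega> (\<lambda>y. f y * a y) = integral ?U (\<lambda>s. b s * f (\<Phi> s))"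
  proof -
    have "integral \<Omega> (\<lambda>y. f y * a y) = integral (\<Phi> ` ?U) (\<lambda>y. f y * a y)"
      using \<Omega>(2) by (subst (1 2) integral_restrict_UNIV[symmetric], intro arg_cong[where f = "integral _"])
        (auto simp: a_def fun_eq_iff)
    also have "\<dots> = integral ?U (\<lambda>s. \<bar>det (J s)\<bar> * (f (\<Phi> s) * a (\<Phi> s)))"
      using set_integrable_subset[OF fa _ \<Omega>(2)] open_image by (intro transform(2)[symmetric]) auto
    also have "\<dots> = integral ?U (\<lambda>s. b s * f (\<Phi> s))"
      using det_nz a_\<Phi> by (intro integral_cong) auto
    finally show ?thesis .
  qed
  have "\<bar>integral \<Omega> (\<lambda>y. f y * integral ?Q (\<lambda>s. b s * mollifier e (\<Phi> s - y)))
      - integral ?U (\<lambda>s. b s * f (\<Phi> s))\<bar> \<le> r" if e: "0 < e" "e < d" for e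
  proof -
    let ?T = "\<lambda>y. integral ?Q (\<lambda>s. b s * mollifier e (\<Phi> s - y))"
    have fT: "(\<lambda>y. f y * ?T y) absolutely_integrable_on \<Omega>"
      by (rule kernel_fubini(2)[OF f b cont elem_smooth_mollifier])
    have "integral \<Omega> (\<lambda>y. f y * ?T y) - integral \<Omega> (\<lambda>y. f y * a y) = integral \<Omega> (\<lambda>y. f y * ?T y - f y * a y)"
      using fT fa by (intro integral_diff[symmetric]) (auto simp: absolutely_integrable_on_def)
    also have "norm \<dots> \<le> integral \<Omega> (\<lambda>y. r / (I + 1) * \<bar>f y\<bar>)"
    proof (rule integral_norm_bound_integral)
      fix y
      have "norm (f y * ?T y - f y * a y) = \<bar>?T y - a y\<bar> * \<bar>f y\<bar>"
        unfolding right_diff_distrib[symmetric] real_norm_def abs_mult by (rule mult.commute)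
      also have "\<dots> \<le> r / (I + 1) * \<bar>f y\<bar>"
        using d(2)[OF e, of y] unfolding T by (rule mult_right_mono) simp
      finally show "norm (f y * ?T y - f y * a y) \<le> r / (I + 1) * \<bar>f y\<bar>" .
    next
      show "(\<lambda>y. r / (I + 1) * \<bar>f y\<bar>) integrable_on \<Omega>" by (rule integrable_on_mult_right[OF fabs])
    qed (use fT fa in \<open>auto intro!: integrable_diff simp: absolutely_integrable_on_def\<close>)
    also have "\<dots> = r / (I + 1) * I" by (simp add: I_def)
    also have "\<dots> \<le> r" using r I0 by (simp add: field_simps)
    finally show ?thesis unfolding fa_eq by simp
  qed
  then show ?thesis using d(1) by blast
qed

text \<open>For fixed y the function s -> \<open>mollifier e (\<Phi> s - y)\<close> is C^1, so the
  chain rule is classical; multiplied by \<psi> it vanishes on the boundary of the square.\<close>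

lemma mollifier_parts:
  assumes \<psi>: "continuous_on UNIV \<psi>" "continuous_on UNIV \<psi>'"
    and d\<psi>: "\<And>s. ((\<lambda>t. \<psi> (s + t *\<^sub>R axis i 1)) has_real_derivative \<psi>' s) (at 0)"
    and supp: "\<And>s. s \<notin> box 0 1 \<Longrightarrow> \<psi> s = 0"
  shows "integral (cbox 0 1) (\<lambda>s. \<psi>' s * mollifier e (\<Phi> s - y))
    = - integral (cbox 0 1) (\<lambda>s. \<psi> s * J s $ 1 $ i * dmollifier e 1 (\<Phi> s - y))
      - integral (cbox 0 1) (\<lambda>s. \<psi> s * J s $ 2 $ i * dmollifier e 2 (\<Phi> s - y))"
proof -
  let ?Q = "cbox 0 1 :: (real^2) set"
  let ?A = "\<lambda>s. \<psi>' s * mollifier e (\<Phi> s - y)"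
  let ?B = "\<lambda>k s. \<psi> s * J s $ k $ i * dmollifier e k (\<Phi> s - y)"
  have cA: "continuous_on ?Q ?A"
    by (intro continuous_intros elem_smooth_compose elem_smooth_mollifier cont continuous_on_subset[OF \<psi>(2)]) auto
  have cB: "continuous_on ?Q (?B k)" for k
    by (intro continuous_intros elem_smooth_compose elem_smooth_dmollifier cont cont_entry continuous_on_subset[OF \<psi>(1)]) auto
  have "integral ?Q (\<lambda>s. ?A s + (?B 1 s + ?B 2 s)) = 0"
  proof (rule integral_square_deriv[where F = "\<lambda>s. \<psi> s * mollifier e (\<Phi> s - y)" and i = i])
    fix t c :: real assume tc: "t \<in> {0..1}" "c \<in> {0..1}"
    let ?s = "line i t c"
    have "((\<lambda>t. \<Phi> (line i t c)) has_derivative (\<lambda>h. J ?s *v (h *\<^sub>R axis i 1))) (at t within {0..1})"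
      using line_mem_square tc
      by (intro has_derivative_in_compose2[OF der _ _ line_deriv]) auto
    then have "((\<lambda>t. \<Phi> (line i t c) - y) has_derivative (\<lambda>h. J ?s *v (h *\<^sub>R axis i 1) - 0)) (at t within {0..1})"
      by (intro has_derivative_diff has_derivative_const)
    from has_derivative_compose[OF this mollifier_deriv]
    have "((\<lambda>t. mollifier e (\<Phi> (line i t c) - y)) has_derivative
        (\<lambda>h. (J ?s *v (h *\<^sub>R axis i 1) - 0) $ 1 * dmollifier e 1 (\<Phi> ?s - y)
          + (J ?s *v (h *\<^sub>R axis i 1) - 0) $ 2 * dmollifier e 2 (\<Phi> ?s - y))) (at t within {0..1})" .
    moreover have "(J ?s *v (h *\<^sub>R axis i 1) - 0) $ k = h * J ?s $ k $ i" for h k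
      by (simp add: matrix_vector_mult_basis column_def matrix_vector_mult_scaleR)
    ultimately have "((\<lambda>t. mollifier e (\<Phi> (line i t c) - y)) has_derivative
        (\<lambda>h. h * J ?s $ 1 $ i * dmollifier e 1 (\<Phi> ?s - y) + h * J ?s $ 2 $ i * dmollifier e 2 (\<Phi> ?s - y))) (at t within {0..1})"
      by (simp only:)
    then have "((\<lambda>t. mollifier e (\<Phi> (line i t c) - y)) has_real_derivative
        J ?s $ 1 $ i * dmollifier e 1 (\<Phi> ?s - y) + J ?s $ 2 $ i * dmollifier e 2 (\<Phi> ?s - y)) (at t within {0..1})"
      unfolding has_field_derivative_def
      by (rule has_derivative_eq_rhs) (simp add: fun_eq_iff algebra_simps)
    from DERIV_mult[OF deriv_along_line[OF d\<psi>, of c t "{0..1}"] this]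
    show "((\<lambda>t. \<psi> (line i t c) * mollifier e (\<Phi> (line i t c) - y)) has_real_derivative
        ?A ?s + (?B 1 ?s + ?B 2 ?s)) (at t within {0..1})"
      by (simp add: algebra_simps)
  next
    fix c :: real
    have "line i 0 c \<notin> box 0 1" "line i 1 c \<notin> box 0 1" by (auto simp: line_def mem_box_2)
    then show "\<psi> (line i 0 c) * mollifier e (\<Phi> (line i 0 c) - y) = \<psi> (line i 1 c) * mollifier e (\<Phi> (line i 1 c) - y)"
      using supp by simp
  qed (intro continuous_intros cA cB)
  moreover have "integral ?Q (\<lambda>s. ?A s + (?B 1 s + ?B 2 s)) = integral ?Q ?A + (integral ?Q (?B 1) + integral ?Q (?B 2))"
    using cA cB by (simp add: integral_add integrable_continuous continuous_on_add)
  ultimately show ?thesis by simp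
qed

end

text \<open>Passes from the Bochner integral of the definition to the gauge integral; the products
  are integrable because functions in \<open>elem_smooth\<close> and their partial derivatives are
  bounded.\<close>

lemma weak_gradient_integral:
  fixes g :: "real^2 \<Rightarrow> real^2"
  assumes "has_weak_gradient \<Omega> v g" "test_function \<Omega> \<phi>" "open \<Omega>" "elem_smooth \<phi>"
    and "v absolutely_integrable_on \<Omega>" "(\<lambda>x. g x $ i) absolutely_integrable_on \<Omega>"
  shows "integral \<Omega> (\<lambda>x. v x * frechet_derivative \<phi> (at x) (axis i 1)) = - integral \<Omega> (\<lambda>x. g x $ i * \<phi> x)"
proof -
  have \<Omega>: "\<Omega> \<in> sets lebesgue" using assms(3) by simp
  have eq: "integral\<^sup>L (lebesgue_on \<Omega>) (\<lambda>x. f x * h x) = integral \<Omega> (\<lambda>x. f x * h x)"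
    if "elem_smooth h" "f absolutely_integrable_on \<Omega>" for f h :: "real^2 \<Rightarrow> real"
  proof -
    obtain B where "\<And>x. \<bar>h x\<bar> \<le> B" using elem_smooth_bounded \<open>elem_smooth h\<close> by blast
    then have "(\<lambda>x. f x * h x) absolutely_integrable_on \<Omega>"
      using that by (intro absolutely_integrable_mult_bounded[OF _ \<Omega>] elem_smooth_continuous) auto
    then show ?thesis
      using \<Omega> by (intro lebesgue_integral_eq_integral absolutely_integrable_imp_integrable)
  qed
  show ?thesis
    using assms(1,2) unfolding has_weak_gradient_def
    unfolding eq[OF elem_smooth_partial(2)[OF assms(4)] assms(5), symmetric] eq[OF assms(4,6), symmetric]
    by blast
qed

context patch
begin

text \<open>The weak derivative of \<open>v \<circ> \<Phi>\<close> in direction \<open>i\<close> is \<open>(g \<circ> \<Phi>) \<bullet> \<partial>\<^sub>i\<Phi>\<close>: inserting the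
  mollifier \<open>\<eta>(\<Phi>(s) - y)\<close> reduces this to the classical chain rule.\<close>

lemma weak_pullback:
  fixes g :: "real^2 \<Rightarrow> real^2"
  assumes \<Omega>: "open \<Omega>" "\<Phi> ` box 0 1 \<subseteq> \<Omega>"
    and v: "v absolutely_integrable_on \<Omega>" and g: "\<And>k. (\<lambda>x. g x $ k) absolutely_integrable_on \<Omega>"
    and weak: "has_weak_gradient \<Omega> v g"
    and \<psi>: "continuous_on UNIV \<psi>" "continuous_on UNIV \<psi>'"
    and d\<psi>: "\<And>s. ((\<lambda>t. \<psi> (s + t *\<^sub>R axis i 1)) has_real_derivative \<psi>' s) (at 0)"
    and \<delta>: "0 < \<delta>"
    and supp: "\<And>s. s \<notin> cbox (pt \<delta> \<delta>) (pt (1 - \<delta>) (1 - \<delta>)) \<Longrightarrow> \<psi> s = 0 \<and> \<psi>' s = 0"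
  shows "integral (box 0 1) (\<lambda>s. \<psi>' s * v (\<Phi> s))
    = - integral (box 0 1) (\<lambda>s. \<psi> s * J s $ 1 $ i * g (\<Phi> s) $ 1)
      - integral (box 0 1) (\<lambda>s. \<psi> s * J s $ 2 $ i * g (\<Phi> s) $ 2)"
    (is "?V = - ?G 1 - ?G 2")
proof -
  let ?Q = "cbox 0 1 :: (real^2) set" and ?D = "cbox (pt \<delta> \<delta>) (pt (1 - \<delta>) (1 - \<delta>))"
  have DU: "?D \<subseteq> box 0 1" using \<delta> by (auto simp: mem_cbox_2 mem_box_2)
  then have DQ: "?D \<subseteq> ?Q" using box_sub by blast
  have c\<psi>: "continuous_on ?Q \<psi>" "continuous_on ?Q \<psi>'" using \<psi> by (auto intro: continuous_on_subset)
  have c\<psi>J: "continuous_on ?Q (\<lambda>s. \<psi> s * J s $ k $ i)" for k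
    by (intro continuous_intros c\<psi> cont_entry)
  define VV where "VV e = integral \<Omega> (\<lambda>y. v y * integral ?Q (\<lambda>s. \<psi>' s * mollifier e (\<Phi> s - y)))" for e
  define GG where "GG k e = integral \<Omega> (\<lambda>y. g y $ k * integral ?Q (\<lambda>s. \<psi> s * J s $ k $ i * mollifier e (\<Phi> s - y)))" for k e
  have "compact (\<Phi> ` ?D)" using cont DQ by (intro compact_continuous_image) (auto intro: continuous_on_subset)
  moreover have "\<Phi> ` ?D \<subseteq> \<Omega>" using DU \<Omega>(2) by blast
  \<comment> \<open>\<rho> is a margin between the image of the box carrying \<psi> and the
    complement of \<Omega>; for 2 e <= \<rho> the mollifiers centred on that image are test
    functions in \<Omega>.\<close>
  ultimately obtain \<rho> where \<rho>: "0 < \<rho>" "(\<Union>x\<in>\<Phi> ` ?D. cball x \<rho>) \<subseteq> \<Omega>"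
    using compact_subset_open_imp_cball_epsilon_subset[OF _ \<Omega>(1)] by blast
  have identity: "VV e = - GG 1 e - GG 2 e" if e: "0 < e" "2 * e \<le> \<rho>" for e
  proof -
    define K where "K k = integral \<Omega> (\<lambda>y. v y * integral ?Q (\<lambda>s. \<psi> s * J s $ k $ i * dmollifier e k (\<Phi> s - y)))" for k
    note fub = kernel_fubini[OF v c\<psi>J cont elem_smooth_dmollifier]
    have "VV e = integral \<Omega> (\<lambda>y. - (v y * integral ?Q (\<lambda>s. \<psi> s * J s $ 1 $ i * dmollifier e 1 (\<Phi> s - y)))
        - v y * integral ?Q (\<lambda>s. \<psi> s * J s $ 2 $ i * dmollifier e 2 (\<Phi> s - y)))"
      unfolding VV_def
    proof (rule integral_cong)
      fix y
      have "\<And>s. s \<notin> box 0 1 \<Longrightarrow> \<psi> s = 0" using DU supp by blast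
      then have "integral ?Q (\<lambda>s. \<psi>' s * mollifier e (\<Phi> s - y))
        = - integral ?Q (\<lambda>s. \<psi> s * J s $ 1 $ i * dmollifier e 1 (\<Phi> s - y))
          - integral ?Q (\<lambda>s. \<psi> s * J s $ 2 $ i * dmollifier e 2 (\<Phi> s - y))"
        by (rule mollifier_parts[OF \<psi> d\<psi>])
      then show "v y * integral ?Q (\<lambda>s. \<psi>' s * mollifier e (\<Phi> s - y))
        = - (v y * integral ?Q (\<lambda>s. \<psi> s * J s $ 1 $ i * dmollifier e 1 (\<Phi> s - y)))
          - v y * integral ?Q (\<lambda>s. \<psi> s * J s $ 2 $ i * dmollifier e 2 (\<Phi> s - y))"
        by (simp only: right_diff_distrib mult_minus_right)
    qed
    also have "\<dots> = - K 1 - K 2"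
      unfolding K_def using fub(2)
      by (subst integral_diff) (auto simp: absolutely_integrable_on_def intro!: integrable_neg)
    \<comment> \<open>Fubini's theorem brings the integral over \<Omega> inside, the weak gradient
      is used for each s separately, and Fubini's theorem leads back.\<close>
    also have "K = (\<lambda>k. GG k e)"
    proof
      fix k
      have "K k = integral ?Q (\<lambda>s. \<psi> s * J s $ k $ i * integral \<Omega> (\<lambda>y. v y * dmollifier e k (\<Phi> s - y)))"
        unfolding K_def by (rule fub(1))
      also have "\<dots> = integral ?Q (\<lambda>s. \<psi> s * J s $ k $ i * integral \<Omega> (\<lambda>y. g y $ k * mollifier e (\<Phi> s - y)))"
      proof (rule integral_cong)
        fix s
        show "\<psi> s * J s $ k $ i * integral \<Omega> (\<lambda>y. v y * dmollifier e k (\<Phi> s - y))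
          = \<psi> s * J s $ k $ i * integral \<Omega> (\<lambda>y. g y $ k * mollifier e (\<Phi> s - y))"
        proof (cases "s \<in> ?D")
          case True
          have "cball (\<Phi> s) (2 * e) \<subseteq> cball (\<Phi> s) \<rho>" using e by (intro subset_cball)
          then have "cball (\<Phi> s) (2 * e) \<subseteq> \<Omega>" using \<rho>(2) True by blast
          from weak_gradient_integral[OF weak test_function_mollifier[OF e(1) this] \<Omega>(1)
              elem_smooth_mollifier_reflect v g[of k]]
          show ?thesis by (simp add: mollifier_reflect_deriv)
        qed (use supp in auto)
      qed
      also have "\<dots> = GG k e"
        unfolding GG_def by (rule kernel_fubini(1)[OF g c\<psi>J cont elem_smooth_mollifier, symmetric])
      finally show "K k = GG k e" .
    qed
    finally show ?thesis .
  qed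
  \<comment> \<open>For small e each of the three mollified integrals is within r of its limit, and
    the identity for e is exact.\<close>
  have "\<bar>?V - (- ?G 1 - ?G 2)\<bar> \<le> 3 * r" if r: "0 < r" for r
  proof -
    obtain d0 where d0: "0 < d0" "\<And>e. 0 < e \<Longrightarrow> e < d0 \<Longrightarrow> \<bar>VV e - ?V\<bar> \<le> r"
    proof -
      have "\<exists>d>0. \<forall>e. 0 < e \<and> e < d \<longrightarrow> \<bar>VV e - ?V\<bar> \<le> r"
        unfolding VV_def by (rule pushforward_limit[OF v \<Omega> c\<psi>(2) \<delta> _ r]) (simp add: supp)
      then show thesis using that by blast
    qed
    have "\<exists>d>0. \<forall>e. 0 < e \<and> e < d \<longrightarrow> \<bar>GG k e - ?G k\<bar> \<le> r" for k
      unfolding GG_def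
    proof (rule pushforward_limit[OF g \<Omega> c\<psi>J \<delta> _ r])
      fix s assume "s \<notin> ?D"
      then have "\<psi> s = 0" using supp by blast
      then show "\<psi> s * J s $ k $ i = 0" by simp
    qed
    then have "\<forall>k. \<exists>d. 0 < d \<and> (\<forall>e. 0 < e \<and> e < d \<longrightarrow> \<bar>GG k e - ?G k\<bar> \<le> r)" by blast
    from choice[OF this] obtain d where "\<forall>k. 0 < d k \<and> (\<forall>e. 0 < e \<and> e < d k \<longrightarrow> \<bar>GG k e - ?G k\<bar> \<le> r)"
      by blast
    then have d: "\<And>k. 0 < d k" "\<And>k e. 0 < e \<Longrightarrow> e < d k \<Longrightarrow> \<bar>GG k e - ?G k\<bar> \<le> r"
      by blast+
    define e where "e = min (min d0 \<rho>) (min (d 1) (d 2)) / 2"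
    have e: "0 < e" "2 * e \<le> \<rho>" "e < d0" "e < d 1" "e < d 2"
      using d0(1) d(1)[of 1] d(1)[of 2] \<rho>(1) by (auto simp: e_def)
    show ?thesis
      using identity[OF e(1,2)] d0(2)[OF e(1,3)] d(2)[OF e(1,4)] d(2)[OF e(1,5)] by linarith
  qed
  \<comment> \<open>A nonzero difference X would satisfy |X| <= 3 |X| / 6.\<close>
  from this[of "\<bar>?V - (- ?G 1 - ?G 2)\<bar> / 6"] have "?V - (- ?G 1 - ?G 2) = 0" by fastforce
  then show ?thesis by simp
qed

end

section \<open>The inverse estimate on a patch\<close>

lemma bipoly_partial:
  assumes "bipoly n n w"
  shows "\<exists>r. bipoly n n r \<and> (\<forall>s. ((\<lambda>t. w ((s + t *\<^sub>R axis i 1) $ 1) ((s + t *\<^sub>R axis i 1) $ 2))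
    has_real_derivative r (s $ 1) (s $ (2::2))) (at 0))"
proof -
  have shift: "(f has_real_derivative d) (at x) \<Longrightarrow> ((\<lambda>t. f (x + t)) has_real_derivative d) (at 0)"
    for f d and x :: real
    using DERIV_shift[of f d 0 x] by (simp add: add.commute)
  consider "i = 1" | "i = 2" using exhaust_2 by blast
  then show ?thesis
  proof cases
    case 1
    obtain r where "bipoly n n r" "\<And>x y. ((\<lambda>x. w x y) has_real_derivative r x y) (at x)"
      using bipoly_deriv[OF assms] by blast
    then show ?thesis using 1 by (intro exI[of _ r]) (auto intro: shift)
  next
    case 2
    obtain r where r: "bipoly n n r" "\<And>x y. ((\<lambda>x. w y x) has_real_derivative r x y) (at x)"
      using bipoly_deriv[OF bipoly_swap[OF assms]] by blast
    then show ?thesis using 2 bipoly_swap[OF r(1)]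
      by (intro exI[of _ "\<lambda>x y. r y x"]) (auto intro: shift)
  qed
qed

lemma square_parts:
  fixes \<psi> \<psi>' W W' :: "real^2 \<Rightarrow> real"
  assumes \<psi>: "continuous_on UNIV \<psi>" "continuous_on UNIV \<psi>'"
    and d\<psi>: "\<And>s. ((\<lambda>t. \<psi> (s + t *\<^sub>R axis i 1)) has_real_derivative \<psi>' s) (at 0)"
    and W: "continuous_on UNIV W" "continuous_on UNIV W'"
    and dW: "\<And>s. ((\<lambda>t. W (s + t *\<^sub>R axis i 1)) has_real_derivative W' s) (at 0)"
    and supp: "\<And>s. s \<notin> box 0 1 \<Longrightarrow> \<psi> s = 0"
  shows "integral (cbox 0 1) (\<lambda>s. \<psi>' s * W s) = - integral (cbox 0 1) (\<lambda>s. \<psi> s * W' s)"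
proof -
  note ci = continuous_intros continuous_on_subset[OF \<psi>(1) subset_UNIV] continuous_on_subset[OF \<psi>(2) subset_UNIV]
    continuous_on_subset[OF W(1) subset_UNIV] continuous_on_subset[OF W(2) subset_UNIV]
  have "integral (cbox 0 1) (\<lambda>s. \<psi>' s * W s + \<psi> s * W' s) = 0"
  proof (rule integral_square_deriv[where F = "\<lambda>s. \<psi> s * W s" and i = i])
    show "((\<lambda>t. \<psi> (line i t c) * W (line i t c)) has_real_derivative
        \<psi>' (line i t c) * W (line i t c) + \<psi> (line i t c) * W' (line i t c)) (at t within {0..1})" for t c
      using DERIV_mult[OF deriv_along_line[OF d\<psi>, of c t "{0..1}"] deriv_along_line[OF dW, of c t "{0..1}"]]
      by (simp add: mult.commute add.commute)
    show "\<psi> (line i 0 c) * W (line i 0 c) = \<psi> (line i 1 c) * W (line i 1 c)" for c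
    proof -
      have "line i 0 c \<notin> box 0 1" "line i 1 c \<notin> box 0 1" by (auto simp: line_def mem_box_2)
      then show ?thesis using supp by simp
    qed
  qed (intro ci)
  then show ?thesis
    by (subst (asm) integral_add) (auto intro!: integrable_continuous ci)
qed

text \<open>Brings the support of a bump into the centred form that \<open>weak_pullback\<close>
  expects.\<close>

lemma box_01_inner:
  assumes "cbox a b \<subseteq> box 0 (1 :: real^2)" "cbox a b \<noteq> {}"
  shows "\<exists>\<delta>>0. cbox a b \<subseteq> cbox (pt \<delta> \<delta>) (pt (1 - \<delta>) (1 - \<delta>))"
proof -
  obtain x where x: "x \<in> cbox a b" using assms(2) by blast
  then have "a \<in> cbox a b" "b \<in> cbox a b" by (auto simp: mem_cbox_2)
  then have "a \<in> box 0 1" "b \<in> box 0 1" using assms(1) by blast+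
  then show ?thesis
    by (intro exI[of _ "min (min (a $ 1) (a $ 2)) (min (1 - b $ 1) (1 - b $ 2))"])
      (auto simp: mem_box_2 mem_cbox_2)
qed

lemma norm_sq_2: "(norm (x :: real^2))\<^sup>2 = (x $ 1)\<^sup>2 + (x $ 2)\<^sup>2"
  by (simp add: norm_vec_def L2_set_def UNIV_2)

lemma integral_ae_eq:
  fixes f g :: "real^2 \<Rightarrow> real"
  assumes "negligible {s \<in> S. f s \<noteq> g s}"
  shows "integral S f = integral S g"
  using assms by (intro integral_spike[where S = "{s \<in> S. f s \<noteq> g s}"]) auto

context patch
begin

text \<open>The factor |det J| of the change of variables is divided out, which its lower bound c
  permits.\<close>

lemma comp_absolutely_integrable:
  fixes f :: "real^2 \<Rightarrow> real"
  assumes "f absolutely_integrable_on \<Phi> ` box 0 1" "0 < c" "\<And>s. s \<in> box 0 1 \<Longrightarrow> c \<le> \<bar>det (J s)\<bar>"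
  shows "(\<lambda>s. f (\<Phi> s)) absolutely_integrable_on box 0 1"
proof -
  have "(\<lambda>s. \<bar>det (J s)\<bar> * f (\<Phi> s) * (1 / \<bar>det (J s)\<bar>)) absolutely_integrable_on box 0 1"
  proof (rule absolutely_integrable_mult_bounded[where B = "1 / c"])
    show "(\<lambda>s. \<bar>det (J s)\<bar> * f (\<Phi> s)) absolutely_integrable_on box 0 1"
      using assms(1) transform(1)[of f] by blast
    show "continuous_on (box 0 1) (\<lambda>s. 1 / \<bar>det (J s)\<bar>)"
      using det_nz by (intro continuous_intros continuous_on_subset[OF cont_det box_sub]) auto
    show "\<bar>1 / \<bar>det (J s)\<bar>\<bar> \<le> 1 / c" if "s \<in> box 0 1" for s
      using assms(2) assms(3)[OF that] by (simp add: frac_le)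
  qed auto
  moreover have "\<bar>det (J s)\<bar> * f (\<Phi> s) * (1 / \<bar>det (J s)\<bar>) = f (\<Phi> s)" if "s \<in> box 0 1" for s
    using det_nz[OF that] by simp
  ultimately show ?thesis
    using set_integrable_cong[OF refl refl, of "box 0 1" "\<lambda>s. \<bar>det (J s)\<bar> * f (\<Phi> s) * (1 / \<bar>det (J s)\<bar>)" "\<lambda>s. f (\<Phi> s)" lebesgue]
    by blast
qed

lemma mult_continuous_absolutely_integrable:
  fixes f b :: "real^2 \<Rightarrow> real"
  assumes "f absolutely_integrable_on box 0 1" "continuous_on (cbox 0 1) b"
  shows "(\<lambda>s. f s * b s) absolutely_integrable_on box 0 1"
proof -
  have "compact (b ` cbox 0 1)" using assms(2) by (intro compact_continuous_image) auto
  then obtain B where "\<And>s. s \<in> cbox 0 1 \<Longrightarrow> \<bar>b s\<bar> \<le> B"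
    using compact_imp_bounded bounded_iff by (metis image_eqI real_norm_def)
  then show ?thesis
    using assms box_sub by (intro absolutely_integrable_mult_bounded) (auto intro: continuous_on_subset)
qed

lemma continuous_absolutely_integrable:
  fixes b :: "real^2 \<Rightarrow> real"
  assumes "continuous_on (cbox 0 1) b"
  shows "b absolutely_integrable_on box 0 1"
  using set_integrable_subset[OF absolutely_integrable_continuous[OF assms] _ box_sub] by simp

text \<open>On the patch u o \<Phi> equals w, whose derivative is classical. Testing the weak chain
  rule against all bumps identifies the two derivatives almost everywhere, which determines the weak
  gradient of u through its products with the columns of J.\<close>

lemma pullback_gradient:
  fixes gu :: "real^2 \<Rightarrow> real^2" and w r :: "real^2 \<Rightarrow> real"
  assumes \<Omega>: "open \<Omega>" "\<Phi> ` box 0 1 \<subseteq> \<Omega>"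
    and u: "u absolutely_integrable_on \<Omega>" and gu: "\<And>k. (\<lambda>x. gu x $ k) absolutely_integrable_on \<Omega>"
    and weak: "has_weak_gradient \<Omega> u gu"
    and c: "0 < c" "\<And>s. s \<in> box 0 1 \<Longrightarrow> c \<le> \<bar>det (J s)\<bar>"
    and uw: "negligible {s \<in> box 0 1. u (\<Phi> s) \<noteq> w s}"
    and w: "continuous_on UNIV w" "continuous_on UNIV r"
    and dw: "\<And>s. ((\<lambda>t. w (s + t *\<^sub>R axis i 1)) has_real_derivative r s) (at 0)"
  shows "negligible {s \<in> box 0 1. J s $ 1 $ i * gu (\<Phi> s) $ 1 + J s $ 2 $ i * gu (\<Phi> s) $ 2 \<noteq> r s}"
proof -
  let ?U = "box 0 1 :: (real^2) set"
  have sub: "f absolutely_integrable_on \<Phi> ` ?U" if "f absolutely_integrable_on \<Omega>" for f :: "real^2 \<Rightarrow> real"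
    using set_integrable_subset[OF that _ \<Omega>(2)] open_image by simp
  have gk: "(\<lambda>s. gu (\<Phi> s) $ k * J s $ k $ i) absolutely_integrable_on ?U" for k
    by (intro mult_continuous_absolutely_integrable cont_entry
        comp_absolutely_integrable[OF sub[OF gu] c])
  define D where "D s = gu (\<Phi> s) $ 1 * J s $ 1 $ i + gu (\<Phi> s) $ 2 * J s $ 2 $ i - r s" for s
  have Dint: "D absolutely_integrable_on ?U"
    unfolding D_def using w(2)
    by (intro set_integral_add(1) set_integral_diff(1) gk continuous_absolutely_integrable)
      (auto intro: continuous_on_subset)
  have "negligible {s \<in> ?U. D s \<noteq> 0}"
  proof (rule fundamental_lemma[OF _ Dint])
    fix n :: real and a b assume n: "0 < n" and ab: "cbox a b \<subseteq> ?U"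
    let ?\<psi> = "bump n a b" and ?\<psi>' = "\<lambda>s. frechet_derivative (bump n a b) (at s) (axis i 1)"
    note \<psi> = elem_smooth_bump[of n a b] and \<psi>' = elem_smooth_partial(2)[OF elem_smooth_bump[of n a b], of i]
    show "integral ?U (\<lambda>s. D s * ?\<psi> s) = 0"
    proof (cases "cbox a b = {}")
      case True
      then have "?\<psi> s = 0" for s using bump_nonzero[OF n, of a b s] box_subset_cbox[of a b] by auto
      then show ?thesis by simp
    next
      case False
      obtain \<delta> where \<delta>: "0 < \<delta>" "cbox a b \<subseteq> cbox (pt \<delta> \<delta>) (pt (1 - \<delta>) (1 - \<delta>))"
        using box_01_inner[OF ab False] by blast
      have z: "?\<psi> s = 0" if "s \<notin> cbox a b" for s
        using bump_nonzero[OF n, of a b s] box_subset_cbox[of a b] that by blast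
      have supp: "?\<psi> s = 0 \<and> ?\<psi>' s = 0" if "s \<notin> cbox (pt \<delta> \<delta>) (pt (1 - \<delta>) (1 - \<delta>))" for s
      proof -
        \<comment> \<open>The complement of the box is open and the bump is 0 on it, so the
          derivative vanishes there as well.\<close>
        have s: "s \<in> - cbox a b" using that \<delta>(2) by blast
        have "((\<lambda>x. 0) has_derivative (\<lambda>h. 0)) (at s)" by simp
        then have "(?\<psi> has_derivative (\<lambda>h. 0)) (at s)"
          by (rule has_derivative_transform_within_open[OF _ _ s]) (use z in auto)
        then have "frechet_derivative ?\<psi> (at s) = (\<lambda>h. 0)" by (rule frechet_derivative_at[symmetric])
        then show ?thesis using z s by simp
      qed
      have supp': "?\<psi> s = 0" if "s \<notin> box 0 1" for s using that ab z by blast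
      have d\<psi>: "((\<lambda>t. ?\<psi> (s + t *\<^sub>R axis i 1)) has_real_derivative ?\<psi>' s) (at 0)" for s
      proof -
        have "(?\<psi> has_derivative frechet_derivative ?\<psi> (at s)) (at (s + 0 *\<^sub>R axis i 1))"
          using elem_smooth_partial(1)[OF \<psi>] by (simp add: frechet_derivative_works)
        moreover have "((\<lambda>t. s + t *\<^sub>R axis i 1) has_derivative (\<lambda>h. h *\<^sub>R axis i 1)) (at 0)"
          by (auto intro!: derivative_eq_intros)
        ultimately have d: "((\<lambda>t. ?\<psi> (s + t *\<^sub>R axis i 1)) has_derivative
            (\<lambda>h. frechet_derivative ?\<psi> (at s) (h *\<^sub>R axis i 1))) (at 0)"
          by (rule has_derivative_compose[rotated])
        have "frechet_derivative ?\<psi> (at s) (h *\<^sub>R axis i 1) = ?\<psi>' s * h" for h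
          using linear_scale[OF linear_frechet_derivative[OF elem_smooth_partial(1)[OF \<psi>]]] by simp
        then show ?thesis using d by (simp add: has_field_derivative_def)
      qed
      note c\<psi> = elem_smooth_continuous[OF \<psi>] and c\<psi>' = elem_smooth_continuous[OF \<psi>']
      have "integral ?U (\<lambda>s. ?\<psi>' s * u (\<Phi> s))
        = - integral ?U (\<lambda>s. ?\<psi> s * J s $ 1 $ i * gu (\<Phi> s) $ 1)
          - integral ?U (\<lambda>s. ?\<psi> s * J s $ 2 $ i * gu (\<Phi> s) $ 2)"
        by (rule weak_pullback[OF \<Omega> u gu weak c\<psi> c\<psi>' d\<psi> \<delta>(1) supp])
      moreover have "integral ?U (\<lambda>s. ?\<psi>' s * u (\<Phi> s)) = integral ?U (\<lambda>s. ?\<psi>' s * w s)"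
        by (rule integral_ae_eq) (rule negligible_subset[OF uw], auto)
      moreover have "integral ?U (\<lambda>s. ?\<psi>' s * w s) = - integral ?U (\<lambda>s. ?\<psi> s * r s)"
        using square_parts[OF c\<psi> c\<psi>' d\<psi> w dw supp'] by (simp add: integral_open_interval)
      moreover have "integral ?U (\<lambda>s. D s * ?\<psi> s) = integral ?U (\<lambda>s. ?\<psi> s * J s $ 1 $ i * gu (\<Phi> s) $ 1)
          + integral ?U (\<lambda>s. ?\<psi> s * J s $ 2 $ i * gu (\<Phi> s) $ 2) - integral ?U (\<lambda>s. ?\<psi> s * r s)"
      proof -
        have 1: "(\<lambda>s. ?\<psi> s * J s $ k $ i * gu (\<Phi> s) $ k) integrable_on ?U" for k
          using mult_continuous_absolutely_integrable[OF gk[of k] c\<psi>]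
          by (simp add: absolutely_integrable_on_def ac_simps)
        have 2: "(\<lambda>s. ?\<psi> s * r s) integrable_on ?U"
          using continuous_absolutely_integrable[OF continuous_on_mult[OF c\<psi> continuous_on_subset[OF w(2) subset_UNIV]]]
          by (simp add: absolutely_integrable_on_def)
        have "(\<lambda>s. D s * ?\<psi> s) = (\<lambda>s. ?\<psi> s * J s $ 1 $ i * gu (\<Phi> s) $ 1 + ?\<psi> s * J s $ 2 $ i * gu (\<Phi> s) $ 2 - ?\<psi> s * r s)"
          by (simp add: D_def fun_eq_iff algebra_simps)
        then show ?thesis by (simp only: integral_diff[OF integrable_add[OF 1 1] 2] integral_add[OF 1 1])
      qed
      ultimately show ?thesis by simp
    qed
  qed auto
  then show ?thesis by (rule negligible_subset) (auto simp: D_def algebra_simps)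
qed

text \<open>The product with the cutoff function is the test function; the terms with its derivative
  and with the weak gradient of \<open>v\<close> are absorbed by AM-GM.\<close>

lemma partial_estimate:
  fixes u v :: "real^2 \<Rightarrow> real" and gv :: "real^2 \<Rightarrow> real^2"
  assumes \<Omega>: "open \<Omega>" "\<Phi> ` box 0 1 \<subseteq> \<Omega>"
    and v: "v absolutely_integrable_on \<Omega>" and gv: "\<And>k. (\<lambda>x. gv x $ k) absolutely_integrable_on \<Omega>"
    and weak: "has_weak_gradient \<Omega> v gv"
    and u: "u absolutely_integrable_on \<Omega>"
    and uv2: "(\<lambda>x. (u x - v x)\<^sup>2) absolutely_integrable_on \<Omega>"
    and gv2: "(\<lambda>x. (norm (gv x))\<^sup>2) absolutely_integrable_on \<Omega>"
    and c: "0 < c" "\<And>s. s \<in> box 0 1 \<Longrightarrow> c \<le> \<bar>det (J s)\<bar>"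
    and w: "bipoly n n w" and uw: "negligible {s \<in> box 0 1. u (\<Phi> s) \<noteq> w (s $ 1) (s $ 2)}"
    and r: "bipoly n n r"
    and dw: "\<And>s. ((\<lambda>t. w ((s + t *\<^sub>R axis i 1) $ 1) ((s + t *\<^sub>R axis i 1) $ 2))
      has_real_derivative r (s $ 1) (s $ 2)) (at 0)"
  shows "integral (box 0 1) (\<lambda>s :: real^2. (r (s $ 1) (s $ 2))\<^sup>2)
    \<le> 96000 * real (n + 1) ^ 4 * integral (box 0 1) (\<lambda>s. (u (\<Phi> s) - v (\<Phi> s))\<^sup>2)
      + 32 * integral (box 0 1) (\<lambda>s. (norm (gv (\<Phi> s)))\<^sup>2 * ((J s $ 1 $ i)\<^sup>2 + (J s $ 2 $ i)\<^sup>2))"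
proof -
  let ?U = "box 0 1 :: (real^2) set"
  let ?r = "\<lambda>s :: real^2. r (s $ 1) (s $ 2)" and ?w = "\<lambda>s :: real^2. w (s $ 1) (s $ 2)"
  let ?P = "\<lambda>s. u (\<Phi> s) - v (\<Phi> s)"
  let ?E = "\<lambda>s. J s $ 1 $ i * gv (\<Phi> s) $ 1 + J s $ 2 $ i * gv (\<Phi> s) $ 2"
  let ?G = "\<lambda>s. (norm (gv (\<Phi> s)))\<^sup>2 * ((J s $ 1 $ i)\<^sup>2 + (J s $ 2 $ i)\<^sup>2)"
  obtain \<delta> and \<psi> \<psi>' :: "real^2 \<Rightarrow> real" where \<delta>: "0 < \<delta>" "\<delta> < 1/2"
    and \<psi>: "continuous_on UNIV \<psi>" "continuous_on UNIV \<psi>'"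
    and d\<psi>: "\<And>s. ((\<lambda>t. \<psi> (s + t *\<^sub>R axis i 1)) has_real_derivative \<psi>' s) (at 0)"
    and supp: "\<And>s. s \<notin> cbox (pt \<delta> \<delta>) (pt (1 - \<delta>) (1 - \<delta>)) \<Longrightarrow> \<psi> s = 0 \<and> \<psi>' s = 0"
    and \<psi>_le: "\<And>s. (\<psi> s)\<^sup>2 \<le> (?r s)\<^sup>2"
    and \<psi>_low: "integral (cbox 0 1) (\<lambda>s. (?r s)\<^sup>2) \<le> 4 * integral (cbox 0 1) (\<lambda>s. \<psi> s * ?r s)"
    and \<psi>'_up: "integral (cbox 0 1) (\<lambda>s. (\<psi>' s)\<^sup>2) \<le> 3000 * real (n + 1) ^ 4 * integral (cbox 0 1) (\<lambda>s. (?r s)\<^sup>2)"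
    by (rule square_cutoff[OF r, of i]) (rule that; assumption)
  have DU: "cbox (pt \<delta> \<delta>) (pt (1 - \<delta>) (1 - \<delta>)) \<subseteq> ?U" using \<delta> by (auto simp: mem_cbox_2 mem_box_2)
  have supp': "\<psi> s = 0" if "s \<notin> box 0 1" for s using that DU supp by blast
  have cr: "continuous_on S ?r" and cw: "continuous_on S ?w" for S
    by (intro bipoly_continuous[OF r] bipoly_continuous[OF w] continuous_intros)+
  have c\<psi>: "continuous_on S \<psi>" "continuous_on S \<psi>'" for S using \<psi> by (auto intro: continuous_on_subset)
  have sub: "f absolutely_integrable_on \<Phi> ` ?U" if "f absolutely_integrable_on \<Omega>" for f :: "real^2 \<Rightarrow> real"
    using set_integrable_subset[OF that _ \<Omega>(2)] open_image by simp
  note pull = comp_absolutely_integrable[OF sub c]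
  have cint: "f integrable_on ?U" if "continuous_on (cbox 0 1) f" for f :: "real^2 \<Rightarrow> real"
    using continuous_absolutely_integrable[OF that] by (simp add: absolutely_integrable_on_def)
  have ux: "(\<lambda>s. \<psi>' s * u (\<Phi> s)) integrable_on ?U"
    using mult_continuous_absolutely_integrable[OF pull[OF u] c\<psi>(2)]
    by (simp add: absolutely_integrable_on_def mult.commute)
  have vx: "(\<lambda>s. \<psi>' s * v (\<Phi> s)) integrable_on ?U"
    using mult_continuous_absolutely_integrable[OF pull[OF v] c\<psi>(2)]
    by (simp add: absolutely_integrable_on_def mult.commute)
  have gx: "(\<lambda>s. \<psi> s * J s $ k $ i * gv (\<Phi> s) $ k) integrable_on ?U" for k
    using mult_continuous_absolutely_integrable[OF pull[OF gv[of k]] continuous_on_mult[OF c\<psi>(1) cont_entry[of k i]]]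
    by (simp add: absolutely_integrable_on_def mult.commute)
  have P2: "(\<lambda>s. (?P s)\<^sup>2) integrable_on ?U"
    using pull[OF uv2] by (simp add: absolutely_integrable_on_def)
  have G: "?G integrable_on ?U"
    using mult_continuous_absolutely_integrable[OF pull[OF gv2], of "\<lambda>s. (J s $ 1 $ i)\<^sup>2 + (J s $ 2 $ i)\<^sup>2"]
    by (simp add: absolutely_integrable_on_def continuous_intros cont_entry)
  define N where "N = real (n + 1) ^ 4"
  have N: "0 < N" by (simp add: N_def)
  define R where "R = integral ?U (\<lambda>s. (?r s)\<^sup>2)"
  \<comment> \<open>Moving the derivative off r leaves w, which may be replaced by u o \<Phi>; u is
    split into (u - v) + v before the weak chain rule is applied to v.\<close>
  have "integral ?U (\<lambda>s. \<psi> s * ?r s) = - integral ?U (\<lambda>s. \<psi>' s * ?w s)"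
    using square_parts[OF \<psi> d\<psi> cw cr dw supp'] by (simp add: integral_open_interval)
  also have "integral ?U (\<lambda>s. \<psi>' s * ?w s) = integral ?U (\<lambda>s. \<psi>' s * u (\<Phi> s))"
    by (rule integral_ae_eq) (rule negligible_subset[OF uw], auto)
  also have "\<dots> = integral ?U (\<lambda>s. \<psi>' s * u (\<Phi> s) - \<psi>' s * v (\<Phi> s)) + integral ?U (\<lambda>s. \<psi>' s * v (\<Phi> s))"
    by (simp add: integral_diff[OF ux vx])
  also have "integral ?U (\<lambda>s. \<psi>' s * v (\<Phi> s)) = - integral ?U (\<lambda>s. \<psi> s * J s $ 1 $ i * gv (\<Phi> s) $ 1)
      - integral ?U (\<lambda>s. \<psi> s * J s $ 2 $ i * gv (\<Phi> s) $ 2)"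
    by (rule weak_pullback[OF \<Omega> v gv weak \<psi> d\<psi> \<delta>(1) supp])
  finally have "integral ?U (\<lambda>s. \<psi> s * ?r s) = integral ?U (\<lambda>s. (\<psi> s * J s $ 1 $ i * gv (\<Phi> s) $ 1
      + \<psi> s * J s $ 2 $ i * gv (\<Phi> s) $ 2) - (\<psi>' s * u (\<Phi> s) - \<psi>' s * v (\<Phi> s)))"
    by (simp add: integral_diff[OF integrable_add[OF gx gx] integrable_diff[OF ux vx]] integral_add[OF gx gx])
  \<comment> \<open>The weights are set for absorption: \<psi> and its derivative each return R /
    16, so R <= 4 (R / 8 + ...) keeps half of R on the left, and twice 4 * 4 and 4 * 12000 N give 32
    and 96000 N.\<close>
  also have "\<dots> \<le> integral ?U (\<lambda>s. ((1/16) * (?r s)\<^sup>2 + 4 * ?G s) + (1 / (48000 * N) * (\<psi>' s)\<^sup>2 + 12000 * N * (?P s)\<^sup>2))"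
  proof (rule integral_le)
    fix s
    have "\<psi> s * ?E s \<le> (1/16) * (\<psi> s)\<^sup>2 + 4 * (?E s)\<^sup>2"
      using zero_le_power2[of "\<psi> s / 4 - 2 * ?E s"] by (simp add: power2_eq_square algebra_simps)
    moreover have "(?E s)\<^sup>2 \<le> ?G s"
    proof -
      \<comment> \<open>Lagrange's identity: the defect in the Cauchy-Schwarz inequality is a
        squared 2 x 2 determinant.\<close>
      have "?G s - (?E s)\<^sup>2 = (J s $ 1 $ i * gv (\<Phi> s) $ 2 - J s $ 2 $ i * gv (\<Phi> s) $ 1)\<^sup>2"
        unfolding norm_sq_2 by (simp add: power2_eq_square algebra_simps)
      then show ?thesis by (metis diff_ge_0_iff_ge zero_le_power2)
    qed
    moreover have "- (\<psi>' s * ?P s) \<le> 1 / (48000 * N) * (\<psi>' s)\<^sup>2 + 12000 * N * (?P s)\<^sup>2"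
    proof -
      have "0 \<le> 1 / (48000 * N) * (\<psi>' s + 24000 * N * ?P s)\<^sup>2" using N by simp
      also have "\<dots> = 1 / (48000 * N) * (\<psi>' s)\<^sup>2 + 12000 * N * (?P s)\<^sup>2 + \<psi>' s * ?P s"
        using N by (simp add: power2_eq_square field_simps)
      finally show ?thesis by simp
    qed
    ultimately have "\<psi> s * ?E s - \<psi>' s * ?P s
      \<le> ((1/16) * (?r s)\<^sup>2 + 4 * ?G s) + (1 / (48000 * N) * (\<psi>' s)\<^sup>2 + 12000 * N * (?P s)\<^sup>2)"
      using \<psi>_le[of s] by linarith
    then show "(\<psi> s * J s $ 1 $ i * gv (\<Phi> s) $ 1 + \<psi> s * J s $ 2 $ i * gv (\<Phi> s) $ 2)
        - (\<psi>' s * u (\<Phi> s) - \<psi>' s * v (\<Phi> s))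
      \<le> ((1/16) * (?r s)\<^sup>2 + 4 * ?G s) + (1 / (48000 * N) * (\<psi>' s)\<^sup>2 + 12000 * N * (?P s)\<^sup>2)"
      by (simp only: right_diff_distrib distrib_left mult.assoc)
  qed (intro integrable_diff integrable_add integrable_on_mult_right gx ux vx P2 G cint continuous_intros cr c\<psi>)+
  also have "\<dots> = (1/16) * R + 4 * integral ?U ?G + (1 / (48000 * N) * integral ?U (\<lambda>s. (\<psi>' s)\<^sup>2)
      + 12000 * N * integral ?U (\<lambda>s. (?P s)\<^sup>2))"
  proof -
    have 1: "(\<lambda>s. (1/16) * (?r s)\<^sup>2) integrable_on ?U" "(\<lambda>s. 1 / (48000 * N) * (\<psi>' s)\<^sup>2) integrable_on ?U"
      by (intro cint continuous_intros cr c\<psi>)+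
    have 2: "(\<lambda>s. 4 * ?G s) integrable_on ?U" "(\<lambda>s. 12000 * N * (?P s)\<^sup>2) integrable_on ?U"
      by (intro integrable_on_mult_right G P2)+
    show ?thesis
      unfolding integral_add[OF integrable_add[OF 1(1) 2(1)] integrable_add[OF 1(2) 2(2)]]
        integral_add[OF 1(1) 2(1)] integral_add[OF 1(2) 2(2)] integral_mult_right R_def ..
  qed
  also have "1 / (48000 * N) * integral ?U (\<lambda>s. (\<psi>' s)\<^sup>2) \<le> 1 / (48000 * N) * (3000 * N * R)"
    using N \<psi>'_up by (intro mult_left_mono) (auto simp: N_def R_def integral_open_interval)
  also have "1 / (48000 * N) * (3000 * N * R) = (1/16) * R" using N by simp
  finally have "integral ?U (\<lambda>s. \<psi> s * ?r s)
      \<le> (1/16) * R + 4 * integral ?U ?G + ((1/16) * R + 12000 * N * integral ?U (\<lambda>s. (?P s)\<^sup>2))" by simp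
  moreover have "R \<le> 4 * integral ?U (\<lambda>s. \<psi> s * ?r s)"
    using \<psi>_low by (simp add: R_def integral_open_interval)
  ultimately have "R \<le> 96000 * N * integral ?U (\<lambda>s. (?P s)\<^sup>2) + 32 * integral ?U ?G" by linarith
  then show ?thesis by (simp add: R_def N_def)
qed

end

text \<open>The adjugate recovers det J times (g1, g2) from the products of this vector with the
  columns of J, and its Frobenius norm is that of J; the defect is again a sum of squares.\<close>

lemma det_adjugate_bound:
  fixes J11 J12 J21 J22 g1 g2 :: real
  shows "(J11 * J22 - J12 * J21)\<^sup>2 * (g1\<^sup>2 + g2\<^sup>2)
    \<le> (J11\<^sup>2 + J12\<^sup>2 + J21\<^sup>2 + J22\<^sup>2) * ((J11 * g1 + J21 * g2)\<^sup>2 + (J12 * g1 + J22 * g2)\<^sup>2)"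
proof -
  define D1 where "D1 = J11 * g1 + J21 * g2"
  define D2 where "D2 = J12 * g1 + J22 * g2"
  have "(J11 * J22 - J12 * J21) * g1 = D1 * J22 - D2 * J21" "(J11 * J22 - J12 * J21) * g2 = D2 * J11 - D1 * J12"
    by (simp_all add: D1_def D2_def algebra_simps)
  then have "(J11 * J22 - J12 * J21)\<^sup>2 * (g1\<^sup>2 + g2\<^sup>2) = (D1 * J22 - D2 * J21)\<^sup>2 + (D2 * J11 - D1 * J12)\<^sup>2"
    by (simp only: distrib_left power_mult_distrib[symmetric])
  moreover have "(J11\<^sup>2 + J12\<^sup>2 + J21\<^sup>2 + J22\<^sup>2) * (D1\<^sup>2 + D2\<^sup>2)
      - ((D1 * J22 - D2 * J21)\<^sup>2 + (D2 * J11 - D1 * J12)\<^sup>2)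
    = (D1 * J21 + D2 * J22)\<^sup>2 + (D1 * J11 + D2 * J12)\<^sup>2"
    by (simp add: power2_eq_square algebra_simps)
  moreover have "0 \<le> (D1 * J21 + D2 * J22)\<^sup>2 + (D1 * J11 + D2 * J12)\<^sup>2" by simp
  ultimately show ?thesis unfolding D1_def D2_def by linarith
qed

text \<open>The squared Frobenius norm, equal to the trace of the Gramian.\<close>

definition frob :: "real^2^2 \<Rightarrow> real" where
  "frob A = (A $ 1 $ 1)\<^sup>2 + (A $ 1 $ 2)\<^sup>2 + (A $ 2 $ 1)\<^sup>2 + (A $ 2 $ 2)\<^sup>2"

text \<open>c and d both have the scaling of an area, so d / c is scale-free and the remaining 1 / c
  carries h^-2. The two directions double 96000 to 192000, while the column norms of J add up to
  \<open>frob J\<close> and leave 32 unchanged.\<close>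

lemma (in patch) patch_estimate:
  fixes u v :: "real^2 \<Rightarrow> real" and gu gv :: "real^2 \<Rightarrow> real^2"
  assumes \<Omega>: "open \<Omega>" "\<Phi> ` box 0 1 \<subseteq> \<Omega>"
    and u: "u absolutely_integrable_on \<Omega>" and gu: "\<And>k. (\<lambda>x. gu x $ k) absolutely_integrable_on \<Omega>"
    and weak_u: "has_weak_gradient \<Omega> u gu"
    and v: "v absolutely_integrable_on \<Omega>" and gv: "\<And>k. (\<lambda>x. gv x $ k) absolutely_integrable_on \<Omega>"
    and weak_v: "has_weak_gradient \<Omega> v gv"
    and uv2: "(\<lambda>x. (u x - v x)\<^sup>2) absolutely_integrable_on \<Omega>"
    and gu2: "(\<lambda>x. (norm (gu x))\<^sup>2) absolutely_integrable_on \<Omega>"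
    and gv2: "(\<lambda>x. (norm (gv x))\<^sup>2) absolutely_integrable_on \<Omega>"
    and w: "bipoly n n w" and uw: "negligible {s \<in> box 0 1. u (\<Phi> s) \<noteq> w (s $ 1) (s $ 2)}"
    and c: "0 < c" "\<And>s. s \<in> box 0 1 \<Longrightarrow> c \<le> \<bar>det (J s)\<bar>"
    and d: "\<And>s. s \<in> box 0 1 \<Longrightarrow> frob (J s) \<le> d"
  shows "integral (\<Phi> ` box 0 1) (\<lambda>x. (norm (gu x))\<^sup>2)
    \<le> d / c * (192000 * real (n + 1) ^ 4 / c * integral (\<Phi> ` box 0 1) (\<lambda>x. (u x - v x)\<^sup>2)
      + 32 * (d / c) * integral (\<Phi> ` box 0 1) (\<lambda>x. (norm (gv x))\<^sup>2))"
proof -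
  let ?U = "box 0 1 :: (real^2) set"
  have d0: "0 \<le> d"
  proof -
    have "pt (1/2) (1/2) \<in> ?U" by (simp add: mem_box_2)
    from d[OF this] show ?thesis unfolding frob_def by (smt (verit) zero_le_power2)
  qed
  have sub: "f absolutely_integrable_on \<Phi> ` ?U" if "f absolutely_integrable_on \<Omega>" for f :: "real^2 \<Rightarrow> real"
    using set_integrable_subset[OF that _ \<Omega>(2)] open_image by simp
  have tr: "(\<lambda>s. \<bar>det (J s)\<bar> * f (\<Phi> s)) integrable_on ?U"
    "integral (\<Phi> ` ?U) f = integral ?U (\<lambda>s. \<bar>det (J s)\<bar> * f (\<Phi> s))"
    if "f absolutely_integrable_on \<Omega>" for f :: "real^2 \<Rightarrow> real"
    using transform[of f] sub[OF that] by (auto simp: absolutely_integrable_on_def)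
  obtain r1 where r1: "bipoly n n r1" "\<And>s :: real^2. ((\<lambda>t. w ((s + t *\<^sub>R axis 1 1) $ 1) ((s + t *\<^sub>R axis 1 1) $ 2))
    has_real_derivative r1 (s $ 1) (s $ 2)) (at 0)"
    using bipoly_partial[OF w, of 1] by blast
  obtain r2 where r2: "bipoly n n r2" "\<And>s :: real^2. ((\<lambda>t. w ((s + t *\<^sub>R axis 2 1) $ 1) ((s + t *\<^sub>R axis 2 1) $ 2))
    has_real_derivative r2 (s $ 1) (s $ 2)) (at 0)"
    using bipoly_partial[OF w, of 2] by blast
  have cw: "continuous_on UNIV (\<lambda>s :: real^2. w (s $ 1) (s $ 2))"
    and c1: "continuous_on S (\<lambda>s :: real^2. r1 (s $ 1) (s $ 2))"
    and c2: "continuous_on S (\<lambda>s :: real^2. r2 (s $ 1) (s $ 2))" for S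
    by (intro bipoly_continuous[OF w] bipoly_continuous[OF r1(1)] bipoly_continuous[OF r2(1)] continuous_intros)+
  define R where "R s = (r1 (s $ 1) (s $ 2))\<^sup>2 + (r2 (s $ 1) (s $ 2))\<^sup>2" for s :: "real^2"
  define D where "D i s = J s $ 1 $ i * gu (\<Phi> s) $ 1 + J s $ 2 $ i * gu (\<Phi> s) $ 2" for i s
  let ?N = "{s \<in> ?U. D 1 s \<noteq> r1 (s $ 1) (s $ 2)} \<union> {s \<in> ?U. D 2 s \<noteq> r2 (s $ 1) (s $ 2)}"
  have N: "negligible ?N"
    using pullback_gradient[OF \<Omega> u gu weak_u c uw cw c1 r1(2)] pullback_gradient[OF \<Omega> u gu weak_u c uw cw c2 r2(2)]
    unfolding D_def by (intro negligible_Un)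
  have ri: "(\<lambda>s :: real^2. (r1 (s $ 1) (s $ 2))\<^sup>2) integrable_on ?U" "(\<lambda>s :: real^2. (r2 (s $ 1) (s $ 2))\<^sup>2) integrable_on ?U"
    using continuous_absolutely_integrable[OF continuous_on_power[OF c1]]
      continuous_absolutely_integrable[OF continuous_on_power[OF c2]]
    by (auto simp: absolutely_integrable_on_def)
  then have Ri: "R integrable_on ?U" unfolding R_def by (rule integrable_add)
  have Di: "(\<lambda>s. (D 1 s)\<^sup>2 + (D 2 s)\<^sup>2) integrable_on ?U"
    by (rule integrable_spike[OF Ri N]) (auto simp: R_def)
  have Deq: "integral ?U (\<lambda>s. (D 1 s)\<^sup>2 + (D 2 s)\<^sup>2) = integral ?U R"
    by (rule integral_spike[OF N]) (auto simp: R_def)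
  have "integral (\<Phi> ` ?U) (\<lambda>x. (norm (gu x))\<^sup>2) = integral ?U (\<lambda>s. \<bar>det (J s)\<bar> * (norm (gu (\<Phi> s)))\<^sup>2)"
    by (rule tr(2)[OF gu2])
  also have "\<dots> \<le> integral ?U (\<lambda>s. d / c * ((D 1 s)\<^sup>2 + (D 2 s)\<^sup>2))"
  proof (rule integral_le)
    fix s assume s: "s \<in> ?U"
    have "c * (\<bar>det (J s)\<bar> * (norm (gu (\<Phi> s)))\<^sup>2) \<le> \<bar>det (J s)\<bar> * (\<bar>det (J s)\<bar> * (norm (gu (\<Phi> s)))\<^sup>2)"
      using c(2)[OF s] by (rule mult_right_mono) simp
    also have "\<dots> = (det (J s))\<^sup>2 * ((gu (\<Phi> s) $ 1)\<^sup>2 + (gu (\<Phi> s) $ 2)\<^sup>2)"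
      unfolding norm_sq_2[symmetric] mult.assoc[symmetric] abs_mult_self_eq by (simp add: power2_eq_square)
    also have "\<dots> \<le> frob (J s) * ((D 1 s)\<^sup>2 + (D 2 s)\<^sup>2)"
      unfolding D_def frob_def det_2 by (rule det_adjugate_bound)
    also have "\<dots> \<le> d * ((D 1 s)\<^sup>2 + (D 2 s)\<^sup>2)"
      using d[OF s] by (rule mult_right_mono) simp
    finally show "\<bar>det (J s)\<bar> * (norm (gu (\<Phi> s)))\<^sup>2 \<le> d / c * ((D 1 s)\<^sup>2 + (D 2 s)\<^sup>2)"
      using c(1) by (simp add: field_simps)
  qed (intro tr(1) gu2 integrable_on_mult_right Di)+
  also have "\<dots> = d / c * (integral ?U (\<lambda>s :: real^2. (r1 (s $ 1) (s $ 2))\<^sup>2) + integral ?U (\<lambda>s :: real^2. (r2 (s $ 1) (s $ 2))\<^sup>2))"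
    unfolding integral_mult_right Deq R_def integral_add[OF ri] ..
  also have "\<dots> \<le> d / c * (192000 * real (n + 1) ^ 4 / c * integral (\<Phi> ` ?U) (\<lambda>x. (u x - v x)\<^sup>2)
      + 32 * (d / c) * integral (\<Phi> ` ?U) (\<lambda>x. (norm (gv x))\<^sup>2))"
  proof (rule mult_left_mono)
    let ?P = "integral ?U (\<lambda>s. (u (\<Phi> s) - v (\<Phi> s))\<^sup>2)"
    let ?G = "\<lambda>i s. (norm (gv (\<Phi> s)))\<^sup>2 * ((J s $ 1 $ i)\<^sup>2 + (J s $ 2 $ i)\<^sup>2)"
    have Pi: "(\<lambda>s. (u (\<Phi> s) - v (\<Phi> s))\<^sup>2) integrable_on ?U"
      using comp_absolutely_integrable[OF sub[OF uv2] c] by (simp add: absolutely_integrable_on_def)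
    have Gi: "?G i integrable_on ?U" for i
      using mult_continuous_absolutely_integrable[OF comp_absolutely_integrable[OF sub[OF gv2] c], of "\<lambda>s. (J s $ 1 $ i)\<^sup>2 + (J s $ 2 $ i)\<^sup>2"]
      by (simp add: absolutely_integrable_on_def continuous_intros cont_entry)
    have "?P \<le> integral ?U (\<lambda>s. 1 / c * (\<bar>det (J s)\<bar> * (u (\<Phi> s) - v (\<Phi> s))\<^sup>2))"
    proof (rule integral_le)
      fix s assume s: "s \<in> ?U"
      show "(u (\<Phi> s) - v (\<Phi> s))\<^sup>2 \<le> 1 / c * (\<bar>det (J s)\<bar> * (u (\<Phi> s) - v (\<Phi> s))\<^sup>2)"
        using mult_right_mono[OF c(2)[OF s], of "(u (\<Phi> s) - v (\<Phi> s))\<^sup>2"] c(1) by (simp add: field_simps)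
    qed (intro Pi integrable_on_mult_right tr(1)[OF uv2])+
    also have "\<dots> = 1 / c * integral (\<Phi> ` ?U) (\<lambda>x. (u x - v x)\<^sup>2)"
      unfolding integral_mult_right tr(2)[OF uv2] ..
    finally have P: "192000 * real (n + 1) ^ 4 * ?P \<le> 192000 * real (n + 1) ^ 4 / c * integral (\<Phi> ` ?U) (\<lambda>x. (u x - v x)\<^sup>2)"
      using mult_left_mono[of ?P _ "192000 * real (n + 1) ^ 4"] by fastforce
    have "integral ?U (?G 1) + integral ?U (?G 2) = integral ?U (\<lambda>s. ?G 1 s + ?G 2 s)"
      by (rule integral_add[OF Gi Gi, symmetric])
    also have "\<dots> \<le> integral ?U (\<lambda>s. d / c * (\<bar>det (J s)\<bar> * (norm (gv (\<Phi> s)))\<^sup>2))"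
    proof (rule integral_le)
      fix s assume s: "s \<in> ?U"
      have "?G 1 s + ?G 2 s = (norm (gv (\<Phi> s)))\<^sup>2 * frob (J s)" by (simp add: frob_def algebra_simps)
      also have "\<dots> \<le> (norm (gv (\<Phi> s)))\<^sup>2 * d" using d[OF s] by (rule mult_left_mono) simp
      also have "\<dots> \<le> d / c * (\<bar>det (J s)\<bar> * (norm (gv (\<Phi> s)))\<^sup>2)"
        using mult_right_mono[OF c(2)[OF s], of "d * (norm (gv (\<Phi> s)))\<^sup>2"] c(1) d0 by (simp add: field_simps)
      finally show "?G 1 s + ?G 2 s \<le> d / c * (\<bar>det (J s)\<bar> * (norm (gv (\<Phi> s)))\<^sup>2)" .
    qed (intro integrable_add Gi integrable_on_mult_right tr(1)[OF gv2])+
    also have "\<dots> = d / c * integral (\<Phi> ` ?U) (\<lambda>x. (norm (gv x))\<^sup>2)"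
      unfolding integral_mult_right tr(2)[OF gv2] ..
    finally have "integral ?U (?G 1) + integral ?U (?G 2) \<le> d / c * integral (\<Phi> ` ?U) (\<lambda>x. (norm (gv x))\<^sup>2)" .
    then have G: "32 * integral ?U (?G 1) + 32 * integral ?U (?G 2) \<le> 32 * (d / c) * integral (\<Phi> ` ?U) (\<lambda>x. (norm (gv x))\<^sup>2)"
      unfolding mult.assoc by linarith
    note pe = partial_estimate[OF \<Omega> v gv weak_v u uv2 gv2 c w uw]
    show "integral ?U (\<lambda>s :: real^2. (r1 (s $ 1) (s $ 2))\<^sup>2) + integral ?U (\<lambda>s :: real^2. (r2 (s $ 1) (s $ 2))\<^sup>2)
      \<le> 192000 * real (n + 1) ^ 4 / c * integral (\<Phi> ` ?U) (\<lambda>x. (u x - v x)\<^sup>2)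
        + 32 * (d / c) * integral (\<Phi> ` ?U) (\<lambda>x. (norm (gv x))\<^sup>2)"
      using pe[OF _ r1] pe[OF _ r2] P G by simp
  qed (use c d0 in simp)
  finally show ?thesis .
qed

section \<open>Eigenvalues of the Gramian\<close>

lemma symmetric_eigenvalue:
  assumes "(p - l) * (r - l) = q\<^sup>2"
  shows "is_eigenvalue (vector [vector [p, q], vector [q, r]]) l"
\<comment> \<open>The hypothesis is the characteristic equation. (q, l - p) is an eigenvector unless
  it is 0, and then the matrix is diagonal and the first axis serves.\<close>
proof (cases "q = 0 \<and> l = p")
  case True
  then show ?thesis unfolding is_eigenvalue_def
    by (intro exI[of _ "pt 1 0"]) (auto simp: vec_eq_iff forall_2 matrix_vector_mult_def sum_2)
next
  case False
  show ?thesis unfolding is_eigenvalue_def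
  proof (intro exI[of _ "pt q (l - p)"] conjI)
    show "pt q (l - p) \<noteq> 0" using False by (auto simp: vec_eq_iff forall_2)
    show "vector [vector [p, q], vector [q, r]] *v pt q (l - p) = l *\<^sub>R pt q (l - p)"
      using assms by (simp add: vec_eq_iff forall_2 matrix_vector_mult_def sum_2 power2_eq_square algebra_simps)
  qed
qed

text \<open>The eigenvalues m + s and m - s are explicit; their sum is the trace
  \<open>frob J\<close> and their product is (det J)^2.\<close>

lemma gramian_eigenvalue_bounds:
  fixes J :: "real^2^2"
  assumes ev: "\<And>l. is_eigenvalue (transpose J ** J) l \<Longrightarrow> a \<le> l \<and> l \<le> b" and a: "0 < a"
  shows "frob J \<le> 2 * b" "a \<le> \<bar>det J\<bar>"
proof -
  define p where "p = (J $ 1 $ 1)\<^sup>2 + (J $ 2 $ 1)\<^sup>2"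
  define q where "q = J $ 1 $ 1 * J $ 1 $ 2 + J $ 2 $ 1 * J $ 2 $ 2"
  define r where "r = (J $ 1 $ 2)\<^sup>2 + (J $ 2 $ 2)\<^sup>2"
  have G: "transpose J ** J = vector [vector [p, q], vector [q, r]]"
    by (simp add: vec_eq_iff forall_2 matrix_matrix_mult_def sum_2 transpose_def p_def q_def r_def power2_eq_square mult.commute)
  define m where "m = (p + r) / 2"
  define s where "s = sqrt (((p - r) / 2)\<^sup>2 + q\<^sup>2)"
  have s2: "s\<^sup>2 = ((p - r) / 2)\<^sup>2 + q\<^sup>2" by (simp add: s_def)
  have "(p - (m + s)) * (r - (m + s)) = q\<^sup>2" "(p - (m - s)) * (r - (m - s)) = q\<^sup>2"
    using s2 by (simp_all add: m_def power2_eq_square field_simps)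
  then have e: "a \<le> m + s" "m + s \<le> b" "a \<le> m - s" "m - s \<le> b"
    using ev[unfolded G, OF symmetric_eigenvalue] by blast+
  have "frob J = 2 * m" by (simp add: frob_def p_def r_def m_def)
  then show "frob J \<le> 2 * b" using e by linarith
  have "a * a \<le> (m + s) * (m - s)" using e a by (intro mult_mono) auto
  also have "\<dots> = p * r - q\<^sup>2" using s2 by (simp add: m_def power2_eq_square field_simps)
  also have "\<dots> = (det J)\<^sup>2" by (simp add: det_2 p_def q_def r_def power2_eq_square algebra_simps)
  finally have "a\<^sup>2 \<le> \<bar>det J\<bar>\<^sup>2" by (simp add: power2_eq_square)
  then show "a \<le> \<bar>det J\<bar>" by (rule power2_le_imp_le) simp
qed

section \<open>Elements\<close>

text \<open>The data shared by all elements of a mesh. \<open>gu\<close> and \<open>gv\<close> are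
  any weak gradients, so that v = 0 can be paired with the zero field.\<close>

locale gradient_pair =
  fixes \<Omega> :: "(real^2) set" and u v :: "real^2 \<Rightarrow> real" and gu gv :: "real^2 \<Rightarrow> real^2"
  assumes open_\<Omega>: "open \<Omega>"
    and u: "u absolutely_integrable_on \<Omega>" and gu: "\<And>k. (\<lambda>x. gu x $ k) absolutely_integrable_on \<Omega>"
    and weak_u: "has_weak_gradient \<Omega> u gu"
    and v: "v absolutely_integrable_on \<Omega>" and gv: "\<And>k. (\<lambda>x. gv x $ k) absolutely_integrable_on \<Omega>"
    and weak_v: "has_weak_gradient \<Omega> v gv"
    and uv2: "(\<lambda>x. (u x - v x)\<^sup>2) absolutely_integrable_on \<Omega>"
    and gu2: "(\<lambda>x. (norm (gu x))\<^sup>2) absolutely_integrable_on \<Omega>"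
    and gv2: "(\<lambda>x. (norm (gv x))\<^sup>2) absolutely_integrable_on \<Omega>"

definition aff :: "real^2 \<Rightarrow> real^2^2 \<Rightarrow> real^2 \<Rightarrow> real^2" where
  "aff a M s = a + M *v s"

text \<open>The constant of \<open>patch_estimate\<close> for c = h^2 |det M| / \<gamma> and d = 2
  \<gamma> h^2 frob(M). Then d / c = 2 \<gamma>^2 frob(M) / |det M|, 64 = 2 * 32, and 3072000 = 16 *
  192000 because p + 1 <= 2 p.\<close>

definition piece_const :: "real \<Rightarrow> real^2^2 \<Rightarrow> real" where
  "piece_const \<gamma> M = 2 * \<gamma>\<^sup>2 * frob M / \<bar>det M\<bar>
    * (3072000 * \<gamma> / \<bar>det M\<bar> + 64 * \<gamma>\<^sup>2 * frob M / \<bar>det M\<bar>)"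

lemma frob_nonneg: "0 \<le> frob A"
  by (simp add: frob_def)

lemma frob_mult: "frob (A ** B) \<le> frob A * frob B"
proof -
  have cs: "(a * c + b * d)\<^sup>2 \<le> (a\<^sup>2 + b\<^sup>2) * (c\<^sup>2 + d\<^sup>2)" for a b c d :: real
    using zero_le_power2[of "a * d - b * c"] by (simp add: power2_eq_square algebra_simps)
  have "frob (A ** B) = (A$1$1 * B$1$1 + A$1$2 * B$2$1)\<^sup>2 + (A$1$1 * B$1$2 + A$1$2 * B$2$2)\<^sup>2
      + (A$2$1 * B$1$1 + A$2$2 * B$2$1)\<^sup>2 + (A$2$1 * B$1$2 + A$2$2 * B$2$2)\<^sup>2"
    by (simp add: frob_def matrix_matrix_mult_def sum_2)
  also have "\<dots> \<le> ((A$1$1)\<^sup>2 + (A$1$2)\<^sup>2) * ((B$1$1)\<^sup>2 + (B$2$1)\<^sup>2) + ((A$1$1)\<^sup>2 + (A$1$2)\<^sup>2) * ((B$1$2)\<^sup>2 + (B$2$2)\<^sup>2)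
      + ((A$2$1)\<^sup>2 + (A$2$2)\<^sup>2) * ((B$1$1)\<^sup>2 + (B$2$1)\<^sup>2) + ((A$2$1)\<^sup>2 + (A$2$2)\<^sup>2) * ((B$1$2)\<^sup>2 + (B$2$2)\<^sup>2)"
    by (intro add_mono cs)
  also have "\<dots> = frob A * frob B" by (simp add: frob_def algebra_simps)
  finally show ?thesis .
qed

lemma aff_deriv: "(aff a M has_derivative (\<lambda>h. M *v h)) (at s within S)"
proof -
  have "((\<lambda>s. a + M *v s) has_derivative (\<lambda>h. 0 + M *v h)) (at s within S)"
    by (intro has_derivative_add has_derivative_const bounded_linear.has_derivative[OF matrix_vector_mul_bounded_linear]
        has_derivative_ident)
  then show ?thesis by (simp add: aff_def[abs_def])
qed

text \<open>The set lies in the image of N under the inverse affine map; this moves statements that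
  hold almost everywhere from the reference element to the unit square.\<close>

lemma negligible_aff_vimage:
  assumes M: "det M \<noteq> 0" and N: "negligible N"
  shows "negligible {s. aff a M s \<in> N}"
proof -
  obtain B where B: "B ** M = mat 1" using M unfolding invertible_det_nz[symmetric] invertible_def by blast
  have "negligible ((\<lambda>y. B *v (y - a)) ` N)"
  proof (rule negligible_differentiable_image_negligible[OF _ N])
    show "(\<lambda>y. B *v (y - a)) differentiable_on N"
    proof -
      have "(\<lambda>y. B *v (y - a)) = aff (- (B *v a)) (B)"
        by (simp add: fun_eq_iff aff_def matrix_vector_mult_diff_distrib)
      then show ?thesis unfolding differentiable_on_def differentiable_def using aff_deriv by metis
    qed
  qed simp
  moreover have "s = B *v (aff a M s - a)" for s
    using B by (simp add: aff_def matrix_vector_mul_assoc)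
  then have "{s. aff a M s \<in> N} \<subseteq> (\<lambda>y. B *v (y - a)) ` N" by blast
  ultimately show ?thesis by (rule negligible_subset)
qed

lemma integral_mono_set:
  fixes f :: "real^2 \<Rightarrow> real"
  assumes "f absolutely_integrable_on T" "S \<subseteq> T" "S \<in> sets lebesgue" "\<And>x. 0 \<le> f x"
  shows "integral S f \<le> integral T f"
  using assms set_integrable_subset[OF assms(1,3,2)]
  by (intro integral_subset_le) (auto simp: absolutely_integrable_on_def)

text \<open>The pieces may overlap: for nonnegative f, points covered several times only enlarge the
  sum.\<close>

lemma integral_cover_le:
  fixes f :: "real^2 \<Rightarrow> real"
  assumes f: "f absolutely_integrable_on T" "\<And>x. 0 \<le> f x" and I: "finite I"
    and S: "\<And>k. k \<in> I \<Longrightarrow> S k \<in> sets lebesgue" "\<And>k. k \<in> I \<Longrightarrow> S k \<subseteq> T" "T \<subseteq> (\<Union>k\<in>I. S k)"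
  shows "integral T f \<le> (\<Sum>k\<in>I. integral (S k) f)"
proof -
  have fk: "f integrable_on S k" if "k \<in> I" for k
    using set_integrable_subset[OF f(1) S(1,2)] that by (simp add: absolutely_integrable_on_def)
  have fT: "f integrable_on T" using f(1) by (simp add: absolutely_integrable_on_def)
  have "integral T f = integral UNIV (\<lambda>x. if x \<in> T then f x else 0)" by (simp add: integral_restrict_UNIV)
  also have "\<dots> \<le> integral UNIV (\<lambda>x. \<Sum>k\<in>I. if x \<in> S k then f x else 0)"
  proof (rule integral_le)
    fix x
    show "(if x \<in> T then f x else 0) \<le> (\<Sum>k\<in>I. if x \<in> S k then f x else 0)"
    proof (cases "x \<in> T")
      case True
      then obtain k where k: "k \<in> I" "x \<in> S k" using S(3) by blast
      have "(if x \<in> S k then f x else 0) \<le> (\<Sum>k\<in>I. if x \<in> S k then f x else 0)"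
        using k(1) I f(2) by (intro member_le_sum) auto
      then show ?thesis using True k by simp
    qed (use f(2) in \<open>auto intro: sum_nonneg\<close>)
  qed (use fT fk I in \<open>auto simp: integrable_restrict_UNIV intro!: integrable_sum\<close>)
  also have "\<dots> = (\<Sum>k\<in>I. integral (S k) f)"
    using fk I by (subst integral_sum) (auto simp: integrable_restrict_UNIV integral_restrict_UNIV)
  finally show ?thesis .
qed

locale element = gradient_pair +
  fixes K Khat :: "(real^2) set" and F :: "real^2 \<Rightarrow> real^2" and \<gamma> :: real and p :: nat and q :: "real^2 \<Rightarrow> real"
  assumes open_K: "open K" and K_sub: "K \<subseteq> \<Omega>" and open_Khat: "open Khat" and FK: "F ` Khat = K"
    and inj_F: "inj_on F (closure Khat)" and C1_F: "C1_on (closure Khat) F"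
    and eigen: "\<And>x l. x \<in> Khat \<Longrightarrow> is_eigenvalue (gramian F x) l \<Longrightarrow>
      0 < l \<and> (diameter K)\<^sup>2 / l \<le> \<gamma> \<and> l / (diameter K)\<^sup>2 \<le> \<gamma>"
    and \<gamma>: "0 < \<gamma>" and h_pos: "0 < diameter K" and p: "1 \<le> p"
    and uq: "AE x in lebesgue_on Khat. (u \<circ> F) x = q x"
begin

text \<open>F composed with the affine chart is a patch. The eigenvalue bounds and the chain rule
  give the Jacobian bounds c and d, both proportional to h^2, so h drops out of d / c.\<close>

lemma piece_estimate:
  assumes M: "det M \<noteq> 0" and sub: "aff a M ` box 0 1 \<subseteq> Khat" "aff a M ` cbox 0 1 \<subseteq> closure Khat"
    and q: "bipoly p p (\<lambda>x y. q (aff a M (pt x y)))"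
  shows "open ((F \<circ> aff a M) ` box 0 1)" "(F \<circ> aff a M) ` box 0 1 \<subseteq> K"
    and "integral ((F \<circ> aff a M) ` box 0 1) (\<lambda>x. (norm (gu x))\<^sup>2)
      \<le> piece_const \<gamma> M * (real p ^ 4 / (diameter K)\<^sup>2 * integral K (\<lambda>x. (u x - v x)\<^sup>2)
          + integral K (\<lambda>x. (norm (gv x))\<^sup>2))"
proof -
  obtain F' where F': "\<And>x. x \<in> closure Khat \<Longrightarrow> (F has_derivative (\<lambda>h. F' x *v h)) (at x within closure Khat)"
    "continuous_on (closure Khat) F'"
    using C1_F unfolding C1_on_def by blast
  let ?\<Phi> = "F \<circ> aff a M" and ?J = "\<lambda>s. F' (aff a M s) ** M"
  let ?m = "\<bar>det M\<bar>" and ?f = "frob M" and ?h = "diameter K"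
  have m: "0 < ?m" using M by simp
  have F'_bounds: "frob (F' x) \<le> 2 * (\<gamma> * ?h\<^sup>2)" "?h\<^sup>2 / \<gamma> \<le> \<bar>det (F' x)\<bar>" if x: "x \<in> Khat" for x
  proof -
    \<comment> \<open>In the open reference element the derivative relative to the closure is the
      ordinary one, so \<open>F' x\<close> is the matrix from which \<open>gramian\<close> is
      formed.\<close>
    have "x \<in> interior (closure Khat)"
      using x interior_maximal[OF closure_subset open_Khat] by blast
    then have "(F has_derivative (\<lambda>h. F' x *v h)) (at x)"
      using F'(1)[of x] at_within_interior interior_subset by (metis subsetD)
    then have "frechet_derivative F (at x) = (\<lambda>h. F' x *v h)" by (rule frechet_derivative_at[symmetric])
    then have G: "gramian F x = transpose (F' x) ** F' x" by (simp add: gramian_def Let_def)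
    have "?h\<^sup>2 / \<gamma> \<le> l \<and> l \<le> \<gamma> * ?h\<^sup>2" if "is_eigenvalue (transpose (F' x) ** F' x) l" for l
      using eigen[OF x, unfolded G, OF that] \<gamma> h_pos by (auto simp: field_simps)
    from gramian_eigenvalue_bounds[OF this] \<gamma> h_pos
    show "frob (F' x) \<le> 2 * (\<gamma> * ?h\<^sup>2)" "?h\<^sup>2 / \<gamma> \<le> \<bar>det (F' x)\<bar>" by auto
  qed
  define c where "c = ?h\<^sup>2 / \<gamma> * ?m"
  define d where "d = 2 * (\<gamma> * ?h\<^sup>2) * ?f"
  have c0: "0 < c" using h_pos \<gamma> m by (simp add: c_def)
  have det_low: "c \<le> \<bar>det (?J s)\<bar>" if "s \<in> box 0 1" for s
  proof -
    have "?h\<^sup>2 / \<gamma> \<le> \<bar>det (F' (aff a M s))\<bar>" using F'_bounds(2) that sub(1) by blast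
    then show ?thesis unfolding det_mul abs_mult c_def by (rule mult_right_mono) simp
  qed
  have frob_up: "frob (?J s) \<le> d" if "s \<in> box 0 1" for s
  proof -
    have "frob (?J s) \<le> frob (F' (aff a M s)) * ?f" by (rule frob_mult)
    also have "\<dots> \<le> d" unfolding d_def
      using F'_bounds(1)[of "aff a M s"] that sub(1) frob_nonneg by (intro mult_right_mono) auto
    finally show ?thesis .
  qed
  have cont_aff: "continuous_on S (aff a M)" for S
    by (rule has_derivative_continuous_on[OF aff_deriv])
  interpret patch ?\<Phi> ?J
  proof
    show "(?\<Phi> has_derivative (\<lambda>h. ?J s *v h)) (at s within cbox 0 1)" if "s \<in> cbox 0 1" for s
      using has_derivative_in_compose2[OF F'(1) sub(2) that aff_deriv]
      by (simp add: o_def matrix_vector_mul_assoc)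
    have "continuous_on (cbox 0 1) (\<lambda>s. F' (aff a M s))"
      by (rule continuous_on_compose2[OF F'(2) cont_aff sub(2)])
    then show "continuous_on (cbox 0 1) ?J"
      unfolding matrix_matrix_mult_def by (intro continuous_intros)
    show "inj_on ?\<Phi> (cbox 0 1)"
    proof (rule comp_inj_on)
      have "inj (\<lambda>h. M *v h)" using M by (simp add: invertible_det_nz[symmetric] invertible_left_inverse matrix_left_invertible_injective)
      then show "inj_on (aff a M) (cbox 0 1)" by (auto simp: inj_on_def aff_def)
      show "inj_on F (aff a M ` cbox 0 1)" using inj_F sub(2) by (rule inj_on_subset)
    qed
    show "det (?J s) \<noteq> 0" if "s \<in> box 0 1" for s using det_low[OF that] c0 by auto
  qed
  show op: "open (?\<Phi> ` box 0 1)" by (rule open_image)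
  show subK: "?\<Phi> ` box 0 1 \<subseteq> K" using sub(1) FK by auto
  have neg: "negligible {s \<in> box 0 1. u (?\<Phi> s) \<noteq> q (aff a M (pt (s $ 1) (s $ 2)))}"
  proof -
    have "AE x in lebesgue. x \<in> Khat \<longrightarrow> u (F x) = q x"
      using uq open_Khat by (subst (asm) AE_restrict_space_iff) auto
    then obtain N where N: "N \<in> null_sets lebesgue" "{x. \<not> (x \<in> Khat \<longrightarrow> u (F x) = q x)} \<subseteq> N"
      unfolding eventually_ae_filter by auto
    then have "negligible {s. aff a M s \<in> N}"
      using M by (intro negligible_aff_vimage) (auto simp: negligible_iff_null_sets)
    then show ?thesis
      by (rule negligible_subset) (use N(2) sub(1) in auto)
  qed
  have "integral (?\<Phi> ` box 0 1) (\<lambda>x. (norm (gu x))\<^sup>2)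
    \<le> d / c * (192000 * real (p + 1) ^ 4 / c * integral (?\<Phi> ` box 0 1) (\<lambda>x. (u x - v x)\<^sup>2)
      + 32 * (d / c) * integral (?\<Phi> ` box 0 1) (\<lambda>x. (norm (gv x))\<^sup>2))"
    using subK K_sub
    by (intro patch_estimate[OF open_\<Omega> _ u gu weak_u v gv weak_v uv2 gu2 gv2 q neg c0 det_low frob_up]) auto
  also have "\<dots> \<le> d / c * (3072000 * \<gamma> / ?m * (real p ^ 4 / ?h\<^sup>2 * integral K (\<lambda>x. (u x - v x)\<^sup>2))
      + 64 * \<gamma>\<^sup>2 * ?f / ?m * integral K (\<lambda>x. (norm (gv x))\<^sup>2))"
  proof (intro mult_left_mono add_mono)
    have K_int: "f absolutely_integrable_on K" if "f absolutely_integrable_on \<Omega>" for f :: "real^2 \<Rightarrow> real"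
      using set_integrable_subset[OF that _ K_sub] open_K by simp
    have le: "integral (?\<Phi> ` box 0 1) (\<lambda>x. (u x - v x)\<^sup>2) \<le> integral K (\<lambda>x. (u x - v x)\<^sup>2)"
      using op by (intro integral_mono_set K_int uv2 subK) auto
    have le': "integral (?\<Phi> ` box 0 1) (\<lambda>x. (norm (gv x))\<^sup>2) \<le> integral K (\<lambda>x. (norm (gv x))\<^sup>2)"
      using op by (intro integral_mono_set K_int gv2 subK) auto
    have "real (p + 1) ^ 4 \<le> (2 * real p) ^ 4" using p by (intro power_mono) auto
    then have p4: "192000 * real (p + 1) ^ 4 / c \<le> 3072000 * real p ^ 4 / c"
      using c0 by (intro divide_right_mono) (auto simp: power_mult_distrib)
    have nn: "0 \<le> integral (?\<Phi> ` box 0 1) (\<lambda>x. (u x - v x)\<^sup>2)"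
      "0 \<le> integral (?\<Phi> ` box 0 1) (\<lambda>x. (norm (gv x))\<^sup>2)"
      using set_integrable_subset[OF K_int[OF uv2] _ subK] set_integrable_subset[OF K_int[OF gv2] _ subK] op
      by (auto simp: absolutely_integrable_on_def intro!: integral_nonneg)
    have "192000 * real (p + 1) ^ 4 / c * integral (?\<Phi> ` box 0 1) (\<lambda>x. (u x - v x)\<^sup>2)
      \<le> 3072000 * real p ^ 4 / c * integral K (\<lambda>x. (u x - v x)\<^sup>2)"
      using p4 le nn c0 by (intro mult_mono) auto
    also have "\<dots> = 3072000 * \<gamma> / ?m * (real p ^ 4 / ?h\<^sup>2 * integral K (\<lambda>x. (u x - v x)\<^sup>2))"
      by (simp add: c_def mult_ac)
    finally show "192000 * real (p + 1) ^ 4 / c * integral (?\<Phi> ` box 0 1) (\<lambda>x. (u x - v x)\<^sup>2)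
      \<le> 3072000 * \<gamma> / ?m * (real p ^ 4 / ?h\<^sup>2 * integral K (\<lambda>x. (u x - v x)\<^sup>2))" .
    have "32 * (d / c) = 64 * \<gamma>\<^sup>2 * ?f / ?m"
      using h_pos \<gamma> m by (simp add: c_def d_def power2_eq_square field_simps)
    then show "32 * (d / c) * integral (?\<Phi> ` box 0 1) (\<lambda>x. (norm (gv x))\<^sup>2)
      \<le> 64 * \<gamma>\<^sup>2 * ?f / ?m * integral K (\<lambda>x. (norm (gv x))\<^sup>2)"
      using le' \<gamma> m frob_nonneg[of M] by (simp only:) (intro mult_left_mono, auto)
    show "0 \<le> d / c" using c0 \<gamma> frob_nonneg by (auto simp: d_def)
  qed
  also have "\<dots> \<le> piece_const \<gamma> M * (real p ^ 4 / ?h\<^sup>2 * integral K (\<lambda>x. (u x - v x)\<^sup>2) + integral K (\<lambda>x. (norm (gv x))\<^sup>2))"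
  proof -
    let ?X = "real p ^ 4 / ?h\<^sup>2 * integral K (\<lambda>x. (u x - v x)\<^sup>2)" and ?Y = "integral K (\<lambda>x. (norm (gv x))\<^sup>2)"
    let ?A = "3072000 * \<gamma> / ?m" and ?B = "64 * \<gamma>\<^sup>2 * ?f / ?m"
    have nn: "0 \<le> integral K (\<lambda>x. (u x - v x)\<^sup>2)" "0 \<le> ?Y"
      using set_integrable_subset[OF uv2 _ K_sub] set_integrable_subset[OF gv2 _ K_sub] open_K
      by (auto simp: absolutely_integrable_on_def intro!: integral_nonneg)
    then have X: "0 \<le> ?X" by simp
    have AB: "0 \<le> ?A" "0 \<le> ?B" using \<gamma> m frob_nonneg[of M] by auto
    have dc: "d / c = 2 * \<gamma>\<^sup>2 * ?f / ?m"
      using h_pos \<gamma> m by (simp add: c_def d_def power2_eq_square field_simps)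
    have "?A * ?X + ?B * ?Y \<le> (?A + ?B) * (?X + ?Y)"
      using mult_nonneg_nonneg[OF AB(1) nn(2)] mult_nonneg_nonneg[OF AB(2) X]
      by (simp only: distrib_left distrib_right)
    then have "d / c * (?A * ?X + ?B * ?Y) \<le> d / c * ((?A + ?B) * (?X + ?Y))"
      using c0 \<gamma> frob_nonneg[of M] by (intro mult_left_mono) (auto simp: d_def)
    also have "\<dots> = piece_const \<gamma> M * (?X + ?Y)"
      unfolding piece_const_def dc by (simp only: mult.assoc)
    finally show ?thesis .
  qed
  finally show "integral (?\<Phi> ` box 0 1) (\<lambda>x. (norm (gu x))\<^sup>2)
      \<le> piece_const \<gamma> M * (real p ^ 4 / ?h\<^sup>2 * integral K (\<lambda>x. (u x - v x)\<^sup>2) + integral K (\<lambda>x. (norm (gv x))\<^sup>2))" .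
qed

lemma element_estimate_cover:
  assumes I: "finite I" and M: "\<And>k. k \<in> I \<Longrightarrow> det (M k) \<noteq> 0"
    and sub: "\<And>k. k \<in> I \<Longrightarrow> aff (a k) (M k) ` box 0 1 \<subseteq> Khat" "Khat \<subseteq> (\<Union>k\<in>I. aff (a k) (M k) ` box 0 1)"
    and q: "\<And>k. k \<in> I \<Longrightarrow> bipoly p p (\<lambda>x y. q (aff (a k) (M k) (pt x y)))"
  shows "integral K (\<lambda>x. (norm (gu x))\<^sup>2)
      \<le> (\<Sum>k\<in>I. piece_const \<gamma> (M k)) * (real p ^ 4 / (diameter K)\<^sup>2 * integral K (\<lambda>x. (u x - v x)\<^sup>2)
          + integral K (\<lambda>x. (norm (gv x))\<^sup>2))"
proof -
  have cl: "aff (a k) (M k) ` cbox 0 1 \<subseteq> closure Khat" if "k \<in> I" for k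
  proof -
    have "aff (a k) (M k) ` closure (box 0 1) \<subseteq> closure Khat"
      using sub(1)[OF that] closure_subset[of Khat] has_derivative_continuous_on[OF aff_deriv]
      by (intro image_closure_subset) auto
    moreover have "closure (box 0 1) = (cbox 0 1 :: (real^2) set)"
    proof (rule closure_box)
      have "pt (1/2) (1/2) \<in> box 0 1" by (simp add: mem_box_2)
      then show "box 0 1 \<noteq> ({} :: (real^2) set)" by blast
    qed
    ultimately show ?thesis by simp
  qed
  note pe = piece_estimate[OF M sub(1) cl q]
  have "integral K (\<lambda>x. (norm (gu x))\<^sup>2) \<le> (\<Sum>k\<in>I. integral ((F \<circ> aff (a k) (M k)) ` box 0 1) (\<lambda>x. (norm (gu x))\<^sup>2))"
  proof (rule integral_cover_le)
    show "(\<lambda>x. (norm (gu x))\<^sup>2) absolutely_integrable_on K"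
      using set_integrable_subset[OF gu2 _ K_sub] open_K by simp
    show "K \<subseteq> (\<Union>k\<in>I. (F \<circ> aff (a k) (M k)) ` box 0 1)" using sub(2) FK by fastforce
  qed (use I pe(1,2) in auto)
  also have "\<dots> \<le> (\<Sum>k\<in>I. piece_const \<gamma> (M k) * (real p ^ 4 / (diameter K)\<^sup>2 * integral K (\<lambda>x. (u x - v x)\<^sup>2)
          + integral K (\<lambda>x. (norm (gv x))\<^sup>2)))"
    by (intro sum_mono pe(3))
  finally show ?thesis by (simp only: sum_distrib_right)
qed

end

section \<open>Covering the reference elements by parallelograms\<close>

lemma aff_nth: "aff a M s $ k = a $ k + M $ k $ 1 * s $ 1 + M $ k $ 2 * s $ 2"
  by (simp add: aff_def matrix_vector_mult_def sum_2)

lemma bipoly_affine: "bipoly 1 1 (\<lambda>x y. a + b * x + c * y)"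
proof -
  have "bipoly 1 1 (\<lambda>x y. x)" "bipoly 1 1 (\<lambda>x y. y)"
    using bipoly.fst[of 0 1] bipoly.snd[of 1 0] by auto
  from bipoly.mult[OF bipoly.const[of 0 0] this(1)] bipoly.mult[OF bipoly.const[of 0 0] this(2)]
  show ?thesis by (intro bipoly.add bipoly.const) auto
qed

lemma bipoly_cmult: "bipoly m n f \<Longrightarrow> bipoly m n (\<lambda>x y. c * f x y)"
  using bipoly.mult[OF bipoly.const[of 0 0 c], of m n f m n] by simp

text \<open>Affine maps do not raise the total degree, so i + j <= p bounds the degree in each new
  variable by p.\<close>

lemma bipoly_poly_P:
  assumes "q \<in> poly_P p"
  shows "bipoly p p (\<lambda>x y. q (aff a M (pt x y)))"
proof -
  obtain c where q: "q = (\<lambda>x. \<Sum>i\<le>p. \<Sum>j\<le>p - i. c i j * (x $ 1) ^ i * (x $ 2) ^ j)"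
    using assms by (auto simp: poly_P_def)
  have lin: "bipoly 1 1 (\<lambda>x y. aff a M (pt x y) $ k)" for k
    using bipoly_affine by (simp add: aff_nth)
  have "bipoly p p (\<lambda>x y. c i j * (aff a M (pt x y) $ 1) ^ i * (aff a M (pt x y) $ 2) ^ j)"
    if "i \<le> p" "j \<le> p - i" for i j
    using that bipoly_power[OF lin, of i 1] bipoly_power[OF lin, of j 2]
    by (intro bipoly.mult[of i i _ j j] bipoly_cmult) auto
  then show ?thesis unfolding q by (intro bipoly_sum) auto
qed

text \<open>M is diagonal, so each old coordinate depends on a single new one and the degree bounds
  in the separate variables persist.\<close>

lemma bipoly_poly_Q:
  assumes "q \<in> poly_Q p" and M: "M $ 1 $ 2 = 0" "M $ 2 $ 1 = 0"
  shows "bipoly p p (\<lambda>x y. q (aff a M (pt x y)))"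
proof -
  obtain c where q: "q = (\<lambda>x. \<Sum>i\<le>p. \<Sum>j\<le>p. c i j * (x $ 1) ^ i * (x $ 2) ^ j)"
    using assms(1) by (auto simp: poly_Q_def)
  have x: "bipoly 1 0 (\<lambda>x y. aff a M (pt x y) $ 1)"
    using bipoly.add[OF bipoly.const bipoly_cmult[OF bipoly.fst[of 0 0]], of "a $ 1" "M $ 1 $ 1"]
    by (simp add: aff_nth M)
  have y: "bipoly 0 1 (\<lambda>x y. aff a M (pt x y) $ 2)"
    using bipoly.add[OF bipoly.const bipoly_cmult[OF bipoly.snd[of 0 0]], of "a $ 2" "M $ 2 $ 2"]
    by (simp add: aff_nth M)
  have "bipoly p p (\<lambda>x y. c i j * (aff a M (pt x y) $ 1) ^ i * (aff a M (pt x y) $ 2) ^ j)"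
    if "i \<le> p" "j \<le> p" for i j
    using that bipoly_power[OF x, of i] bipoly_power[OF y, of j]
    by (intro bipoly.mult[of i 0 _ 0 j] bipoly_cmult) auto
  then show ?thesis unfolding q by (intro bipoly_sum) auto
qed

text \<open>The columns are half the sides of the triangle at v, so the image of the unit square
  consists of the points whose barycentric coordinates for b and c lie strictly between 0 and
  1/2.\<close>

definition corner_matrix :: "real^2 \<Rightarrow> real^2 \<Rightarrow> real^2 \<Rightarrow> real^2^2" where
  "corner_matrix v b c = vector [vector [(b $ 1 - v $ 1) / 2, (c $ 1 - v $ 1) / 2],
     vector [(b $ 2 - v $ 2) / 2, (c $ 2 - v $ 2) / 2]]"

lemma aff_corner: "aff v (corner_matrix v b c) s
    = (1 - (s $ 1 + s $ 2) / 2) *\<^sub>R v + (s $ 1 / 2) *\<^sub>R b + (s $ 2 / 2) *\<^sub>R c"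
  by (simp add: vec_eq_iff forall_2 aff_nth corner_matrix_def field_simps)

lemma det_corner: "4 * det (corner_matrix v b c)
    = (b $ 1 - v $ 1) * (c $ 2 - v $ 2) - (c $ 1 - v $ 1) * (b $ 2 - v $ 2)"
  by (simp add: corner_matrix_def det_2 field_simps)

lemma corner_image:
  assumes "x \<in> aff v (corner_matrix v b c) ` box 0 1"
  shows "\<exists>\<alpha> \<beta> \<gamma>. 0 < \<alpha> \<and> 0 < \<beta> \<and> 0 < \<gamma> \<and> \<alpha> + \<beta> + \<gamma> = 1 \<and> \<alpha> *\<^sub>R v + \<beta> *\<^sub>R b + \<gamma> *\<^sub>R c = x"
proof -
  obtain s where "s \<in> box 0 1" "x = aff v (corner_matrix v b c) s" using assms by blast
  then show ?thesis
    by (intro exI[of _ "1 - (s $ 1 + s $ 2) / 2"] exI[of _ "s $ 1 / 2"] exI[of _ "s $ 2 / 2"])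
      (auto simp: mem_box_2 aff_corner)
qed

lemma corner_imageI:
  assumes "0 < \<beta>" "\<beta> < 1/2" "0 < \<gamma>" "\<gamma> < 1/2" "\<alpha> + \<beta> + \<gamma> = 1"
  shows "\<alpha> *\<^sub>R v + \<beta> *\<^sub>R b + \<gamma> *\<^sub>R c \<in> aff v (corner_matrix v b c) ` box 0 1"
proof (rule image_eqI[of _ _ "pt (2 * \<beta>) (2 * \<gamma>)"])
  have "\<alpha> = 1 - (2 * \<beta> + 2 * \<gamma>) / 2" using assms(5) by argo
  then show "\<alpha> *\<^sub>R v + \<beta> *\<^sub>R b + \<gamma> *\<^sub>R c = aff v (corner_matrix v b c) (pt (2 * \<beta>) (2 * \<gamma>))"
    unfolding aff_corner by simp
qed (use assms in \<open>auto simp: mem_box_2\<close>)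

text \<open>A triangle is the union of three parallelograms: at most one barycentric coordinate is at
  least \<open>1/2\<close>.\<close>

lemma reference_pieces:
  assumes "Khat \<in> {ref_square, ref_triangle}"
  shows "\<exists>(I :: nat set) a M. finite I \<and> (\<forall>k\<in>I. det (M k) \<noteq> 0 \<and> aff (a k) (M k) ` box 0 1 \<subseteq> Khat)
    \<and> Khat \<subseteq> (\<Union>k\<in>I. aff (a k) (M k) ` box 0 1)
    \<and> (\<forall>p q. \<forall>k\<in>I. q \<in> poly_ref Khat p \<longrightarrow> bipoly p p (\<lambda>x y. q (aff (a k) (M k) (pt x y))))"
proof (cases "Khat = ref_triangle")
  case True
  define A B C where "A = (vector [0, 2 / sqrt 3] :: real^2)" and "B = (vector [1, - 1 / sqrt 3] :: real^2)"
    and "C = (vector [-1, - 1 / sqrt 3] :: real^2)"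
  have "\<not> collinear {A, B, C}"
  proof
    assume "collinear {A, B, C}"
    then consider "A = C" | w where "B = w *\<^sub>R A + (1 - w) *\<^sub>R C" unfolding collinear_3_expand by blast
    then show False
    proof cases
      case 1
      then have "A $ 1 = C $ 1" by simp
      then show False by (simp add: A_def C_def)
    next
      case 2
      then have 1: "B $ 1 = w * A $ 1 + (1 - w) * C $ 1" and 2: "B $ 2 = w * A $ 2 + (1 - w) * C $ 2" by simp_all
      from 2 have "w = 0" by (simp add: A_def B_def C_def field_simps)
      then show False using 1 by (simp add: A_def B_def C_def)
    qed
  qed
  then have K: "Khat = {v. \<exists>x y z. 0 < x \<and> 0 < y \<and> 0 < z \<and> x + y + z = 1 \<and> x *\<^sub>R A + y *\<^sub>R B + z *\<^sub>R C = v}"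
    unfolding True ref_triangle_def A_def[symmetric] B_def[symmetric] C_def[symmetric]
    by (intro interior_convex_hull_3_minimal) auto
  define a where "a k = (if k = 0 then A else if k = 1 then B else C)" for k :: nat
  define M where "M k = (if k = 0 then corner_matrix A B C else if k = 1 then corner_matrix B A C
    else corner_matrix C A B)" for k :: nat
  have d: "4 * det (corner_matrix A B C) \<noteq> 0" "4 * det (corner_matrix B A C) \<noteq> 0" "4 * det (corner_matrix C A B) \<noteq> 0"
    unfolding det_corner by (simp_all add: A_def B_def C_def field_simps)
  show ?thesis
  proof (intro exI[of _ "{0, 1, 2 :: nat}"] exI[of _ a] exI[of _ M] conjI ballI allI impI)
    fix k :: nat assume k: "k \<in> {0, 1, 2}"
    show "det (M k) \<noteq> 0" using k d by (auto simp: M_def)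
    show "aff (a k) (M k) ` box 0 1 \<subseteq> Khat"
    proof
      fix x assume x: "x \<in> aff (a k) (M k) ` box 0 1"
      consider "k = 0" | "k = 1" | "k = 2" using k by blast
      then show "x \<in> Khat"
      proof cases
        case 1
        then show ?thesis using corner_image[of x A B C] x by (simp add: K a_def M_def)
      next
        case 2
        then obtain \<alpha> \<beta> \<gamma> where "0 < \<alpha>" "0 < \<beta>" "0 < \<gamma>" "\<alpha> + \<beta> + \<gamma> = 1" "\<alpha> *\<^sub>R B + \<beta> *\<^sub>R A + \<gamma> *\<^sub>R C = x"
          using corner_image[of x B A C] x by (auto simp: a_def M_def)
        then show ?thesis unfolding K
          by (intro CollectI exI[of _ \<beta>] exI[of _ \<alpha>] exI[of _ \<gamma>]) (auto simp: algebra_simps)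
      next
        case 3
        then obtain \<alpha> \<beta> \<gamma> where "0 < \<alpha>" "0 < \<beta>" "0 < \<gamma>" "\<alpha> + \<beta> + \<gamma> = 1" "\<alpha> *\<^sub>R C + \<beta> *\<^sub>R A + \<gamma> *\<^sub>R B = x"
          using corner_image[of x C A B] x by (auto simp: a_def M_def)
        then show ?thesis unfolding K
          by (intro CollectI exI[of _ \<beta>] exI[of _ \<gamma>] exI[of _ \<alpha>]) (auto simp: algebra_simps)
      qed
    qed
  next
    show "Khat \<subseteq> (\<Union>k\<in>{0, 1, 2}. aff (a k) (M k) ` box 0 1)"
    proof
      fix v assume "v \<in> Khat"
      then obtain x y z where *: "0 < x" "0 < y" "0 < z" "x + y + z = 1" and v: "x *\<^sub>R A + y *\<^sub>R B + z *\<^sub>R C = v"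
        unfolding K by blast
      \<comment> \<open>The corner A serves unless y or z reaches 1/2; a coordinate of at least 1/2
        forces the two others, which are positive, below 1/2.\<close>
      consider "y < 1/2" "z < 1/2" | "1/2 \<le> y" | "1/2 \<le> z" by linarith
      then show "v \<in> (\<Union>k\<in>{0, 1, 2}. aff (a k) (M k) ` box 0 1)"
      proof cases
        case 1
        then have "v \<in> aff (a 0) (M 0) ` box 0 1"
          using corner_imageI[of y z x A B C] * v by (simp add: a_def M_def)
        then show ?thesis by blast
      next
        case 2
        then have "y *\<^sub>R B + x *\<^sub>R A + z *\<^sub>R C \<in> aff (a 1) (M 1) ` box 0 1"
          using corner_imageI[of x z y B A C] * by (simp add: a_def M_def)
        then show ?thesis using v by (auto simp: add.commute)
      next
        case 3
        then have "z *\<^sub>R C + x *\<^sub>R A + y *\<^sub>R B \<in> aff (a 2) (M 2) ` box 0 1"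
          using corner_imageI[of x y z C A B] * by (simp add: a_def M_def)
        moreover have "z *\<^sub>R C + x *\<^sub>R A + y *\<^sub>R B = v" using v by (simp add: algebra_simps)
        ultimately show ?thesis by blast
      qed
    qed
  next
    fix p q and k :: nat assume "q \<in> poly_ref Khat p"
    then show "bipoly p p (\<lambda>x y. q (aff (a k) (M k) (pt x y)))"
      using True by (intro bipoly_poly_P) (simp add: poly_ref_def)
  qed auto
next
  case False
  define a where "a = (vector [-1, - 1 / sqrt 3] :: real^2)"
  \<comment> \<open>3 / sqrt 3 is the height of the reference square.\<close>
  define M where "M = (vector [vector [2, 0], vector [0, 3 / sqrt 3]] :: real^2^2)"
  have aff1: "aff a M s $ 1 = -1 + 2 * s $ 1" and aff2: "aff a M s $ 2 = (3 * s $ 2 - 1) / sqrt 3" for s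
    by (simp_all add: aff_nth a_def M_def diff_divide_distrib)
  have K: "Khat = box (vector [-1, - 1 / sqrt 3]) (vector [1, 2 / sqrt 3])"
    using assms False by (simp add: ref_square_def)
  have img: "aff a M ` box 0 1 = Khat"
  proof (intro set_eqI iffI)
    fix x assume x: "x \<in> Khat"
    have "aff a M (pt ((x $ 1 + 1) / 2) ((sqrt 3 * x $ 2 + 1) / 3)) = x"
      by (simp add: vec_eq_iff forall_2 aff1 aff2 add_divide_distrib)
    moreover have "pt ((x $ 1 + 1) / 2) ((sqrt 3 * x $ 2 + 1) / 3) \<in> box 0 1"
      using x by (simp add: K mem_box_2 field_simps)
    ultimately show "x \<in> aff a M ` box 0 1" by (metis image_eqI)
  next
    fix x assume "x \<in> aff a M ` box 0 1"
    then obtain s where "s \<in> box 0 1" "x = aff a M s" by blast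
    then show "x \<in> Khat" by (simp add: K mem_box_2 aff1 aff2 field_simps)
  qed
  show ?thesis
  proof (intro exI[of _ "{0 :: nat}"] exI[of _ "\<lambda>k. a"] exI[of _ "\<lambda>k. M"] conjI ballI allI impI)
    show "det M \<noteq> 0" by (simp add: M_def det_2)
    fix p q assume "q \<in> poly_ref Khat p"
    then show "bipoly p p (\<lambda>x y. q (aff a M (pt x y)))"
      using False by (intro bipoly_poly_Q) (auto simp: poly_ref_def M_def)
  qed (use img in auto)
qed

text \<open>All data are quantified inside, including the domain and both functions, which records
  that C depends on \<gamma> alone.\<close>

definition inverse_estimate_const :: "real \<Rightarrow> real \<Rightarrow> bool" where
  "inverse_estimate_const \<gamma> C \<longleftrightarrow> (\<forall>\<Omega> u v gu gv K Khat F p q. Khat \<in> {ref_square, ref_triangle}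
    \<and> q \<in> poly_ref Khat p \<and> element \<Omega> u v gu gv K Khat F \<gamma> p q \<longrightarrow>
    integral K (\<lambda>x. (norm (gu x))\<^sup>2) \<le> C * (real p ^ 4 / (diameter K)\<^sup>2 * integral K (\<lambda>x. (u x - v x)\<^sup>2)
      + integral K (\<lambda>x. (norm (gv x))\<^sup>2)))"

text \<open>Each of the two reference elements has a fixed finite family of pieces, and
  \<open>piece_const\<close> involves only \<gamma> and the matrices of the pieces.\<close>

lemma element_estimate:
  assumes \<gamma>: "0 < \<gamma>"
  shows "\<exists>C>0. inverse_estimate_const \<gamma> C"
proof -
  have ex: "\<exists>C\<ge>0. \<forall>\<Omega> u v gu gv K F p q. q \<in> poly_ref Khat p \<and> element \<Omega> u v gu gv K Khat F \<gamma> p q \<longrightarrow>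
    integral K (\<lambda>x. (norm (gu x))\<^sup>2) \<le> C * (real p ^ 4 / (diameter K)\<^sup>2 * integral K (\<lambda>x. (u x - v x)\<^sup>2)
      + integral K (\<lambda>x. (norm (gv x))\<^sup>2))" if Khat: "Khat \<in> {ref_square, ref_triangle}" for Khat
  proof -
    obtain I :: "nat set" and a M where P: "finite I \<and> (\<forall>k\<in>I. det (M k) \<noteq> 0 \<and> aff (a k) (M k) ` box 0 1 \<subseteq> Khat)
        \<and> Khat \<subseteq> (\<Union>k\<in>I. aff (a k) (M k) ` box 0 1)
        \<and> (\<forall>p q. \<forall>k\<in>I. q \<in> poly_ref Khat p \<longrightarrow> bipoly p p (\<lambda>x y. q (aff (a k) (M k) (pt x y))))"
      using reference_pieces[OF Khat] by (elim exE) (rule that)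
    have I: "finite I" "\<And>k. k \<in> I \<Longrightarrow> det (M k) \<noteq> 0"
      "\<And>k. k \<in> I \<Longrightarrow> aff (a k) (M k) ` box 0 1 \<subseteq> Khat" "Khat \<subseteq> (\<Union>k\<in>I. aff (a k) (M k) ` box 0 1)"
      using P by auto
    have q: "bipoly p p (\<lambda>x y. q (aff (a k) (M k) (pt x y)))" if "k \<in> I" "q \<in> poly_ref Khat p" for p q k
      by (rule P[THEN conjunct2, THEN conjunct2, THEN conjunct2, THEN spec, THEN spec, THEN bspec, THEN mp]) (use that in auto)
    have "0 \<le> (\<Sum>k\<in>I. piece_const \<gamma> (M k))"
      using \<gamma> frob_nonneg by (intro sum_nonneg) (auto simp: piece_const_def)
    moreover have "integral K (\<lambda>x. (norm (gu x))\<^sup>2) \<le> (\<Sum>k\<in>I. piece_const \<gamma> (M k)) *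
        (real p ^ 4 / (diameter K)\<^sup>2 * integral K (\<lambda>x. (u x - v x)\<^sup>2) + integral K (\<lambda>x. (norm (gv x))\<^sup>2))"
      if "q' \<in> poly_ref Khat p" "element \<Omega> u v gu gv K Khat F \<gamma> p q'" for \<Omega> u v gu gv K F p q'
      using that(2) by (rule element.element_estimate_cover) (use I q that(1) in auto)
    ultimately show ?thesis by (intro exI[of _ "\<Sum>k\<in>I. piece_const \<gamma> (M k)"] conjI allI impI) auto
  qed
  obtain Cs where Cs: "0 \<le> Cs" "\<And>\<Omega> u v gu gv K F p q. q \<in> poly_ref ref_square p \<Longrightarrow> element \<Omega> u v gu gv K ref_square F \<gamma> p q \<Longrightarrow>
    integral K (\<lambda>x. (norm (gu x))\<^sup>2) \<le> Cs * (real p ^ 4 / (diameter K)\<^sup>2 * integral K (\<lambda>x. (u x - v x)\<^sup>2)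
      + integral K (\<lambda>x. (norm (gv x))\<^sup>2))"
    using ex[OF insertI1] by (elim exE conjE) (rule that; blast)
  obtain Ct where Ct: "0 \<le> Ct" "\<And>\<Omega> u v gu gv K F p q. q \<in> poly_ref ref_triangle p \<Longrightarrow> element \<Omega> u v gu gv K ref_triangle F \<gamma> p q \<Longrightarrow>
    integral K (\<lambda>x. (norm (gu x))\<^sup>2) \<le> Ct * (real p ^ 4 / (diameter K)\<^sup>2 * integral K (\<lambda>x. (u x - v x)\<^sup>2)
      + integral K (\<lambda>x. (norm (gv x))\<^sup>2))"
    using ex[OF insertI2[OF insertI1]] by (elim exE conjE) (rule that; blast)
  show ?thesis unfolding inverse_estimate_const_def
  proof (intro exI[of _ "Cs + Ct + 1"] conjI allI impI)
    show "0 < Cs + Ct + 1" using Cs(1) Ct(1) by simp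
    fix \<Omega> u v gu gv K Khat F p q
    assume A: "Khat \<in> {ref_square, ref_triangle} \<and> q \<in> poly_ref Khat p \<and> element \<Omega> u v gu gv K Khat F \<gamma> p q"
    then interpret element \<Omega> u v gu gv K Khat F \<gamma> p q by blast
    let ?X = "real p ^ 4 / (diameter K)\<^sup>2 * integral K (\<lambda>x. (u x - v x)\<^sup>2) + integral K (\<lambda>x. (norm (gv x))\<^sup>2)"
    have "(\<lambda>x. (u x - v x)\<^sup>2) absolutely_integrable_on K" "(\<lambda>x. (norm (gv x))\<^sup>2) absolutely_integrable_on K"
      using set_integrable_subset[OF uv2 _ K_sub] set_integrable_subset[OF gv2 _ K_sub] open_K by auto
    then have X: "0 \<le> ?X"
      by (intro add_nonneg_nonneg mult_nonneg_nonneg integral_nonneg) (auto simp: absolutely_integrable_on_def)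
    have "integral K (\<lambda>x. (norm (gu x))\<^sup>2) \<le> Cs * ?X \<or> integral K (\<lambda>x. (norm (gu x))\<^sup>2) \<le> Ct * ?X"
      using A Cs(2)[of q p \<Omega> u v gu gv K F] Ct(2)[of q p \<Omega> u v gu gv K F] by blast
    moreover have "Cs * ?X \<le> (Cs + Ct + 1) * ?X" "Ct * ?X \<le> (Cs + Ct + 1) * ?X"
      using Cs(1) Ct(1) X by (intro mult_right_mono; simp)+
    ultimately show "integral K (\<lambda>x. (norm (gu x))\<^sup>2) \<le> (Cs + Ct + 1) * ?X" by linarith
  qed
qed

section \<open>Lebesgue and Sobolev norms\<close>

lemma absolutely_integrable_lebesgue_on:
  fixes f :: "real^2 \<Rightarrow> real"
  assumes "open \<Omega>"
  shows "f absolutely_integrable_on \<Omega> \<longleftrightarrow> integrable (lebesgue_on \<Omega>) f"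
  using assms by (simp add: set_integrable_def integrable_restrict_space)

lemma L2_norm_sq:
  fixes f :: "real^2 \<Rightarrow> 'b::euclidean_space"
  shows "(L2_norm \<Omega> f)\<^sup>2 = (\<integral>x. (norm (f x))\<^sup>2 \<partial>lebesgue_on \<Omega>)"
  by (simp add: L2_norm_def)

lemma L2_square_integrable:
  fixes f :: "real^2 \<Rightarrow> 'b::euclidean_space"
  assumes "open \<Omega>" "f \<in> L2 \<Omega>"
  shows "(\<lambda>x. (norm (f x))\<^sup>2) absolutely_integrable_on \<Omega>"
    and "(L2_norm \<Omega> f)\<^sup>2 = integral \<Omega> (\<lambda>x. (norm (f x))\<^sup>2)"
proof -
  have "integrable (lebesgue_on \<Omega>) (\<lambda>x. (norm (f x))\<^sup>2)" using assms(2) by (simp add: L2_def)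
  then show "(\<lambda>x. (norm (f x))\<^sup>2) absolutely_integrable_on \<Omega>"
    "(L2_norm \<Omega> f)\<^sup>2 = integral \<Omega> (\<lambda>x. (norm (f x))\<^sup>2)"
    using assms(1) by (auto simp: absolutely_integrable_lebesgue_on L2_norm_sq lebesgue_integral_eq_integral)
qed

text \<open>A bounded domain has finite measure, and 2 t <= 1 + t^2 embeds L2 into L1.\<close>

lemma L2_dominated:
  fixes f :: "real^2 \<Rightarrow> 'b::euclidean_space" and g :: "real^2 \<Rightarrow> real"
  assumes \<Omega>: "open \<Omega>" "bounded \<Omega>" and f: "f \<in> L2 \<Omega>"
    and g: "g \<in> borel_measurable (lebesgue_on \<Omega>)" "\<And>x. \<bar>g x\<bar> \<le> norm (f x)"
  shows "g absolutely_integrable_on \<Omega>"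
proof -
  have "integrable (lebesgue_on \<Omega>) (\<lambda>x. (norm (f x))\<^sup>2)" using f by (simp add: L2_def)
  moreover have "integrable (lebesgue_on \<Omega>) (\<lambda>x. 1 :: real)"
    using absolutely_integrable_on_const[OF lmeasurable_open[OF \<Omega>(2,1)], of "1 :: real"]
    by (simp add: absolutely_integrable_lebesgue_on[OF \<Omega>(1)])
  ultimately have "integrable (lebesgue_on \<Omega>) (\<lambda>x. 1 + (norm (f x))\<^sup>2)" by simp
  then have "integrable (lebesgue_on \<Omega>) g"
  proof (rule Bochner_Integration.integrable_bound[OF _ g(1)])
    have "\<bar>g x\<bar> \<le> 1 + (norm (f x))\<^sup>2" for x
    proof -
      have "2 * norm (f x) \<le> 1 + (norm (f x))\<^sup>2"
        using zero_le_power2[of "norm (f x) - 1"] by (simp add: power2_diff)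
      then show ?thesis using g(2)[of x] norm_ge_zero[of "f x"] by linarith
    qed
    then show "AE x in lebesgue_on \<Omega>. norm (g x) \<le> norm (1 + (norm (f x))\<^sup>2)" by auto
  qed
  then show ?thesis using \<Omega>(1) by (simp add: absolutely_integrable_lebesgue_on)
qed

lemma gradient_pair_L2:
  assumes \<Omega>: "open \<Omega>" "bounded \<Omega>"
    and u: "u \<in> L2 \<Omega>" "gu \<in> L2 \<Omega>" "has_weak_gradient \<Omega> u gu"
    and v: "v \<in> L2 \<Omega>" "gv \<in> L2 \<Omega>" "has_weak_gradient \<Omega> v gv"
  shows "gradient_pair \<Omega> u v gu gv"
proof
  have scalar: "w absolutely_integrable_on \<Omega>" if "w \<in> L2 \<Omega>" for w :: "real^2 \<Rightarrow> real"
    using that by (intro L2_dominated[OF \<Omega> that]) (auto simp: L2_def)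
  have vector: "(\<lambda>x. w x $ k) absolutely_integrable_on \<Omega>" if "w \<in> L2 \<Omega>" for w :: "real^2 \<Rightarrow> real^2" and k
  proof (rule L2_dominated[OF \<Omega> that])
    have "w \<in> borel_measurable (lebesgue_on \<Omega>)" using that by (simp add: L2_def)
    then have "(\<lambda>x. w x \<bullet> axis k 1) \<in> borel_measurable (lebesgue_on \<Omega>)" by simp
    then show "(\<lambda>x. w x $ k) \<in> borel_measurable (lebesgue_on \<Omega>)" by (simp add: inner_axis)
  qed (rule component_le_norm_cart)
  show "u absolutely_integrable_on \<Omega>" "v absolutely_integrable_on \<Omega>" using u v by (auto intro: scalar)
  show "(\<lambda>x. gu x $ k) absolutely_integrable_on \<Omega>" "(\<lambda>x. gv x $ k) absolutely_integrable_on \<Omega>" for k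
    using u v by (auto intro: vector)
  show "(\<lambda>x. (norm (gu x))\<^sup>2) absolutely_integrable_on \<Omega>" "(\<lambda>x. (norm (gv x))\<^sup>2) absolutely_integrable_on \<Omega>"
    using u v \<Omega> by (auto intro: L2_square_integrable)
  show "(\<lambda>x. (u x - v x)\<^sup>2) absolutely_integrable_on \<Omega>"
    unfolding absolutely_integrable_lebesgue_on[OF \<Omega>(1)]
  proof (rule Bochner_Integration.integrable_bound)
    show "integrable (lebesgue_on \<Omega>) (\<lambda>x. 2 * (norm (u x))\<^sup>2 + 2 * (norm (v x))\<^sup>2)"
      using u(1) v(1) by (auto simp: L2_def)
    show "(\<lambda>x. (u x - v x)\<^sup>2) \<in> borel_measurable (lebesgue_on \<Omega>)"
      using u(1) v(1) by (auto simp: L2_def)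
    have "(u x - v x)\<^sup>2 \<le> 2 * (u x)\<^sup>2 + 2 * (v x)\<^sup>2" for x
      using zero_le_power2[of "u x + v x"] by (simp add: power2_sum power2_diff)
    then show "AE x in lebesgue_on \<Omega>. norm ((u x - v x)\<^sup>2) \<le> norm (2 * (norm (u x))\<^sup>2 + 2 * (norm (v x))\<^sup>2)"
      by (auto intro!: AE_I2)
  qed
qed (use \<Omega> u v in auto)

lemma weak_gradient_H1:
  assumes "u \<in> H1 \<Omega>"
  shows "u \<in> L2 \<Omega>" "weak_gradient \<Omega> u \<in> L2 \<Omega>" "has_weak_gradient \<Omega> u (weak_gradient \<Omega> u)"
proof -
  have "\<exists>g. g \<in> L2 \<Omega> \<and> has_weak_gradient \<Omega> u g" using assms by (auto simp: H1_def)
  from someI_ex[OF this]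
  show "weak_gradient \<Omega> u \<in> L2 \<Omega>" "has_weak_gradient \<Omega> u (weak_gradient \<Omega> u)"
    by (auto simp: weak_gradient_def)
  show "u \<in> L2 \<Omega>" using assms by (simp add: H1_def)
qed

lemma L2_norm_nonneg: "0 \<le> L2_norm \<Omega> f"
  by (auto simp: L2_norm_def intro!: integral_nonneg_AE)

lemma H1_norm_nonneg: "0 \<le> H1_norm \<Omega> f"
  by (simp add: H1_norm_def)

lemma H1_norm_sq: "(H1_norm \<Omega> u)\<^sup>2 = (L2_norm \<Omega> u)\<^sup>2 + (L2_norm \<Omega> (weak_gradient \<Omega> u))\<^sup>2"
  by (simp add: H1_norm_def)

lemma zero_L2: "(\<lambda>x. 0 :: 'b::euclidean_space) \<in> L2 \<Omega>" "L2_norm \<Omega> (\<lambda>x. 0 :: 'b) = 0"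
  by (auto simp: L2_def L2_norm_def)

lemma zero_weak_gradient: "has_weak_gradient \<Omega> (\<lambda>x. 0) (\<lambda>x. 0)"
  by (simp add: has_weak_gradient_def)

lemma zero_H1: "(\<lambda>x. 0) \<in> H1 \<Omega>"
  unfolding H1_def by (intro CollectI conjI bexI[of _ "\<lambda>x. 0"] zero_L2 zero_weak_gradient)

text \<open>\<open>weak_gradient\<close> selects some weak gradient, and that of 0 vanishes almost
  everywhere by the fundamental lemma. The zero function is the competitor that keeps the
  K-functional bounded as t grows.\<close>

lemma H1_norm_zero:
  assumes \<Omega>: "open \<Omega>" "bounded \<Omega>"
  shows "H1_norm \<Omega> (\<lambda>x. 0) = 0"
proof -
  define g where "g = weak_gradient \<Omega> (\<lambda>x. 0)"
  note g = weak_gradient_H1[OF zero_H1, of \<Omega>, folded g_def]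
  interpret gradient_pair \<Omega> "\<lambda>x. 0" "\<lambda>x. 0" g g
    by (rule gradient_pair_L2[OF \<Omega> g g])
  have "negligible {x \<in> \<Omega>. g x $ k \<noteq> 0}" for k
  proof (rule fundamental_lemma[OF \<Omega>(1) gu])
    fix n :: real and a b assume "0 < n" "cbox a b \<subseteq> \<Omega>"
    from weak_gradient_integral[OF weak_u test_function_bump[OF this] \<Omega>(1) elem_smooth_bump u gu]
    show "integral \<Omega> (\<lambda>x. g x $ k * bump n a b x) = 0" by simp
  qed
  then have N: "negligible ({x \<in> \<Omega>. g x $ 1 \<noteq> 0} \<union> {x \<in> \<Omega>. g x $ 2 \<noteq> 0})" by (intro negligible_Un)
  have "(L2_norm \<Omega> g)\<^sup>2 = integral \<Omega> (\<lambda>x. (norm (g x))\<^sup>2)"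
    using g(2) \<Omega>(1) by (rule L2_square_integrable(2)[rotated])
  also have "\<dots> = integral \<Omega> (\<lambda>x. 0)"
    by (rule integral_spike[OF N]) (auto simp: norm_sq_2)
  finally show ?thesis
    by (simp add: H1_norm_def zero_L2 g_def)
qed

lemma zero_H1_tilde:
  assumes "open \<Omega>" "bounded \<Omega>"
  shows "(\<lambda>x. 0) \<in> H1_tilde \<Omega>"
proof -
  have "has_trace \<Omega> (\<lambda>x. 0) (\<lambda>x. 0)" unfolding has_trace_def
  proof (intro exI[of _ "\<lambda>n x. 0"] conjI allI impI)
    show "smooth (\<lambda>x. 0)" by (intro elem_smooth_smooth elem_smooth.const)
    show "(\<lambda>n :: nat. H1_norm \<Omega> ((\<lambda>x. 0) - (\<lambda>x. 0))) \<longlonglongrightarrow> 0"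
      using H1_norm_zero[OF assms] by (simp add: fun_diff_def)
  qed auto
  then show ?thesis using zero_H1 by (simp add: H1_tilde_def)
qed

section \<open>Integrals and weighted norms over a mesh\<close>

lemma integral_disjoint_le:
  fixes f :: "real^2 \<Rightarrow> real"
  assumes f: "f absolutely_integrable_on \<Omega>" "\<And>x. 0 \<le> f x" and T: "finite \<T>" "disjoint \<T>"
    and K: "\<And>K. K \<in> \<T> \<Longrightarrow> open K" "\<And>K. K \<in> \<T> \<Longrightarrow> K \<subseteq> \<Omega>"
  shows "(\<Sum>K\<in>\<T>. integral K f) \<le> integral \<Omega> f"
proof -
  have fK: "f integrable_on K" if "K \<in> \<T>" for K
    using set_integrable_subset[OF f(1) _ K(2)[OF that]] K(1)[OF that] by (simp add: absolutely_integrable_on_def)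
  have "(\<Sum>K\<in>\<T>. integral K f) = integral UNIV (\<lambda>x. \<Sum>K\<in>\<T>. if x \<in> K then f x else 0)"
    using fK T by (subst integral_sum) (auto simp: integrable_restrict_UNIV integral_restrict_UNIV)
  also have "\<dots> \<le> integral UNIV (\<lambda>x. if x \<in> \<Omega> then f x else 0)"
  proof (rule integral_le)
    fix x
    show "(\<Sum>K\<in>\<T>. if x \<in> K then f x else 0) \<le> (if x \<in> \<Omega> then f x else 0)"
    proof (cases "\<exists>K\<in>\<T>. x \<in> K")
      case True
      then obtain K0 where K0: "K0 \<in> \<T>" "x \<in> K0" by blast
      have "(\<Sum>K\<in>\<T>. if x \<in> K then f x else 0) = (\<Sum>K\<in>\<T>. if K = K0 then f x else 0)"
        using T(2) K0 by (intro sum.cong) (auto simp: disjoint_def)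
      then show ?thesis using K0 K(2) T(1) by (auto simp: sum.delta)
    next
      case False
      then have "(\<Sum>K\<in>\<T>. if x \<in> K then f x else 0) = 0" by (intro sum.neutral) auto
      then show ?thesis using f(2) by simp
    qed
  qed (use fK f(1) T in \<open>auto simp: integrable_restrict_UNIV absolutely_integrable_on_def intro!: integrable_sum\<close>)
  finally show ?thesis by (simp add: integral_restrict_UNIV)
qed

lemma weighted_norm_sq:
  fixes g :: "real^2 \<Rightarrow> real^2" and c d :: "(real^2) set \<Rightarrow> real"
  assumes \<Omega>: "open \<Omega>" and g: "g \<in> L2 \<Omega>" and T: "finite \<T>" "disjoint \<T>"
    and K: "\<And>K. K \<in> \<T> \<Longrightarrow> open K" "\<And>K. K \<in> \<T> \<Longrightarrow> K \<subseteq> \<Omega>"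
  shows "(L2_norm \<Omega> (\<lambda>x. (piecewise_const \<T> c x powr \<alpha> * piecewise_const \<T> d x powr \<beta>) *\<^sub>R g x))\<^sup>2
    = (\<Sum>K\<in>\<T>. (c K powr \<alpha> * d K powr \<beta>)\<^sup>2 * integral K (\<lambda>x. (norm (g x))\<^sup>2))"
proof -
  let ?w = "\<lambda>x. piecewise_const \<T> c x powr \<alpha> * piecewise_const \<T> d x powr \<beta>"
  let ?W = "\<lambda>K. (c K powr \<alpha> * d K powr \<beta>)\<^sup>2"
  have gi: "(\<lambda>x. (norm (g x))\<^sup>2) absolutely_integrable_on \<Omega>" by (rule L2_square_integrable[OF \<Omega> g])
  have gK: "(\<lambda>x. ?W K * (norm (g x))\<^sup>2) absolutely_integrable_on K" if "K \<in> \<T>" for K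
    using set_integrable_subset[OF gi _ K(2)[OF that]] K(1)[OF that]
    by auto
  have pc: "piecewise_const \<T> e x = e K" if "K \<in> \<T>" "x \<in> K" for e :: "(real^2) set \<Rightarrow> real" and K x
  proof -
    have "piecewise_const \<T> e x = (\<Sum>K'\<in>\<T>. if K' = K then e K' else 0)"
      unfolding piecewise_const_def using T(2) that by (intro sum.cong) (auto simp: disjoint_def indicator_def)
    then show ?thesis using T(1) that by (simp add: sum.delta)
  qed
  have eq: "(norm (?w x *\<^sub>R g x))\<^sup>2 = (\<Sum>K\<in>\<T>. if x \<in> K then ?W K * (norm (g x))\<^sup>2 else 0)" for x
  proof (cases "\<exists>K\<in>\<T>. x \<in> K")
    case True
    then obtain K0 where K0: "K0 \<in> \<T>" "x \<in> K0" by blast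
    have "(\<Sum>K\<in>\<T>. if x \<in> K then ?W K * (norm (g x))\<^sup>2 else 0) = (\<Sum>K\<in>\<T>. if K = K0 then ?W K * (norm (g x))\<^sup>2 else 0)"
      using T(2) K0 by (intro sum.cong) (auto simp: disjoint_def)
    then show ?thesis using K0 T(1) by (simp add: sum.delta pc power_mult_distrib)
  next
    case False
    then have "(\<Sum>K\<in>\<T>. if x \<in> K then ?W K * (norm (g x))\<^sup>2 else 0) = 0" by (intro sum.neutral) auto
    \<comment> \<open>On the skeleton \<open>piecewise_const\<close> is 0, and
      \<open>0 powr \<alpha>\<close> is 0 for every exponent, including 0; the weight vanishes there
      and the identity holds pointwise.\<close>
    moreover have "piecewise_const \<T> c x = 0" unfolding piecewise_const_def
      using False by (intro sum.neutral) auto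
    ultimately show ?thesis by simp
  qed
  have int: "(\<lambda>x. if x \<in> K then ?W K * (norm (g x))\<^sup>2 else 0) absolutely_integrable_on \<Omega>" if "K \<in> \<T>" for K
  proof -
    have "(\<lambda>x. indicator \<Omega> x *\<^sub>R (if x \<in> K then ?W K * (norm (g x))\<^sup>2 else 0)) = (\<lambda>x. indicator K x *\<^sub>R (?W K * (norm (g x))\<^sup>2))"
      using K(2)[OF that] by (auto simp: fun_eq_iff indicator_def)
    then show ?thesis using gK[OF that] unfolding set_integrable_def by simp
  qed
  have "(\<lambda>x. (norm (?w x *\<^sub>R g x))\<^sup>2) absolutely_integrable_on \<Omega>"
    unfolding eq using T(1) int by (intro absolutely_integrable_sum) auto
  then have "(L2_norm \<Omega> (\<lambda>x. ?w x *\<^sub>R g x))\<^sup>2 = integral \<Omega> (\<lambda>x. (norm (?w x *\<^sub>R g x))\<^sup>2)"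
    unfolding L2_norm_sq using \<Omega>
    by (intro lebesgue_integral_eq_integral) (auto simp: absolutely_integrable_lebesgue_on)
  also have "\<dots> = (\<Sum>K\<in>\<T>. integral \<Omega> (\<lambda>x. if x \<in> K then ?W K * (norm (g x))\<^sup>2 else 0))"
    unfolding eq using T(1) int by (intro integral_sum) (auto simp: absolutely_integrable_on_def)
  also have "\<dots> = (\<Sum>K\<in>\<T>. ?W K * integral K (\<lambda>x. (norm (g x))\<^sup>2))"
  proof (rule sum.cong[OF refl])
    fix K assume "K \<in> \<T>"
    then have "\<Omega> \<inter> K = K" using K(2) by blast
    then show "integral \<Omega> (\<lambda>x. if x \<in> K then ?W K * (norm (g x))\<^sup>2 else 0) = ?W K * integral K (\<lambda>x. (norm (g x))\<^sup>2)"
      by (simp add: Henstock_Kurzweil_Integration.integral_restrict_Int Int_commute)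
  qed
  finally show ?thesis .
qed

section \<open>Interpolation\<close>

lemma open_reference: "Khat \<in> {ref_square, ref_triangle} \<Longrightarrow> open Khat"
  by (auto simp: ref_square_def ref_triangle_def)

lemma diameter_open_pos:
  fixes K :: "(real^2) set"
  assumes "open K" "bounded K" "K \<noteq> {}"
  shows "0 < diameter K"
proof -
  obtain x where x: "x \<in> K" using assms(3) by blast
  then obtain e where e: "0 < e" "cball x e \<subseteq> K" using assms(1) open_contains_cball by blast
  have "x + e *\<^sub>R axis 1 1 \<in> cball x e" using e(1) by (simp add: dist_norm)
  then have "dist x (x + e *\<^sub>R axis 1 1) \<le> diameter K"
    using e x assms(2) by (intro diameter_bounded_bound) auto
  moreover have "dist x (x + e *\<^sub>R axis 1 1) = e" using e(1) by (simp add: dist_norm)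
  ultimately show ?thesis using e(1) by linarith
qed

text \<open>With a = h / p^2, weights c that are at most a^2 and at most T make the coefficients of
  the element estimate at most 1 and T. The choice c = a^2 with v = 0 will treat \<theta> = 0, and c
  = min(t, a)^2 with T = t^2 the K-functional.\<close>

lemma mesh_estimate:
  fixes c :: "(real^2) set \<Rightarrow> real"
  assumes \<gamma>: "0 < \<gamma>" and \<Omega>: "open \<Omega>" "bounded \<Omega>" and C: "0 < C"
    and elem: "inverse_estimate_const \<gamma> C"
    and mesh: "is_mesh \<Omega> \<T> R F" "mesh_assumption \<Omega> \<T> R F \<gamma>" and p: "\<And>K. K \<in> \<T> \<Longrightarrow> 1 \<le> p K"
    and u: "u \<in> S0 \<Omega> \<T> R F p" "gu \<in> L2 \<Omega>" "has_weak_gradient \<Omega> u gu"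
    and v: "v \<in> L2 \<Omega>" "gv \<in> L2 \<Omega>" "has_weak_gradient \<Omega> v gv"
    and c: "\<And>K. K \<in> \<T> \<Longrightarrow> 0 \<le> c K" "\<And>K. K \<in> \<T> \<Longrightarrow> c K \<le> (diameter K / (real (p K))\<^sup>2)\<^sup>2"
      "\<And>K. K \<in> \<T> \<Longrightarrow> c K \<le> T" and T0: "0 \<le> T"
  shows "(\<Sum>K\<in>\<T>. c K * integral K (\<lambda>x. (norm (gu x))\<^sup>2))
    \<le> C * ((L2_norm \<Omega> (u - v))\<^sup>2 + T * (L2_norm \<Omega> gv)\<^sup>2)"
proof -
  have T: "finite \<T>" "disjoint \<T>" and K: "\<And>K. K \<in> \<T> \<Longrightarrow> open K" "\<And>K. K \<in> \<T> \<Longrightarrow> K \<subseteq> \<Omega>"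
    and RF: "\<And>K. K \<in> \<T> \<Longrightarrow> R K \<in> {ref_square, ref_triangle} \<and> F K ` R K = K"
    using mesh(1) by (auto simp: is_mesh_def)
  have bij: "bij_betw (F K) (closure (R K)) (closure K)" and C1: "C1_on (closure (R K)) (F K)" if "K \<in> \<T>" for K
    using mesh(2) that by (auto simp: mesh_assumption_def)
  have eig: "0 < l \<and> (diameter K)\<^sup>2 / l \<le> \<gamma> \<and> l / (diameter K)\<^sup>2 \<le> \<gamma>"
    if "K \<in> \<T>" "x \<in> R K" "is_eigenvalue (gramian (F K) x) l" for K x l
  proof -
    have "\<forall>K\<in>\<T>. \<forall>x\<in>R K. \<forall>l. is_eigenvalue (gramian (F K) x) l \<longrightarrow>
        0 < l \<and> (diameter K)\<^sup>2 / l \<le> \<gamma> \<and> l / (diameter K)\<^sup>2 \<le> \<gamma>"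
      using mesh(2) unfolding mesh_assumption_def by (elim conjE)
    then show ?thesis using that by blast
  qed
  have uL2: "u \<in> L2 \<Omega>" using u(1) by (simp add: S0_def)
  interpret gp: gradient_pair \<Omega> u v gu gv
    by (rule gradient_pair_L2[OF \<Omega> uL2 u(2,3) v])
  let ?P = "\<lambda>x. (u x - v x)\<^sup>2" and ?G = "\<lambda>x. (norm (gv x))\<^sup>2"
  have sub: "f integrable_on K" if "f absolutely_integrable_on \<Omega>" "K \<in> \<T>" for f :: "real^2 \<Rightarrow> real" and K
    using set_integrable_subset[OF that(1) _ K(2)[OF that(2)]] K(1)[OF that(2)] by (simp add: absolutely_integrable_on_def)
  have nn: "0 \<le> integral K ?P" "0 \<le> integral K ?G" if "K \<in> \<T>" for K
    using sub[OF gp.uv2 that] sub[OF gp.gv2 that] by (auto intro: integral_nonneg)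
  have one: "c K * integral K (\<lambda>x. (norm (gu x))\<^sup>2) \<le> C * (integral K ?P + T * integral K ?G)" if KT: "K \<in> \<T>" for K
  proof (cases "K = {}")
    case False
    have bK: "bounded K" using \<Omega>(2) K(2)[OF KT] by (rule bounded_subset)
    have h: "0 < diameter K" by (rule diameter_open_pos[OF K(1)[OF KT] bK False])
    obtain q where q: "q \<in> poly_ref (R K) (p K)" "AE x in lebesgue_on (R K). (u \<circ> F K) x = q x"
      using u(1) KT by (auto simp: S0_def)
    have "element \<Omega> u v gu gv K (R K) (F K) \<gamma> (p K) q"
    proof
      show "open (R K)" using RF[OF KT] open_reference by blast
      show "F K ` R K = K" using RF[OF KT] by blast
      show "inj_on (F K) (closure (R K))" using bij[OF KT] by (rule bij_betw_imp_inj_on)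
      show "0 < l \<and> (diameter K)\<^sup>2 / l \<le> \<gamma> \<and> l / (diameter K)\<^sup>2 \<le> \<gamma>"
        if "x \<in> R K" "is_eigenvalue (gramian (F K) x) l" for x l
        using eig[OF KT that] .
    qed (use KT K C1 \<gamma> h p q in auto)
    then have "integral K (\<lambda>x. (norm (gu x))\<^sup>2)
        \<le> C * (real (p K) ^ 4 / (diameter K)\<^sup>2 * integral K ?P + integral K ?G)"
      using RF[OF KT] q(1) by (intro elem[unfolded inverse_estimate_const_def, rule_format] conjI) auto
    then have "c K * integral K (\<lambda>x. (norm (gu x))\<^sup>2)
        \<le> c K * (C * (real (p K) ^ 4 / (diameter K)\<^sup>2 * integral K ?P + integral K ?G))"
      using c(1)[OF KT] by (rule mult_left_mono)
    also have "\<dots> = C * ((c K * (real (p K) ^ 4 / (diameter K)\<^sup>2)) * integral K ?P + c K * integral K ?G)"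
      by (simp add: algebra_simps)
    also have "\<dots> \<le> C * (1 * integral K ?P + T * integral K ?G)"
    proof (intro mult_left_mono add_mono mult_right_mono nn KT c(3))
      have p0: "0 < real (p K)" using p[OF KT] by simp
      have "c K * (real (p K) ^ 4 / (diameter K)\<^sup>2)
          \<le> (diameter K / (real (p K))\<^sup>2)\<^sup>2 * (real (p K) ^ 4 / (diameter K)\<^sup>2)"
        by (intro mult_right_mono c(2) KT) auto
      also have "\<dots> = 1" using h p0 by (simp add: power_divide flip: power_mult)
      finally show "c K * (real (p K) ^ 4 / (diameter K)\<^sup>2) \<le> 1" .
    qed (use C in auto)
    finally show ?thesis by simp
  qed simp
  have "(\<Sum>K\<in>\<T>. c K * integral K (\<lambda>x. (norm (gu x))\<^sup>2)) \<le> (\<Sum>K\<in>\<T>. C * (integral K ?P + T * integral K ?G))"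
    by (intro sum_mono one)
  also have "\<dots> = C * ((\<Sum>K\<in>\<T>. integral K ?P) + T * (\<Sum>K\<in>\<T>. integral K ?G))"
    by (simp add: sum.distrib sum_distrib_left distrib_left)
  also have "\<dots> \<le> C * (integral \<Omega> ?P + T * integral \<Omega> ?G)"
    using C T K T0 by (intro mult_left_mono add_mono integral_disjoint_le gp.uv2 gp.gv2) auto
  also have "integral \<Omega> ?P = (L2_norm \<Omega> (u - v))\<^sup>2"
  proof -
    have "integrable (lebesgue_on \<Omega>) ?P" using gp.uv2 absolutely_integrable_lebesgue_on[OF \<Omega>(1)] by blast
    then show ?thesis using \<Omega>(1) by (simp add: L2_norm_sq lebesgue_integral_eq_integral)
  qed
  also have "integral \<Omega> ?G = (L2_norm \<Omega> gv)\<^sup>2"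
    by (rule L2_square_integrable(2)[OF \<Omega>(1) v(2), symmetric])
  finally show ?thesis .
qed

section \<open>The K-functional and its integrals over t\<close>

lemma K2_le:
  assumes "v \<in> X1"
  shows "K2 n0 X1 n1 t u \<le> (n0 (u - v))\<^sup>2 + t\<^sup>2 * (n1 v)\<^sup>2"
  unfolding K2_def using assms by (intro cINF_lower bdd_belowI[of _ 0]) auto

lemma K2_ge:
  assumes "X1 \<noteq> {}" "\<And>v. v \<in> X1 \<Longrightarrow> c \<le> (n0 (u - v))\<^sup>2 + t\<^sup>2 * (n1 v)\<^sup>2"
  shows "c \<le> K2 n0 X1 n1 t u"
  unfolding K2_def using assms by (intro cINF_greatest) auto

lemma nn_integral_real_has_integral:
  fixes f :: "real \<Rightarrow> real"
  assumes "(f has_integral I) UNIV" "\<And>x. 0 \<le> f x"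
  shows "(\<integral>\<^sup>+x. ennreal (f x) \<partial>lborel) = ennreal I"
  using nn_integral_has_integral_lebesgue[of UNIV f I] assms by simp

text \<open>The integrand is t^(-2 \<theta>) t^2 / t, the regime of small t; extension by zero lets
  integrals over intervals of different length be summed on the whole line.\<close>

lemma has_integral_power_below:
  fixes \<theta> a :: real
  assumes "\<theta> < 1" "0 \<le> a"
  shows "((\<lambda>t. if t \<in> {0..a} then t powr (1 - 2 * \<theta>) else 0) has_integral a powr (2 * (1 - \<theta>)) / (2 * (1 - \<theta>))) UNIV"
  using has_integral_powr_from_0[of "1 - 2 * \<theta>" a] assms
  by (simp only: has_integral_restrict_UNIV) (simp add: algebra_simps)

lemma has_integral_power_above:
  fixes \<theta> :: real
  assumes "0 < \<theta>"
  shows "((\<lambda>t. if t \<in> {1..} then t powr (- 1 - 2 * \<theta>) else 0) has_integral 1 / (2 * \<theta>)) UNIV"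
  using has_integral_powr_to_inf[of "- 1 - 2 * \<theta>" 1] assms
  by (simp only: has_integral_restrict_UNIV) simp

text \<open>\<open>K\<^sup>2(t, u)\<close> is at most \<open>t\<^sup>2 \<parallel>u\<parallel>\<^sub>1\<^sup>2\<close>, and at most \<open>\<parallel>u\<parallel>\<^sub>0\<^sup>2\<close>. The element \<open>z\<close> is the zero of \<open>X1\<close>, for which
  the type \<open>'f\<close> provides no constant.\<close>

lemma interp_integral_finite:
  fixes u z :: "'f::minus"
  assumes \<theta>: "0 < \<theta>" "\<theta> < 1" and u: "u \<in> X1" "n0 (u - u) = 0"
    and z: "z \<in> X1" "n1 z = 0"
  shows "(\<integral>\<^sup>+t\<in>{0<..}. ennreal (t powr (-2 * \<theta>) * K2 n0 X1 n1 t u / t) \<partial>lborel) < \<infinity>"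
proof -
  \<comment> \<open>The envelope uses v = u up to t = 1 and v = z beyond.\<close>
  define f where "f t = (n1 u)\<^sup>2 * (if t \<in> {0..1} then t powr (1 - 2 * \<theta>) else 0)
    + (n0 (u - z))\<^sup>2 * (if t \<in> {1..} then t powr (- 1 - 2 * \<theta>) else 0)" for t :: real
  have "(f has_integral (n1 u)\<^sup>2 * (1 powr (2 * (1 - \<theta>)) / (2 * (1 - \<theta>))) + (n0 (u - z))\<^sup>2 * (1 / (2 * \<theta>))) UNIV"
    unfolding f_def using \<theta> by (intro has_integral_add has_integral_mult_right has_integral_power_below has_integral_power_above) auto
  moreover have f0: "0 \<le> f t" for t by (simp add: f_def)
  ultimately have fin: "(\<integral>\<^sup>+t. ennreal (f t) \<partial>lborel) < \<infinity>"
    by (subst nn_integral_real_has_integral) auto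
  have "(\<integral>\<^sup>+t\<in>{0<..}. ennreal (t powr (-2 * \<theta>) * K2 n0 X1 n1 t u / t) \<partial>lborel) \<le> (\<integral>\<^sup>+t. ennreal (f t) \<partial>lborel)"
  proof (rule nn_integral_mono)
    fix t :: real
    show "ennreal (t powr (-2 * \<theta>) * K2 n0 X1 n1 t u / t) * indicator {0<..} t \<le> ennreal (f t)"
    proof (cases "0 < t")
      case t: True
      have pw: "t powr (-2 * \<theta>) / t = t powr (- 1 - 2 * \<theta>)"
        using t by (simp add: powr_diff powr_minus field_simps flip: powr_add)
      have "t powr (-2 * \<theta>) * K2 n0 X1 n1 t u / t = t powr (- 1 - 2 * \<theta>) * K2 n0 X1 n1 t u"
        using pw by (metis times_divide_eq_left)
      also have "\<dots> \<le> f t"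
      proof (cases "t \<le> 1")
        case True
        have "t powr (- 1 - 2 * \<theta>) * K2 n0 X1 n1 t u \<le> t powr (- 1 - 2 * \<theta>) * (t\<^sup>2 * (n1 u)\<^sup>2)"
          using K2_le[OF u(1), of n0 n1 t u] u(2) by (intro mult_left_mono) auto
        also have "\<dots> = (n1 u)\<^sup>2 * (t powr (- 1 - 2 * \<theta>) * t powr 2)" using t by (simp add: powr_numeral)
        also have "\<dots> = (n1 u)\<^sup>2 * t powr (1 - 2 * \<theta>)" by (simp flip: powr_add)
        also have "\<dots> \<le> f t" using t True by (simp add: f_def)
        finally show ?thesis .
      next
        case False
        have "t powr (- 1 - 2 * \<theta>) * K2 n0 X1 n1 t u \<le> t powr (- 1 - 2 * \<theta>) * (n0 (u - z))\<^sup>2"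
          using K2_le[OF z(1), of n0 n1 t u] z(2) by (intro mult_left_mono) auto
        also have "\<dots> \<le> f t" using False by (simp add: f_def)
        finally show ?thesis .
      qed
      finally show ?thesis using t by (simp add: ennreal_leI)
    qed (use f0 in auto)
  qed
  then show ?thesis using fin by (rule le_less_trans)
qed

text \<open>\<open>\<integral>\<^sub>0\<^sup>\<infinity> t\<^sup>-\<^sup>2\<^sup>\<theta> min(t, a)\<^sup>2 dt / t\<close> is bounded below by its part on \<open>(0, a)\<close>.\<close>

lemma interp_integral_lower:
  fixes a G :: "'k \<Rightarrow> real"
  assumes \<theta>: "0 < \<theta>" "\<theta> < 1" and I: "finite I" and a: "\<And>k. k \<in> I \<Longrightarrow> 0 \<le> a k" and G: "\<And>k. k \<in> I \<Longrightarrow> 0 \<le> G k"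
    and C: "0 < C" and le: "\<And>t. 0 < t \<Longrightarrow> (\<Sum>k\<in>I. (min t (a k))\<^sup>2 * G k) \<le> C * \<kappa> t"
    and fin: "(\<integral>\<^sup>+t\<in>{0<..}. ennreal (t powr (-2 * \<theta>) * \<kappa> t / t) \<partial>lborel) < \<infinity>"
  shows "(\<Sum>k\<in>I. a k powr (2 * (1 - \<theta>)) * G k)
    \<le> 2 * C * enn2real (\<integral>\<^sup>+t\<in>{0<..}. ennreal (t powr (-2 * \<theta>) * \<kappa> t / t) \<partial>lborel)"
proof -
  let ?N = "\<integral>\<^sup>+t\<in>{0<..}. ennreal (t powr (-2 * \<theta>) * \<kappa> t / t) \<partial>lborel"
  \<comment> \<open>On (0, a k) the minimum of t and \<open>a k\<close> is t, which leaves a pure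
    power of t; C is moved to this side.\<close>
  define f where "f t = (\<Sum>k\<in>I. G k / C * (if t \<in> {0..a k} then t powr (1 - 2 * \<theta>) else 0))" for t
  define S where "S = (\<Sum>k\<in>I. G k / C * (a k powr (2 * (1 - \<theta>)) / (2 * (1 - \<theta>))))"
  have "(f has_integral S) UNIV"
    unfolding f_def S_def using \<theta> I a by (intro has_integral_sum has_integral_mult_right has_integral_power_below) auto
  moreover have "0 \<le> f t" for t unfolding f_def using G C by (intro sum_nonneg mult_nonneg_nonneg) auto
  ultimately have "ennreal S = (\<integral>\<^sup>+t. ennreal (f t) \<partial>lborel)"
    by (rule nn_integral_real_has_integral[symmetric])
  also have "\<dots> \<le> ?N"
  proof (rule nn_integral_mono)
    fix t :: real
    show "ennreal (f t) \<le> ennreal (t powr (-2 * \<theta>) * \<kappa> t / t) * indicator {0<..} t"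
    proof (cases "0 < t")
      case t: True
      have pw: "t powr (-2 * \<theta>) / t = t powr (- 1 - 2 * \<theta>)"
        using t by (simp add: powr_diff powr_minus field_simps flip: powr_add)
      have "f t \<le> t powr (- 1 - 2 * \<theta>) * ((\<Sum>k\<in>I. (min t (a k))\<^sup>2 * G k) / C)"
        unfolding f_def sum_divide_distrib sum_distrib_left
      proof (rule sum_mono)
        fix k assume k: "k \<in> I"
        have "t powr (1 - 2 * \<theta>) = t powr (- 1 - 2 * \<theta>) * t\<^sup>2"
          using t powr_add[of t "- 1 - 2 * \<theta>" 2] by (simp add: powr_numeral)
        then show "G k / C * (if t \<in> {0..a k} then t powr (1 - 2 * \<theta>) else 0)
            \<le> t powr (- 1 - 2 * \<theta>) * ((min t (a k))\<^sup>2 * G k / C)"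
          using t G[OF k] C by (auto simp: min_def mult_ac)
      qed
      also have "\<dots> \<le> t powr (- 1 - 2 * \<theta>) * \<kappa> t"
        using le[OF t] C by (intro mult_left_mono) (auto simp: field_simps)
      also have "\<dots> = t powr (-2 * \<theta>) * \<kappa> t / t" using pw by (metis times_divide_eq_left)
      finally show ?thesis using t by (simp add: ennreal_leI)
    next
      case False
      have "f t = 0" unfolding f_def using False by (intro sum.neutral) auto
      then show ?thesis by simp
    qed
  qed
  also have "?N = ennreal (enn2real ?N)" using fin by simp
  finally have "S \<le> enn2real ?N" by (simp add: ennreal_le_iff)
  \<comment> \<open>The power integral contributes the factor 2 (1 - \<theta>), at most 2, so one
    constant serves all \<theta>.\<close>
  moreover have "(\<Sum>k\<in>I. a k powr (2 * (1 - \<theta>)) * G k) = 2 * (1 - \<theta>) * C * S"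
    unfolding S_def sum_distrib_left using \<theta> C by (intro sum.cong) auto
  moreover have "0 \<le> S" unfolding S_def using G C \<theta> by (intro sum_nonneg) auto
  moreover have "2 * (1 - \<theta>) * C * S \<le> 2 * C * S" using \<open>0 \<le> S\<close> \<theta> C by (intro mult_right_mono) auto
  ultimately show ?thesis using C by (smt (verit) mult_left_mono mult_pos_pos)
qed

text \<open>Identifies the squared weight of the theorem as a power of the element scale h / p^2. At
  h = 0 both sides are 0 by the convention for \<open>powr\<close>.\<close>

lemma weight_eq:
  fixes h p s :: real
  assumes "0 \<le> h" "1 \<le> p"
  shows "(h powr s * p powr (- 2 * s))\<^sup>2 = (h / p\<^sup>2) powr (2 * s)"
proof -
  have sq: "(x powr e)\<^sup>2 = x powr (2 * e)" for x e :: real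
    by (simp add: power2_eq_square flip: powr_add)
  have p: "0 < p" using assms by simp
  have "(p\<^sup>2) powr (2 * s) = p powr (2 * (2 * s))"
    using p powr_powr[of p 2 "2 * s"] by (simp add: powr_numeral)
  moreover have "(h / p\<^sup>2) powr (2 * s) = h powr (2 * s) / (p\<^sup>2) powr (2 * s)"
    using assms by (intro powr_divide; simp)
  moreover have "p powr (2 * (- 2 * s)) = inverse (p powr (2 * (2 * s)))"
    by (simp flip: powr_minus)
  ultimately have "(h / p\<^sup>2) powr (2 * s) = h powr (2 * s) * p powr (2 * (- 2 * s))"
    by (simp only: divide_inverse)
  then show ?thesis by (simp only: power_mult_distrib sq)
qed

text \<open>X1 stands for H^1 or its subspace with zero trace. The estimates hold for every v in
  H^1, hence for v in X1, and 0 in X1 provides the competitor for large t.\<close>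

lemma inverse_estimate_interpolation:
  assumes \<gamma>: "0 < \<gamma>" and \<Omega>: "open \<Omega>" "bounded \<Omega>" and C: "0 < C"
    and elem: "inverse_estimate_const \<gamma> C"
    and \<theta>: "0 \<le> \<theta>" "\<theta> \<le> 1"
    and mesh: "is_mesh \<Omega> \<T> R F" "mesh_assumption \<Omega> \<T> R F \<gamma>" and p: "\<And>K. K \<in> \<T> \<Longrightarrow> 1 \<le> p K"
    and X1: "X1 \<subseteq> H1 \<Omega>" "(\<lambda>x. 0) \<in> X1" and u: "u \<in> S0 \<Omega> \<T> R F p" "u \<in> X1"
  shows "L2_norm \<Omega> (\<lambda>x. (piecewise_const \<T> diameter x powr (1 - \<theta>)
      * piecewise_const \<T> (\<lambda>K. real (p K)) x powr (-2 * (1 - \<theta>))) *\<^sub>R weak_gradient \<Omega> u x)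
    \<le> sqrt (2 * C + 1) * interp_norm (L2_norm \<Omega>) X1 (H1_norm \<Omega>) \<theta> u" (is "?L \<le> _ * ?N")
proof -
  have T: "finite \<T>" "disjoint \<T>" and K: "\<And>K. K \<in> \<T> \<Longrightarrow> open K" "\<And>K. K \<in> \<T> \<Longrightarrow> K \<subseteq> \<Omega>"
    using mesh(1) by (auto simp: is_mesh_def)
  have uH: "u \<in> H1 \<Omega>" using u(2) X1(1) by blast
  define gu where "gu = weak_gradient \<Omega> u"
  note g = weak_gradient_H1[OF uH, folded gu_def]
  define G where "G K = integral K (\<lambda>x. (norm (gu x))\<^sup>2)" for K
  define a where "a K = diameter K / (real (p K))\<^sup>2" for K
  have gi: "(\<lambda>x. (norm (gu x))\<^sup>2) absolutely_integrable_on \<Omega>" by (rule L2_square_integrable[OF \<Omega>(1) g(2)])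
  have G: "0 \<le> G K" if "K \<in> \<T>" for K
    using set_integrable_subset[OF gi _ K(2)[OF that]] K(1)[OF that] unfolding G_def
    by (auto simp: absolutely_integrable_on_def intro: integral_nonneg)
  have d: "0 \<le> diameter K" if "K \<in> \<T>" for K
    using bounded_subset[OF \<Omega>(2) K(2)[OF that]] by (rule diameter_ge_0)
  have a: "0 \<le> a K" if "K \<in> \<T>" for K using d[OF that] by (simp add: a_def)
  have L: "?L\<^sup>2 = (\<Sum>K\<in>\<T>. a K powr (2 * (1 - \<theta>)) * G K)"
    unfolding gu_def[symmetric]
  proof (rule trans[OF weighted_norm_sq[OF \<Omega>(1) g(2) T]], goal_cases)
    case 3
    show ?case unfolding G_def[symmetric]
    proof (rule sum.cong[OF refl])
    fix K assume "K \<in> \<T>"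
    then show "(diameter K powr (1 - \<theta>) * real (p K) powr (-2 * (1 - \<theta>)))\<^sup>2 * G K = a K powr (2 * (1 - \<theta>)) * G K"
      using weight_eq[of "diameter K" "real (p K)" "1 - \<theta>"] d p unfolding a_def by simp
    qed
  qed (use K in auto)
  have est: "(\<Sum>K\<in>\<T>. c K * G K) \<le> C * ((L2_norm \<Omega> (u - v))\<^sup>2 + M * (L2_norm \<Omega> gv)\<^sup>2)"
    if "v \<in> L2 \<Omega>" "gv \<in> L2 \<Omega>" "has_weak_gradient \<Omega> v gv"
      "\<And>K. K \<in> \<T> \<Longrightarrow> 0 \<le> c K" "\<And>K. K \<in> \<T> \<Longrightarrow> c K \<le> (a K)\<^sup>2" "\<And>K. K \<in> \<T> \<Longrightarrow> c K \<le> M" "0 \<le> M"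
    for v gv c M
    unfolding G_def using that
    by (intro mesh_estimate[OF \<gamma> \<Omega> C elem mesh p u(1) g(2,3)]) (auto simp: a_def)
  have N0: "0 \<le> ?N"
    by (auto simp: interp_norm_def L2_norm_nonneg H1_norm_nonneg)
  have diff_0: "u - (\<lambda>x. 0) = u" by (simp add: fun_eq_iff)
  have "?L\<^sup>2 \<le> (2 * C + 1) * ?N\<^sup>2"
  proof -
    consider "\<theta> = 0" | "\<theta> = 1" | "0 < \<theta>" "\<theta> < 1" using \<theta> by linarith
    then show ?thesis
    proof cases
      case 1
      have "a K powr 2 = (a K)\<^sup>2" if "K \<in> \<T>" for K
        using a[OF that] by (cases "a K = 0") (auto simp: powr_numeral)
      then have "?L\<^sup>2 = (\<Sum>K\<in>\<T>. (a K)\<^sup>2 * G K)" unfolding L using 1 by simp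
      \<comment> \<open>v = 0 with the zero field as gradient; the sum of the weights is merely a
        common majorant, and it is multiplied by 0.\<close>
      also have "\<dots> \<le> C * ((L2_norm \<Omega> (u - (\<lambda>x. 0)))\<^sup>2 + (\<Sum>K\<in>\<T>. (a K)\<^sup>2) * (L2_norm \<Omega> (\<lambda>x. 0 :: real^2))\<^sup>2)"
        using T(1) by (intro est zero_L2 zero_weak_gradient) (auto intro: member_le_sum sum_nonneg)
      also have "\<dots> = C * ?N\<^sup>2" using 1 by (simp add: zero_L2 diff_0 interp_norm_def)
      also have "\<dots> \<le> (2 * C + 1) * ?N\<^sup>2" using C by (intro mult_right_mono) auto
      finally show ?thesis .
    next
      case 2
      \<comment> \<open>The exponent is 0, so each \<open>a K powr 0\<close> is at most 1, and the
        gradient part of the H1 norm is all that enters.\<close>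
      have "?L\<^sup>2 \<le> (\<Sum>K\<in>\<T>. G K)"
        unfolding L using 2 G by (intro sum_mono) (auto intro!: mult_left_le_one_le)
      also have "\<dots> \<le> integral \<Omega> (\<lambda>x. (norm (gu x))\<^sup>2)"
        unfolding G_def using T K by (intro integral_disjoint_le gi) auto
      also have "\<dots> = (L2_norm \<Omega> gu)\<^sup>2" by (rule L2_square_integrable(2)[OF \<Omega>(1) g(2), symmetric])
      also have "\<dots> \<le> ?N\<^sup>2" using 2 by (simp add: interp_norm_def H1_norm_sq gu_def)
      also have "\<dots> \<le> (2 * C + 1) * ?N\<^sup>2" using C mult_right_mono[of 1 "2 * C + 1" "?N\<^sup>2"] by simp
      finally show ?thesis .
    next
      case 3
      let ?\<kappa> = "\<lambda>t. K2 (L2_norm \<Omega>) X1 (H1_norm \<Omega>) t u"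
      let ?I = "\<integral>\<^sup>+t\<in>{0<..}. ennreal (t powr (-2 * \<theta>) * ?\<kappa> t / t) \<partial>lborel"
      have "L2_norm \<Omega> (u - u) = 0"
        using zero_L2(2)[where 'b = real] by (simp add: fun_diff_def)
      \<comment> \<open>Finiteness matters: \<open>enn2real\<close> would turn an infinite integral
        into 0, and no lower bound for the norm would survive.\<close>
      then have fin: "?I < \<infinity>"
        using 3 u(2) X1(2) H1_norm_zero[OF \<Omega>] by (intro interp_integral_finite)
      have "(\<Sum>K\<in>\<T>. (min t (a K))\<^sup>2 * G K) \<le> C * ?\<kappa> t" if t: "0 < t" for t
      proof -
        have "(\<Sum>K\<in>\<T>. (min t (a K))\<^sup>2 * G K) / C \<le> ?\<kappa> t"
        proof (rule K2_ge)
          fix v assume "v \<in> X1"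
          then have v: "v \<in> H1 \<Omega>" using X1(1) by blast
          have "(\<Sum>K\<in>\<T>. (min t (a K))\<^sup>2 * G K)
            \<le> C * ((L2_norm \<Omega> (u - v))\<^sup>2 + t\<^sup>2 * (L2_norm \<Omega> (weak_gradient \<Omega> v))\<^sup>2)"
            using t a by (intro est weak_gradient_H1[OF v] power_mono) auto
          also have "\<dots> \<le> C * ((L2_norm \<Omega> (u - v))\<^sup>2 + t\<^sup>2 * (H1_norm \<Omega> v)\<^sup>2)"
            using C by (intro mult_left_mono add_mono) (auto simp: H1_norm_sq)
          finally show "(\<Sum>K\<in>\<T>. (min t (a K))\<^sup>2 * G K) / C \<le> (L2_norm \<Omega> (u - v))\<^sup>2 + t\<^sup>2 * (H1_norm \<Omega> v)\<^sup>2"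
            using C by (simp add: field_simps)
        qed (use X1(2) in auto)
        then show ?thesis using C by (simp add: field_simps)
      qed
      from interp_integral_lower[OF 3 T(1) a G C this fin]
      have "?L\<^sup>2 \<le> 2 * C * enn2real ?I" unfolding L .
      also have "enn2real ?I = ?N\<^sup>2" using 3 by (simp add: interp_norm_def)
      also have "2 * C * ?N\<^sup>2 \<le> (2 * C + 1) * ?N\<^sup>2" by (intro mult_right_mono) auto
      finally show ?thesis .
    qed
  qed
  also have "(2 * C + 1) * ?N\<^sup>2 = (sqrt (2 * C + 1) * ?N)\<^sup>2" using C by (simp add: power_mult_distrib)
  finally show ?thesis
    using N0 C by (elim power2_le_imp_le) auto
qed

theorem lemma3p2:
  fixes \<Omega> :: "(real^2) set" and \<theta> \<gamma> :: real
  assumes "lipschitz_polygonal_domain \<Omega>"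
    and "0 \<le> \<theta>" and "\<theta> \<le> 1"
    and "0 < \<gamma>"
  shows "\<exists>C>0. \<forall>\<T> R F p.
    is_mesh \<Omega> \<T> R F \<and> mesh_assumption \<Omega> \<T> R F \<gamma> \<and>
    (\<forall>K\<in>\<T>. 1 \<le> p K) \<and> degree_assumption \<T> R F p \<longrightarrow>
    (let hf = piecewise_const \<T> diameter;
         pf = piecewise_const \<T> (\<lambda>K. real (p K))
     in
      (\<forall>u\<in>S1 \<Omega> \<T> R F p.
         L2_norm \<Omega> (\<lambda>x. (hf x powr (1 - \<theta>) * pf x powr (-2 * (1 - \<theta>))) *\<^sub>R weak_gradient \<Omega> u x)
         \<le> C * interp_norm (L2_norm \<Omega>) (H1 \<Omega>) (H1_norm \<Omega>) \<theta> u) \<and>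
      (\<forall>u\<in>S1_tilde \<Omega> \<T> R F p.
         L2_norm \<Omega> (\<lambda>x. (hf x powr (1 - \<theta>) * pf x powr (-2 * (1 - \<theta>))) *\<^sub>R weak_gradient \<Omega> u x)
         \<le> C * interp_norm (L2_norm \<Omega>) (H1_tilde \<Omega>) (H1_norm \<Omega>) \<theta> u))"
proof -
  have \<Omega>: "open \<Omega>" "bounded \<Omega>" using assms(1) by (auto simp: lipschitz_polygonal_domain_def)
  \<comment> \<open>C is fixed before the mesh, the degrees and the discrete function enter.\<close>
  obtain C where C: "0 < C" and elem: "inverse_estimate_const \<gamma> C"
    using element_estimate[OF assms(4)] by (elim exE conjE) (rule that)
  note bound = inverse_estimate_interpolation[OF assms(4) \<Omega> C elem assms(2,3)]
  show ?thesis
    unfolding Let_def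
  proof (intro exI[of _ "sqrt (2 * C + 1)"] conjI allI impI ballI)
    show "0 < sqrt (2 * C + 1)" using C by simp
  next
    fix \<T> R F p u
    assume *: "is_mesh \<Omega> \<T> R F \<and> mesh_assumption \<Omega> \<T> R F \<gamma> \<and>
        (\<forall>K\<in>\<T>. 1 \<le> p K) \<and> degree_assumption \<T> R F p" and u: "u \<in> S1 \<Omega> \<T> R F p"
    show "L2_norm \<Omega> (\<lambda>x. (piecewise_const \<T> diameter x powr (1 - \<theta>)
        * piecewise_const \<T> (\<lambda>K. real (p K)) x powr (-2 * (1 - \<theta>))) *\<^sub>R weak_gradient \<Omega> u x)
      \<le> sqrt (2 * C + 1) * interp_norm (L2_norm \<Omega>) (H1 \<Omega>) (H1_norm \<Omega>) \<theta> u"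
      using * u zero_H1 by (intro bound) (auto simp: S1_def)
  next
    fix \<T> R F p u
    assume *: "is_mesh \<Omega> \<T> R F \<and> mesh_assumption \<Omega> \<T> R F \<gamma> \<and>
        (\<forall>K\<in>\<T>. 1 \<le> p K) \<and> degree_assumption \<T> R F p" and u: "u \<in> S1_tilde \<Omega> \<T> R F p"
    show "L2_norm \<Omega> (\<lambda>x. (piecewise_const \<T> diameter x powr (1 - \<theta>)
        * piecewise_const \<T> (\<lambda>K. real (p K)) x powr (-2 * (1 - \<theta>))) *\<^sub>R weak_gradient \<Omega> u x)
      \<le> sqrt (2 * C + 1) * interp_norm (L2_norm \<Omega>) (H1_tilde \<Omega>) (H1_norm \<Omega>) \<theta> u"
      using * u zero_H1_tilde[OF \<Omega>] by (intro bound) (auto simp: S1_tilde_def H1_tilde_def)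
  qed
qed

end
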